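(* Let $(R,\mathfrak m)$ be a commutative noetherian local ring and $I$ an ideal of $R$. For every $R$-module $M$ the following hold. (a) $IM\subset\gamma(M)\subset M[\operatorname{Ann}_R(I)]$ and $\operatorname{Ann}_R(I)\cdot M\subset\kappa(M)\subset M[I]$. (b) $\gamma(M)$ is an essential submodule of $M[\operatorname{Ann}_R(I)]$, and $\kappa(M)/\operatorname{Ann}_R(I)\cdot M$ is a small (superfluous) submodule of $M/\operatorname{Ann}_R(I)\cdot M$. (c) $\operatorname{Ass}(\gamma(M))=\operatorname{Ass}(M)\cap\operatorname{Supp}(I)$ and $\operatorname{Koass}(M/\kappa(M))=\operatorname{Koass}(M)\cap\operatorname{Supp}(I)$.
   Context: $E$ is the injective hull of the residue field $R/\mathfrak m$, and $M^\circ=\operatorname{Hom}_R(M,E)$ is the Matlis dual of an $R$-module $M$; in particular $I^\circ=\operatorname{Hom}_R(I,E)$. $\mathcal P$ is the class of all $I$-generated $R$-modules $M$ (there is an epimorphism $I^{(\Lambda)}\twoheadrightarrow M$ from a direct sum of copies of $I$), and $\mathcal S$ is the class of all $I^\circ$-cogenerated $R$-modules $N$ (there is a monomorphism $N\hookrightarrow(I^\circ)^\Lambda$ into a direct product of copies of $I^\circ$). For an $R$-module $M$, $\gamma(M)=\sum\{U\subset M\mid U\in\mathcal P\}$ is the largest submodule of $M$ belonging to $\mathcal P$, and $\kappa(M)=\bigcap\{V\subset M\mid M/V\in\mathcal S\}$ is the smallest submodule $V$ of $M$ with $M/V\in\mathcal S$. For an ideal $\mathfrak a$ of $R$, $M[\mathfrak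 a]=\{x\in M\mid ax=0\text{ for all }a\in\mathfrak a\}$. A submodule $U\subset M$ is essential if it meets every nonzero submodule of $M$ nontrivially; a submodule $U\subset M$ is small if $U+V\neq M$ for every proper submodule $V\subsetneq M$. $\operatorname{Ass}(M)$ is the set of associated primes of $M$; $\operatorname{Supp}(I)=\{\mathfrak p\in\operatorname{Spec}(R)\mid I_{\mathfrak p}\neq0\}$. $\operatorname{Koass}(M)$ is the set of coassociated primes of $M$, i.e. prime ideals $\mathfrak p$ of the form $\mathfrak p=\operatorname{Ann}_R(M/U)$ with $U\subset M$ a submodule such that $M/U$ is artinian; equivalently $\operatorname{Koass}(M)=\operatorname{Ass}(M^\circ)$. *)

theory Defs
  imports "HOL-Algebra.Algebra"
begin

section \<open>Modules over a commutative ring\<close>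

definition local_ring_at :: "('r, 'x) ring_scheme \<Rightarrow> 'r set \<Rightarrow> bool" where
  "local_ring_at R \<mm> \<longleftrightarrow>
     cring R \<and> maximalideal \<mm> R \<and> (\<forall>J. maximalideal J R \<longrightarrow> J = \<mm>)"

text \<open>The record type of modules also has the ring fields \<open>mult\<close> and \<open>one\<close>, which are irrelevant
  for the locale \<^locale>\<open>module\<close> and are left unspecified in the constructions below.\<close>

definition make_module ::
  "'m set \<Rightarrow> 'm \<Rightarrow> ('m \<Rightarrow> 'm \<Rightarrow> 'm) \<Rightarrow> ('r \<Rightarrow> 'm \<Rightarrow> 'm) \<Rightarrow> ('r, 'm) module" where
  "make_module C z p s =
     \<lparr>carrier = C, monoid.mult = undefined, one = undefined, ring.zero = z, add = p, smult = s\<rparr>"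

definition regular_module :: "('r, 'x) ring_scheme \<Rightarrow> ('r, 'r) module" where
  "regular_module R = make_module (carrier R) \<zero>\<^bsub>R\<^esub> (\<lambda>x y. x \<oplus>\<^bsub>R\<^esub> y) (\<lambda>a x. a \<otimes>\<^bsub>R\<^esub> x)"

definition ideal_module :: "('r, 'x) ring_scheme \<Rightarrow> 'r set \<Rightarrow> ('r, 'r) module" where
  "ideal_module R I = (regular_module R)\<lparr>carrier := I\<rparr>"

definition quot_module :: "('r, 'm) module \<Rightarrow> 'm set \<Rightarrow> ('r, 'm set) module" where
  "quot_module M U =
     make_module (a_rcosets\<^bsub>M\<^esub> U) U (set_add M) (\<lambda>a C. \<Union>x\<in>C. U +>\<^bsub>M\<^esub> (a \<odot>\<^bsub>M\<^esub> x))"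

definition module_hom ::
  "('r, 'x) ring_scheme \<Rightarrow> ('r, 'm) module \<Rightarrow> ('r, 'n) module \<Rightarrow> ('m \<Rightarrow> 'n) set" where
  "module_hom R A B =
     {f \<in> carrier A \<rightarrow> carrier B.
        (\<forall>x\<in>carrier A. \<forall>y\<in>carrier A. f (x \<oplus>\<^bsub>A\<^esub> y) = f x \<oplus>\<^bsub>B\<^esub> f y) \<and>
        (\<forall>a\<in>carrier R. \<forall>x\<in>carrier A. f (a \<odot>\<^bsub>A\<^esub> x) = a \<odot>\<^bsub>B\<^esub> f x)}"

definition hom_module ::
  "('r, 'x) ring_scheme \<Rightarrow> ('r, 'm) module \<Rightarrow> ('r, 'n) module \<Rightarrow> ('r, 'm \<Rightarrow> 'n) module" where
  "hom_module R A B =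
     make_module (module_hom R A B \<inter> extensional (carrier A))
       (\<lambda>x\<in>carrier A. \<zero>\<^bsub>B\<^esub>)
       (\<lambda>f g. \<lambda>x\<in>carrier A. f x \<oplus>\<^bsub>B\<^esub> g x)
       (\<lambda>a f. \<lambda>x\<in>carrier A. a \<odot>\<^bsub>B\<^esub> f x)"

definition direct_power :: "'i set \<Rightarrow> ('r, 'm) module \<Rightarrow> ('r, 'i \<Rightarrow> 'm) module" where
  "direct_power \<Lambda> A =
     make_module (\<Lambda> \<rightarrow>\<^sub>E carrier A)
       (\<lambda>i\<in>\<Lambda>. \<zero>\<^bsub>A\<^esub>)
       (\<lambda>x y. \<lambda>i\<in>\<Lambda>. x i \<oplus>\<^bsub>A\<^esub> y i)
       (\<lambda>a x. \<lambda>i\<in>\<Lambda>. a \<odot>\<^bsub>A\<^esub> x i)"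

definition direct_copower :: "'i set \<Rightarrow> ('r, 'm) module \<Rightarrow> ('r, 'i \<Rightarrow> 'm) module" where
  "direct_copower \<Lambda> A =
     (direct_power \<Lambda> A)\<lparr>carrier := {x \<in> \<Lambda> \<rightarrow>\<^sub>E carrier A. finite {i\<in>\<Lambda>. x i \<noteq> \<zero>\<^bsub>A\<^esub>}}\<rparr>"

definition generated_submodule ::
  "('r, 'x) ring_scheme \<Rightarrow> ('r, 'm) module \<Rightarrow> 'm set \<Rightarrow> 'm set" where
  "generated_submodule R M G = \<Inter>{W. submodule W R M \<and> G \<subseteq> W}"

text \<open>The product \<open>\<aa>M\<close>.\<close>

definition ideal_times_module ::
  "('r, 'x) ring_scheme \<Rightarrow> 'r set \<Rightarrow> ('r, 'm) module \<Rightarrow> 'm set" where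
  "ideal_times_module R \<aa> M = generated_submodule R M {a \<odot>\<^bsub>M\<^esub> x |a x. a \<in> \<aa> \<and> x \<in> carrier M}"

definition annihilator :: "('r, 'x) ring_scheme \<Rightarrow> ('r, 'm) module \<Rightarrow> 'r set" where
  "annihilator R M = {a \<in> carrier R. \<forall>x\<in>carrier M. a \<odot>\<^bsub>M\<^esub> x = \<zero>\<^bsub>M\<^esub>}"

text \<open>The submodule \<open>M[\<aa>]\<close>.\<close>

definition annihilated_by :: "('r, 'm) module \<Rightarrow> 'r set \<Rightarrow> 'm set" where
  "annihilated_by M \<aa> = {x \<in> carrier M. \<forall>a\<in>\<aa>. a \<odot>\<^bsub>M\<^esub> x = \<zero>\<^bsub>M\<^esub>}"

definition essential_submodule ::
  "('r, 'x) ring_scheme \<Rightarrow> ('r, 'm) module \<Rightarrow> 'm set \<Rightarrow> bool" where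
  "essential_submodule R M U \<longleftrightarrow>
     submodule U R M \<and> (\<forall>W. submodule W R M \<and> W \<noteq> {\<zero>\<^bsub>M\<^esub>} \<longrightarrow> U \<inter> W \<noteq> {\<zero>\<^bsub>M\<^esub>})"

definition small_submodule ::
  "('r, 'x) ring_scheme \<Rightarrow> ('r, 'm) module \<Rightarrow> 'm set \<Rightarrow> bool" where
  "small_submodule R M U \<longleftrightarrow>
     submodule U R M \<and> (\<forall>V. submodule V R M \<and> V \<noteq> carrier M \<longrightarrow> U <+>\<^bsub>M\<^esub> V \<noteq> carrier M)"

definition artinian_module :: "('r, 'x) ring_scheme \<Rightarrow> ('r, 'm) module \<Rightarrow> bool" where
  "artinian_module R M \<longleftrightarrow>
     (\<forall>W :: nat \<Rightarrow> 'm set. (\<forall>n. submodule (W n) R M) \<and> (\<forall>n. W (Suc n) \<subseteq> W n) \<longrightarrow>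
        (\<exists>n. \<forall>k\<ge>n. W k = W n))"


section \<open>Injective hulls and Matlis duals\<close>

text \<open>HOL has no quantification over all types, so the lifting property is required for the test
  modules \<open>A\<close>, \<open>B\<close> whose elements are taken from the type \<open>'r\<close> of ring elements. These include
  \<open>R\<close> itself and all its ideals, so by Baer's criterion this is injectivity with respect to
  modules over arbitrary types.\<close>

definition injective_module :: "('r, 'x) ring_scheme \<Rightarrow> ('r, 'e) module \<Rightarrow> bool" where
  "injective_module R E \<longleftrightarrow>
     module R E \<and>
     (\<forall>(A :: ('r, 'r) module) (B :: ('r, 'r) module). \<forall>i g.
        module R A \<and> module R B \<and>
        i \<in> module_hom R A B \<and> inj_on i (carrier A) \<and> g \<in> module_hom R A E \<longrightarrow>
        (\<exists>h\<in>module_hom R B E. \<forall>x\<in>carrier A. h (i x) = g x))"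

definition injective_hull ::
  "('r, 'x) ring_scheme \<Rightarrow> ('r, 'm) module \<Rightarrow> ('r, 'e) module \<Rightarrow> bool" where
  "injective_hull R K E \<longleftrightarrow>
     injective_module R E \<and>
     (\<exists>j\<in>module_hom R K E. inj_on j (carrier K) \<and> essential_submodule R E (j ` carrier K))"

abbreviation residue_field_module ::
  "('r, 'x) ring_scheme \<Rightarrow> 'r set \<Rightarrow> ('r, 'r set) module" where
  "residue_field_module R \<mm> \<equiv> quot_module (regular_module R) \<mm>"

abbreviation matlis_dual ::
  "('r, 'x) ring_scheme \<Rightarrow> ('r, 'e) module \<Rightarrow> ('r, 'm) module \<Rightarrow> ('r, 'm \<Rightarrow> 'e) module" where
  "matlis_dual R E M \<equiv> hom_module R M E"


section \<open>Generated and cogenerated modules\<close>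

text \<open>The index sets \<open>\<Lambda>\<close> below are sets of functions of the type of homomorphisms \<open>A \<rightarrow> M\<close>
  (respectively \<open>N \<rightarrow> C\<close>). This is no restriction: for an epimorphism from a direct sum over any
  index type, indices with the same component \<open>A \<rightarrow> M\<close> can be identified, and dually for
  monomorphisms into a product.\<close>

definition generated_by ::
  "('r, 'x) ring_scheme \<Rightarrow> ('r, 'a) module \<Rightarrow> ('r, 'm) module \<Rightarrow> bool" where
  "generated_by R A M \<longleftrightarrow>
     (\<exists>\<Lambda> :: ('a \<Rightarrow> 'm) set. \<exists>f\<in>module_hom R (direct_copower \<Lambda> A) M.
        f ` carrier (direct_copower \<Lambda> A) = carrier M)"

definition cogenerated_by ::
  "('r, 'x) ring_scheme \<Rightarrow> ('r, 'c) module \<Rightarrow> ('r, 'n) module \<Rightarrow> bool" where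
  "cogenerated_by R C N \<longleftrightarrow>
     (\<exists>\<Lambda> :: ('n \<Rightarrow> 'c) set. \<exists>f\<in>module_hom R N (direct_power \<Lambda> C).
        inj_on f (carrier N))"

text \<open>The sum of a family of submodules is the submodule generated by its union.\<close>

definition gamma :: "('r, 'x) ring_scheme \<Rightarrow> 'r set \<Rightarrow> ('r, 'm) module \<Rightarrow> 'm set" where
  "gamma R I M =
     generated_submodule R M
       (\<Union>{U. submodule U R M \<and> generated_by R (ideal_module R I) (M\<lparr>carrier := U\<rparr>)})"

definition kappa ::
  "('r, 'x) ring_scheme \<Rightarrow> ('r, 'e) module \<Rightarrow> 'r set \<Rightarrow> ('r, 'm) module \<Rightarrow> 'm set" where
  "kappa R E I M =
     \<Inter>{V. submodule V R M \<and>
          cogenerated_by R (matlis_dual R E (ideal_module R I)) (quot_module M V)}"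


section \<open>Associated primes, coassociated primes and support\<close>

definition Ass :: "('r, 'x) ring_scheme \<Rightarrow> ('r, 'm) module \<Rightarrow> 'r set set" where
  "Ass R M =
     {\<pp>. primeideal \<pp> R \<and> (\<exists>x\<in>carrier M. \<pp> = {a \<in> carrier R. a \<odot>\<^bsub>M\<^esub> x = \<zero>\<^bsub>M\<^esub>})}"

definition Koass :: "('r, 'x) ring_scheme \<Rightarrow> ('r, 'm) module \<Rightarrow> 'r set set" where
  "Koass R M =
     {\<pp>. primeideal \<pp> R \<and>
        (\<exists>U. submodule U R M \<and> artinian_module R (quot_module M U) \<and>
             \<pp> = annihilator R (quot_module M U))}"

text \<open>The localization \<open>S\<inverse>M\<close> as an \<open>R\<close>-module; a fraction \<open>x/s\<close> is the equivalence class of \<open>(x, s)\<close>.\<close>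

definition fraction_rel :: "('r, 'm) module \<Rightarrow> 'r set \<Rightarrow> (('m \<times> 'r) \<times> ('m \<times> 'r)) set" where
  "fraction_rel M S =
     {((x, s), (y, t)) |x s y t.
        x \<in> carrier M \<and> y \<in> carrier M \<and> s \<in> S \<and> t \<in> S \<and>
        (\<exists>u\<in>S. u \<odot>\<^bsub>M\<^esub> (t \<odot>\<^bsub>M\<^esub> x \<ominus>\<^bsub>M\<^esub> s \<odot>\<^bsub>M\<^esub> y) = \<zero>\<^bsub>M\<^esub>)}"

definition localization ::
  "('r, 'x) ring_scheme \<Rightarrow> ('r, 'm) module \<Rightarrow> 'r set \<Rightarrow> ('r, ('m \<times> 'r) set) module" where
  "localization R M S =
     make_module ((carrier M \<times> S) // fraction_rel M S)
       (fraction_rel M S `` {(\<zero>\<^bsub>M\<^esub>, \<one>\<^bsub>R\<^esub>)})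
       (\<lambda>C D. \<Union>(x, s)\<in>C. \<Union>(y, t)\<in>D.
          fraction_rel M S `` {(t \<odot>\<^bsub>M\<^esub> x \<oplus>\<^bsub>M\<^esub> s \<odot>\<^bsub>M\<^esub> y, s \<otimes>\<^bsub>R\<^esub> t)})
       (\<lambda>a C. \<Union>(x, s)\<in>C. fraction_rel M S `` {(a \<odot>\<^bsub>M\<^esub> x, s)})"

definition Supp :: "('r, 'x) ring_scheme \<Rightarrow> ('r, 'm) module \<Rightarrow> 'r set set" where
  "Supp R M =
     {\<pp>. primeideal \<pp> R \<and>
        carrier (localization R M (carrier R - \<pp>))
          \<noteq> {\<zero>\<^bsub>localization R M (carrier R - \<pp>)\<^esub>}}"

end

theory Submission
  imports Defs
begin

text \<open>The submodule \<open>\<gamma>(M)\<close> is the sum of the images of all homomorphisms \<open>I \<rightarrow> M\<close>. Homomorphisms \<open>M \<rightarrow> I\<degree>\<close> and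
  homomorphisms \<open>I \<rightarrow> M\<degree>\<close> are the same thing, namely bilinear maps \<open>M \<times> I \<rightarrow> E\<close>; hence \<open>\<kappa>(M)\<close> consists of
  the elements of \<open>M\<close> at which \<open>\<gamma>(M\<degree>)\<close> vanishes (\<open>kappa_eq_annihilated\<close>). So the claims on \<open>\<kappa>(M)\<close> are
  dual to those on \<open>\<gamma>(M)\<close>, applied to the module \<open>M\<degree>\<close>. The passage back to \<open>M\<close> uses that
  homomorphisms to \<open>E\<close> separate the points outside a submodule from it (\<open>hom_separating\<close>).

  The inclusions in (a) are direct. Parts (b) and (c) rest on one fact
  (\<open>hom_from_ideal_onto_multiple\<close>): if the annihilator \<open>\<pp>\<close> of \<open>w\<close> is prime and contains \<open>Ann(I)\<close>, then
  the image of some homomorphism from \<open>I\<close> contains \<open>tw\<close> for some \<open>t \<notin> \<pp>\<close>. Locally at \<open>\<pp>\<close> this is the map from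
  \<open>I\<close> onto a simple quotient. Every nonzero submodule of \<open>M[Ann(I)]\<close> contains such an element \<open>w\<close>, and
  \<open>tw \<noteq> 0\<close>, so \<open>\<gamma>(M)\<close> is essential there. For (c) note that \<open>tw\<close> has the annihilator \<open>\<pp>\<close> as well and
  that \<open>Supp(I)\<close> consists of the primes containing \<open>Ann(I)\<close> (\<open>Supp_ideal_module\<close>).

  For the dual claims, let \<open>V\<close> be a proper submodule containing \<open>Ann(I)M\<close>. The homomorphisms
  \<open>M \<rightarrow> E\<close> that vanish on \<open>V\<close> form a nonzero submodule of \<open>M\<degree>[Ann(I)]\<close>, which meets \<open>\<gamma>(M\<degree>)\<close>; thus some
  nonzero homomorphism vanishes on \<open>\<kappa>(M) + V\<close>, which is therefore not all of \<open>M\<close>. A coassociated prime \<open>\<pp>\<close> of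
  \<open>M\<close> is the annihilator of a homomorphism \<open>h: M \<rightarrow> E\<close> that factors through an artinian quotient
  (\<open>Koass_imp_annihilator_of_hom\<close>). If \<open>\<pp>\<close> contains \<open>Ann(I)\<close>, then a multiple \<open>th\<close> in \<open>\<gamma>(M\<degree>)\<close> with \<open>t \<notin> \<pp>\<close>
  exhibits \<open>\<pp>\<close> as a coassociated prime of \<open>M/\<kappa>(M)\<close>.\<close>

section \<open>Modules, submodules and homomorphisms\<close>

lemma make_module_simps [simp]:
  "carrier (make_module C z p s) = C"
  "\<zero>\<^bsub>make_module C z p s\<^esub> = z"
  "x \<oplus>\<^bsub>make_module C z p s\<^esub> y = p x y"
  "a \<odot>\<^bsub>make_module C z p s\<^esub> x = s a x"
  by (simp_all add: make_module_def)

text \<open>Additive inverses need not be constructed: multiplication by \<open>-1\<close> provides them.\<close>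

lemma module_from_smultI:
  fixes R (structure) and M (structure)
  assumes "cring R"
    and "\<And>x y. \<lbrakk>x \<in> carrier M; y \<in> carrier M\<rbrakk> \<Longrightarrow> x \<oplus>\<^bsub>M\<^esub> y \<in> carrier M"
    and "\<zero>\<^bsub>M\<^esub> \<in> carrier M"
    and "\<And>x y z. \<lbrakk>x \<in> carrier M; y \<in> carrier M; z \<in> carrier M\<rbrakk>
           \<Longrightarrow> (x \<oplus>\<^bsub>M\<^esub> y) \<oplus>\<^bsub>M\<^esub> z = x \<oplus>\<^bsub>M\<^esub> (y \<oplus>\<^bsub>M\<^esub> z)"
    and "\<And>x y. \<lbrakk>x \<in> carrier M; y \<in> carrier M\<rbrakk> \<Longrightarrow> x \<oplus>\<^bsub>M\<^esub> y = y \<oplus>\<^bsub>M\<^esub> x"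
    and "\<And>x. x \<in> carrier M \<Longrightarrow> \<zero>\<^bsub>M\<^esub> \<oplus>\<^bsub>M\<^esub> x = x"
    and "\<And>a x. \<lbrakk>a \<in> carrier R; x \<in> carrier M\<rbrakk> \<Longrightarrow> a \<odot>\<^bsub>M\<^esub> x \<in> carrier M"
    and "\<And>a b x. \<lbrakk>a \<in> carrier R; b \<in> carrier R; x \<in> carrier M\<rbrakk>
           \<Longrightarrow> (a \<oplus> b) \<odot>\<^bsub>M\<^esub> x = a \<odot>\<^bsub>M\<^esub> x \<oplus>\<^bsub>M\<^esub> b \<odot>\<^bsub>M\<^esub> x"
    and "\<And>a x y. \<lbrakk>a \<in> carrier R; x \<in> carrier M; y \<in> carrier M\<rbrakk>
           \<Longrightarrow> a \<odot>\<^bsub>M\<^esub> (x \<oplus>\<^bsub>M\<^esub> y) = a \<odot>\<^bsub>M\<^esub> x \<oplus>\<^bsub>M\<^esub> a \<odot>\<^bsub>M\<^esub> y"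
    and "\<And>a b x. \<lbrakk>a \<in> carrier R; b \<in> carrier R; x \<in> carrier M\<rbrakk>
           \<Longrightarrow> (a \<otimes> b) \<odot>\<^bsub>M\<^esub> x = a \<odot>\<^bsub>M\<^esub> (b \<odot>\<^bsub>M\<^esub> x)"
    and "\<And>x. x \<in> carrier M \<Longrightarrow> \<one> \<odot>\<^bsub>M\<^esub> x = x"
    and "\<And>x. x \<in> carrier M \<Longrightarrow> \<zero> \<odot>\<^bsub>M\<^esub> x = \<zero>\<^bsub>M\<^esub>"
  shows "module R M"
proof -
  interpret cring R by fact
  have "\<exists>y\<in>carrier M. y \<oplus>\<^bsub>M\<^esub> x = \<zero>\<^bsub>M\<^esub>" if x: "x \<in> carrier M" for x
  proof (rule bexI[of _ "(\<ominus> \<one>) \<odot>\<^bsub>M\<^esub> x"])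
    have "(\<ominus> \<one>) \<odot>\<^bsub>M\<^esub> x \<oplus>\<^bsub>M\<^esub> x = (\<ominus> \<one> \<oplus> \<one>) \<odot>\<^bsub>M\<^esub> x"
      using x assms(8,11) by simp
    then show "(\<ominus> \<one>) \<odot>\<^bsub>M\<^esub> x \<oplus>\<^bsub>M\<^esub> x = \<zero>\<^bsub>M\<^esub>"
      using x assms(12) by (simp add: l_neg)
  qed (use x assms(7) in simp)
  then have "abelian_group M"
    using assms(2-6) by (intro abelian_groupI) auto
  then show ?thesis
    using assms by (intro moduleI) auto
qed

lemma (in module) a_inv_eq_smult: "x \<in> carrier M \<Longrightarrow> \<ominus>\<^bsub>M\<^esub> x = (\<ominus> \<one>) \<odot>\<^bsub>M\<^esub> x"
  by (simp add: smult_l_minus)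

lemma (in module) smult_swap:
  "\<lbrakk>a \<in> carrier R; b \<in> carrier R; x \<in> carrier M\<rbrakk> \<Longrightarrow> a \<odot>\<^bsub>M\<^esub> (b \<odot>\<^bsub>M\<^esub> x) = b \<odot>\<^bsub>M\<^esub> (a \<odot>\<^bsub>M\<^esub> x)"
  by (simp add: smult_assoc1[symmetric] m_comm)

lemma (in module) minus_eq_zero_imp_eq:
  assumes "x \<in> carrier M" "y \<in> carrier M" "x \<ominus>\<^bsub>M\<^esub> y = \<zero>\<^bsub>M\<^esub>"
  shows "x = y"
  using M.minus_equality[of x "\<ominus>\<^bsub>M\<^esub> y"] assms by (simp add: M.minus_eq)

lemma (in module) submodule_iff:
  "submodule H R M \<longleftrightarrow>
     H \<subseteq> carrier M \<and> \<zero>\<^bsub>M\<^esub> \<in> H \<and> (\<forall>x\<in>H. \<forall>y\<in>H. x \<oplus>\<^bsub>M\<^esub> y \<in> H) \<and>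
     (\<forall>a\<in>carrier R. \<forall>x\<in>H. a \<odot>\<^bsub>M\<^esub> x \<in> H)"
proof
  assume *: "submodule H R M"
  then have "\<zero>\<^bsub>M\<^esub> \<in> H"
    using subgroup.one_closed[OF submodule.axioms(1)] by fastforce
  with * show "H \<subseteq> carrier M \<and> \<zero>\<^bsub>M\<^esub> \<in> H \<and> (\<forall>x\<in>H. \<forall>y\<in>H. x \<oplus>\<^bsub>M\<^esub> y \<in> H) \<and>
     (\<forall>a\<in>carrier R. \<forall>x\<in>H. a \<odot>\<^bsub>M\<^esub> x \<in> H)"
    using submoduleE(1,4,5)[OF *] by blast
next
  assume *: "H \<subseteq> carrier M \<and> \<zero>\<^bsub>M\<^esub> \<in> H \<and> (\<forall>x\<in>H. \<forall>y\<in>H. x \<oplus>\<^bsub>M\<^esub> y \<in> H) \<and>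
     (\<forall>a\<in>carrier R. \<forall>x\<in>H. a \<odot>\<^bsub>M\<^esub> x \<in> H)"
  then have "\<ominus>\<^bsub>M\<^esub> x \<in> H" if "x \<in> H" for x
    using that a_inv_eq_smult[of x] by auto
  with * show "submodule H R M"
    by (intro submoduleI) auto
qed

lemma (in cring) ideal_iff:
  "ideal H R \<longleftrightarrow>
     H \<subseteq> carrier R \<and> \<zero> \<in> H \<and> (\<forall>x\<in>H. \<forall>y\<in>H. x \<oplus> y \<in> H) \<and> (\<forall>a\<in>carrier R. \<forall>x\<in>H. a \<otimes> x \<in> H)"
proof
  assume "ideal H R"
  then interpret ideal H R .
  show "H \<subseteq> carrier R \<and> \<zero> \<in> H \<and> (\<forall>x\<in>H. \<forall>y\<in>H. x \<oplus> y \<in> H) \<and> (\<forall>a\<in>carrier R. \<forall>x\<in>H. a \<otimes> x \<in> H)"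
    using a_subset I_l_closed by auto
next
  assume *: "H \<subseteq> carrier R \<and> \<zero> \<in> H \<and> (\<forall>x\<in>H. \<forall>y\<in>H. x \<oplus> y \<in> H) \<and> (\<forall>a\<in>carrier R. \<forall>x\<in>H. a \<otimes> x \<in> H)"
  then have sub: "H \<subseteq> carrier R" and mul: "\<And>a x. \<lbrakk>a \<in> carrier R; x \<in> H\<rbrakk> \<Longrightarrow> a \<otimes> x \<in> H"
    by blast+
  have neg: "\<ominus> x \<in> H" if "x \<in> H" for x
    using mul[of "\<ominus> \<one>" x] that sub by (auto simp: l_minus)
  have mul': "x \<otimes> a \<in> H" if "x \<in> H" "a \<in> carrier R" for a x
    using mul[OF that(2,1)] m_comm[of a x] that sub by auto
  show "ideal H R"
  proof (rule idealI[OF ring_axioms])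
    show "subgroup H (add_monoid R)"
      by (rule add.subgroupI) (use * neg in blast)+
  qed (use mul mul' in blast)+
qed

lemma (in cring) regular_module_is_module: "module R (regular_module R)"
  unfolding regular_module_def
  by (rule module_from_smultI) (auto simp: is_cring a_ac m_assoc l_distr r_distr)

lemma ideal_module_simps [simp]:
  "carrier (ideal_module R I) = I"
  "\<zero>\<^bsub>ideal_module R I\<^esub> = \<zero>\<^bsub>R\<^esub>"
  "x \<oplus>\<^bsub>ideal_module R I\<^esub> y = x \<oplus>\<^bsub>R\<^esub> y"
  "a \<odot>\<^bsub>ideal_module R I\<^esub> x = a \<otimes>\<^bsub>R\<^esub> x"
  by (simp_all add: ideal_module_def regular_module_def make_module_def)

lemma regular_module_simps [simp]:
  "carrier (regular_module R) = carrier R"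
  "\<zero>\<^bsub>regular_module R\<^esub> = \<zero>\<^bsub>R\<^esub>"
  "x \<oplus>\<^bsub>regular_module R\<^esub> y = x \<oplus>\<^bsub>R\<^esub> y"
  "a \<odot>\<^bsub>regular_module R\<^esub> x = a \<otimes>\<^bsub>R\<^esub> x"
  by (simp_all add: regular_module_def)

lemma (in cring) submodule_regular_module_iff:
  "submodule H R (regular_module R) \<longleftrightarrow> ideal H R"
  by (simp add: module.submodule_iff[OF regular_module_is_module] ideal_iff)

lemma (in cring) ideal_module_is_module:
  assumes "ideal I R"
  shows "module R (ideal_module R I)"
  using submodule.submodule_is_module[OF _ regular_module_is_module, of I] assms
  by (simp add: submodule_regular_module_iff ideal_module_def)

lemma module_homI:
  assumes "\<And>x. x \<in> carrier A \<Longrightarrow> f x \<in> carrier B"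
    and "\<And>x y. \<lbrakk>x \<in> carrier A; y \<in> carrier A\<rbrakk> \<Longrightarrow> f (x \<oplus>\<^bsub>A\<^esub> y) = f x \<oplus>\<^bsub>B\<^esub> f y"
    and "\<And>a x. \<lbrakk>a \<in> carrier R; x \<in> carrier A\<rbrakk> \<Longrightarrow> f (a \<odot>\<^bsub>A\<^esub> x) = a \<odot>\<^bsub>B\<^esub> f x"
  shows "f \<in> module_hom R A B"
  using assms by (simp add: module_hom_def)

lemma module_homD:
  assumes "f \<in> module_hom R A B"
  shows "x \<in> carrier A \<Longrightarrow> f x \<in> carrier B"
    and "\<lbrakk>x \<in> carrier A; y \<in> carrier A\<rbrakk> \<Longrightarrow> f (x \<oplus>\<^bsub>A\<^esub> y) = f x \<oplus>\<^bsub>B\<^esub> f y"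
    and "\<lbrakk>a \<in> carrier R; x \<in> carrier A\<rbrakk> \<Longrightarrow> f (a \<odot>\<^bsub>A\<^esub> x) = a \<odot>\<^bsub>B\<^esub> f x"
  using assms by (auto simp: module_hom_def)

lemma module_hom_zero:
  assumes "module R A" "module R B" "f \<in> module_hom R A B"
  shows "f \<zero>\<^bsub>A\<^esub> = \<zero>\<^bsub>B\<^esub>"
proof -
  interpret A: module R A by fact
  interpret B: module R B by fact
  show ?thesis
    using module_homD(1)[OF assms(3), of "\<zero>\<^bsub>A\<^esub>"]
      module_homD(3)[OF assms(3), of "\<zero>\<^bsub>R\<^esub>" "\<zero>\<^bsub>A\<^esub>"] by simp
qed

lemma module_hom_minus:
  assumes "module R A" "module R B" "f \<in> module_hom R A B" "x \<in> carrier A" "y \<in> carrier A"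
  shows "f (x \<ominus>\<^bsub>A\<^esub> y) = f x \<ominus>\<^bsub>B\<^esub> f y"
proof -
  interpret A: module R A by fact
  interpret B: module R B by fact
  show ?thesis
    using assms module_homD[OF assms(3)]
    by (simp add: a_minus_def A.a_inv_eq_smult B.a_inv_eq_smult)
qed

text \<open>With this rule the module axioms for a quotient follow from the values of its operations on cosets of
  representatives.\<close>

lemma module_of_surj_image:
  assumes A: "module R A" and f: "f \<in> module_hom R A B"
    and surj: "carrier B = f ` carrier A" and zero: "f \<zero>\<^bsub>A\<^esub> = \<zero>\<^bsub>B\<^esub>"
  shows "module R B"
proof -
  interpret A: module R A by fact
  note h = module_homD[OF f]
  note h' = h(2,3)[symmetric]
  show ?thesis
  proof (rule module_from_smultI)
    show "cring R" by (rule A.R.is_cring)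
    show "\<zero>\<^bsub>B\<^esub> \<in> carrier B" unfolding zero[symmetric] by (simp add: h(1))
    show "x \<oplus>\<^bsub>B\<^esub> y \<in> carrier B" if "x \<in> carrier B" "y \<in> carrier B" for x y
      using that unfolding surj by (elim imageE) (simp add: h')
    show "a \<odot>\<^bsub>B\<^esub> x \<in> carrier B" if "a \<in> carrier R" "x \<in> carrier B" for a x
      using that unfolding surj by (elim imageE) (simp add: h')
    show "(x \<oplus>\<^bsub>B\<^esub> y) \<oplus>\<^bsub>B\<^esub> z = x \<oplus>\<^bsub>B\<^esub> (y \<oplus>\<^bsub>B\<^esub> z)"
      if "x \<in> carrier B" "y \<in> carrier B" "z \<in> carrier B" for x y z
      using that unfolding surj by (elim imageE) (simp add: h' A.M.a_assoc)
    show "x \<oplus>\<^bsub>B\<^esub> y = y \<oplus>\<^bsub>B\<^esub> x" if "x \<in> carrier B" "y \<in> carrier B" for x y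
      using that unfolding surj by (elim imageE) (simp add: h' A.M.a_comm)
    show "\<zero>\<^bsub>B\<^esub> \<oplus>\<^bsub>B\<^esub> x = x" if "x \<in> carrier B" for x
      using that unfolding surj zero[symmetric] by (elim imageE) (simp add: h')
    show "(a \<oplus>\<^bsub>R\<^esub> b) \<odot>\<^bsub>B\<^esub> x = a \<odot>\<^bsub>B\<^esub> x \<oplus>\<^bsub>B\<^esub> b \<odot>\<^bsub>B\<^esub> x"
      if "a \<in> carrier R" "b \<in> carrier R" "x \<in> carrier B" for a b x
      using that unfolding surj by (elim imageE) (simp add: h' A.smult_l_distr)
    show "a \<odot>\<^bsub>B\<^esub> (x \<oplus>\<^bsub>B\<^esub> y) = a \<odot>\<^bsub>B\<^esub> x \<oplus>\<^bsub>B\<^esub> a \<odot>\<^bsub>B\<^esub> y"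
      if "a \<in> carrier R" "x \<in> carrier B" "y \<in> carrier B" for a x y
      using that unfolding surj by (elim imageE) (simp add: h' A.smult_r_distr)
    show "(a \<otimes>\<^bsub>R\<^esub> b) \<odot>\<^bsub>B\<^esub> x = a \<odot>\<^bsub>B\<^esub> (b \<odot>\<^bsub>B\<^esub> x)"
      if "a \<in> carrier R" "b \<in> carrier R" "x \<in> carrier B" for a b x
      using that unfolding surj by (elim imageE) (simp add: h' A.smult_assoc1)
    show "\<one>\<^bsub>R\<^esub> \<odot>\<^bsub>B\<^esub> x = x" if "x \<in> carrier B" for x
      using that unfolding surj by (elim imageE) (simp add: h')
    show "\<zero>\<^bsub>R\<^esub> \<odot>\<^bsub>B\<^esub> x = \<zero>\<^bsub>B\<^esub>" if "x \<in> carrier B" for x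
      using that unfolding surj by (elim imageE) (simp add: h' zero)
  qed
qed

text \<open>Several homomorphisms below are defined by a choice, such as that of \<open>r\<close> with \<open>ty \<in> rx + K\<close>. Given by
  their graphs, they need no choice, and that they are well defined is the hypothesis on uniqueness.\<close>

lemma module_hom_of_graph:
  assumes "\<And>x. x \<in> carrier A \<Longrightarrow> \<exists>u. G x u"
    and uniq: "\<And>x u u'. \<lbrakk>G x u; G x u'\<rbrakk> \<Longrightarrow> u = u'"
    and "\<And>x u. \<lbrakk>x \<in> carrier A; G x u\<rbrakk> \<Longrightarrow> u \<in> carrier B"
    and "\<And>x y u v. \<lbrakk>x \<in> carrier A; y \<in> carrier A; G x u; G y v\<rbrakk> \<Longrightarrow> G (x \<oplus>\<^bsub>A\<^esub> y) (u \<oplus>\<^bsub>B\<^esub> v)"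
    and "\<And>a x u. \<lbrakk>a \<in> carrier R; x \<in> carrier A; G x u\<rbrakk> \<Longrightarrow> G (a \<odot>\<^bsub>A\<^esub> x) (a \<odot>\<^bsub>B\<^esub> u)"
  shows "\<exists>f\<in>module_hom R A B. \<forall>x u. G x u \<longrightarrow> f x = u"
proof -
  define f where "f x = (THE u. G x u)" for x
  have f: "f x = u" if "G x u" for x u
    unfolding f_def using that uniq by blast
  have "f \<in> module_hom R A B"
  proof (rule module_homI)
    fix x assume x: "x \<in> carrier A"
    then obtain u where u: "G x u" using assms(1) by blast
    then show "f x \<in> carrier B" using assms(3)[OF x u] f by simp
    show "f (a \<odot>\<^bsub>A\<^esub> x) = a \<odot>\<^bsub>B\<^esub> f x" if "a \<in> carrier R" for a
      using f[OF assms(5)[OF that x u]] f[OF u] by simp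
    fix y assume y: "y \<in> carrier A"
    then obtain v where v: "G y v" using assms(1) by blast
    show "f (x \<oplus>\<^bsub>A\<^esub> y) = f x \<oplus>\<^bsub>B\<^esub> f y"
      using f[OF assms(4)[OF x y u v]] f[OF u] f[OF v] by simp
  qed
  with f show ?thesis by blast
qed

lemma submodule_image:
  assumes "module R A" "module R B" "f \<in> module_hom R A B" "submodule W R A"
  shows "submodule (f ` W) R B"
proof -
  interpret A: module R A by fact
  interpret B: module R B by fact
  note W = assms(4)[unfolded A.submodule_iff]
  note f = module_homD[OF assms(3)]
  have W': "x \<in> W \<Longrightarrow> x \<in> carrier A" for x using W by blast
  show ?thesis
    unfolding B.submodule_iff
  proof (intro conjI)
    show "f ` W \<subseteq> carrier B" using W' f by auto
    show "\<zero>\<^bsub>B\<^esub> \<in> f ` W" using module_hom_zero[OF assms(1-3)] W by force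
    show "\<forall>x\<in>f ` W. \<forall>y\<in>f ` W. x \<oplus>\<^bsub>B\<^esub> y \<in> f ` W"
      using W W' by (auto simp: f(2)[symmetric])
    show "\<forall>a\<in>carrier R. \<forall>x\<in>f ` W. a \<odot>\<^bsub>B\<^esub> x \<in> f ` W"
      using W W' by (auto simp: f(3)[symmetric])
  qed
qed

lemma submodule_vimage:
  assumes "module R A" "module R B" "f \<in> module_hom R A B" "submodule W R B"
  shows "submodule {x \<in> carrier A. f x \<in> W} R A"
proof -
  interpret A: module R A by fact
  interpret B: module R B by fact
  note W = assms(4)[unfolded B.submodule_iff]
  note f = module_homD[OF assms(3)]
  show ?thesis
    unfolding A.submodule_iff
    using f module_hom_zero[OF assms(1-3)] W by auto
qed

lemma (in module) zero_submodule: "submodule {\<zero>\<^bsub>M\<^esub>} R M"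
  by (auto simp: submodule_iff)

lemma submodule_kernel:
  assumes "module R A" "module R B" "f \<in> module_hom R A B"
  shows "submodule {x \<in> carrier A. f x = \<zero>\<^bsub>B\<^esub>} R A"
  using submodule_vimage[OF assms module.zero_submodule[OF assms(2)]] by simp

lemma (in module) submodule_Inter:
  assumes "\<W> \<noteq> {}" "\<And>W. W \<in> \<W> \<Longrightarrow> submodule W R M"
  shows "submodule (\<Inter>\<W>) R M"
  using assms unfolding submodule_iff by blast

text \<open>The locale \<^locale>\<open>module\<close> leaves the record extension of \<open>M\<close> open, whereas quotients, generated submodules,
  \<open>\<gamma>\<close> and \<open>\<kappa>\<close> are defined for the unextended record type only.\<close>

locale plain_module = module R M
  for R :: "('r, 'x) ring_scheme" (structure) and M :: "('r, 'm) module" (structure)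

lemma (in plain_module) generated_submodule_is_submodule:
  assumes "G \<subseteq> carrier M"
  shows "submodule (generated_submodule R M G) R M"
  unfolding generated_submodule_def
  using assms carrier_is_submodule by (intro submodule_Inter) auto

lemma generated_submodule_subset: "G \<subseteq> generated_submodule R M G"
  unfolding generated_submodule_def by blast

lemma generated_submodule_least:
  "\<lbrakk>submodule W R M; G \<subseteq> W\<rbrakk> \<Longrightarrow> generated_submodule R M G \<subseteq> W"
  unfolding generated_submodule_def by blast

lemma (in module) submodule_restrict_iff:
  assumes "submodule H R M"
  shows "submodule W R (M\<lparr>carrier := H\<rparr>) \<longleftrightarrow> submodule W R M \<and> W \<subseteq> H"
proof -
  interpret H: module R "M\<lparr>carrier := H\<rparr>"
    using submodule.submodule_is_module[OF assms module_axioms] .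
  show ?thesis
    using assms unfolding H.submodule_iff submodule_iff by auto
qed

lemma (in plain_module) annihilated_by_submodule:
  assumes "\<aa> \<subseteq> carrier R"
  shows "submodule (annihilated_by M \<aa>) R M"
proof -
  have "a \<odot>\<^bsub>M\<^esub> (b \<odot>\<^bsub>M\<^esub> x) = \<zero>\<^bsub>M\<^esub>"
    if "a \<in> carrier R" "b \<in> carrier R" "x \<in> carrier M" "a \<odot>\<^bsub>M\<^esub> x = \<zero>\<^bsub>M\<^esub>" for a b x
    using that by (simp add: smult_swap[of a b])
  with assms show ?thesis
    unfolding submodule_iff annihilated_by_def
    by (auto simp: smult_r_distr subset_iff)
qed

lemma (in module) annihilator_ideal: 
  assumes "x \<in> carrier M"
  shows "ideal {a \<in> carrier R. a \<odot>\<^bsub>M\<^esub> x = \<zero>\<^bsub>M\<^esub>} R"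
  unfolding ideal_iff
  using assms by (auto simp: smult_l_distr smult_assoc1)

lemma (in module) conductor_ideal:
  assumes "submodule V R M" "x \<in> carrier M"
  shows "ideal {a \<in> carrier R. a \<odot>\<^bsub>M\<^esub> x \<in> V} R"
  unfolding ideal_iff
  using assms unfolding submodule_iff
  by (auto simp: smult_l_distr smult_assoc1)

section \<open>Quotient modules\<close>

context plain_module
begin

context
  fixes U
  assumes U: "submodule U R M"
begin

interpretation abelian_subgroup U M
  by (intro abelian_subgroupI3 additive_subgroupI submodule.axioms(1)[OF U] M.abelian_group_axioms)

lemma coset_eq_iff:
  assumes "x \<in> carrier M" "y \<in> carrier M"
  shows "U +>\<^bsub>M\<^esub> x = U +>\<^bsub>M\<^esub> y \<longleftrightarrow> x \<ominus>\<^bsub>M\<^esub> y \<in> U"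
proof -
  have "U +>\<^bsub>M\<^esub> x = U +>\<^bsub>M\<^esub> y \<longleftrightarrow> x \<in> U +>\<^bsub>M\<^esub> y"
  proof
    show "x \<in> U +>\<^bsub>M\<^esub> y" if "U +>\<^bsub>M\<^esub> x = U +>\<^bsub>M\<^esub> y"
      using a_rcos_self[OF assms(1)] unfolding that .
    show "U +>\<^bsub>M\<^esub> x = U +>\<^bsub>M\<^esub> y" if "x \<in> U +>\<^bsub>M\<^esub> y"
      using a_repr_independence'[OF that assms(2)] by (rule sym)
  qed
  then show ?thesis
    using a_rcos_module[of y x] assms by (simp add: a_minus_def)
qed

lemma coset_eq_submodule_iff:
  assumes "x \<in> carrier M"
  shows "U +>\<^bsub>M\<^esub> x = U \<longleftrightarrow> x \<in> U"
proof
  show "x \<in> U" if "U +>\<^bsub>M\<^esub> x = U"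
    using a_rcos_self[OF assms] unfolding that .
qed (rule a_rcos_const)

lemma quot_module_carrier: "carrier (quot_module M U) = (\<lambda>x. U +>\<^bsub>M\<^esub> x) ` carrier M"
  by (auto simp: quot_module_def A_RCOSETS_def')

lemma quot_module_zero: "\<zero>\<^bsub>quot_module M U\<^esub> = U"
  by (simp add: quot_module_def)

lemma quot_module_add:
  assumes "x \<in> carrier M" "y \<in> carrier M"
  shows "(U +>\<^bsub>M\<^esub> x) \<oplus>\<^bsub>quot_module M U\<^esub> (U +>\<^bsub>M\<^esub> y) = U +>\<^bsub>M\<^esub> (x \<oplus>\<^bsub>M\<^esub> y)"
  using assms by (simp add: quot_module_def a_rcos_sum)

lemma quot_module_smult:
  assumes a: "a \<in> carrier R" and x: "x \<in> carrier M"
  shows "a \<odot>\<^bsub>quot_module M U\<^esub> (U +>\<^bsub>M\<^esub> x) = U +>\<^bsub>M\<^esub> (a \<odot>\<^bsub>M\<^esub> x)"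
proof -
  have const: "U +>\<^bsub>M\<^esub> (a \<odot>\<^bsub>M\<^esub> y) = U +>\<^bsub>M\<^esub> (a \<odot>\<^bsub>M\<^esub> x)" if y: "y \<in> U +>\<^bsub>M\<^esub> x" for y
  proof -
    have yM: "y \<in> carrier M" using y x a_elemrcos_carrier by blast
    have "y \<ominus>\<^bsub>M\<^esub> x \<in> U" using y x a_rcos_module_imp by (simp add: a_minus_def)
    then have "a \<odot>\<^bsub>M\<^esub> (y \<ominus>\<^bsub>M\<^esub> x) \<in> U" using submoduleE(4)[OF U a] by blast
    moreover have "a \<odot>\<^bsub>M\<^esub> (y \<ominus>\<^bsub>M\<^esub> x) = a \<odot>\<^bsub>M\<^esub> y \<ominus>\<^bsub>M\<^esub> a \<odot>\<^bsub>M\<^esub> x"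
      using a x yM by (simp add: a_minus_def smult_r_distr smult_r_minus)
    ultimately show ?thesis
      using a x yM by (simp add: coset_eq_iff)
  qed
  have "U +>\<^bsub>M\<^esub> x \<noteq> {}" using x a_rcos_self by blast
  then show ?thesis
    unfolding quot_module_def make_module_simps by (rule SUP_eq_const) (rule const)
qed

lemma coset_hom: "(\<lambda>x. U +>\<^bsub>M\<^esub> x) \<in> module_hom R M (quot_module M U)"
  by (rule module_homI) (simp_all add: quot_module_carrier quot_module_add quot_module_smult)

lemma quot_module_is_module: "module R (quot_module M U)"
proof (rule module_of_surj_image[OF module_axioms coset_hom])
  show "carrier (quot_module M U) = (\<lambda>x. U +>\<^bsub>M\<^esub> x) ` carrier M"
    by (rule quot_module_carrier)
  show "U +>\<^bsub>M\<^esub> \<zero>\<^bsub>M\<^esub> = \<zero>\<^bsub>quot_module M U\<^esub>"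
    using U by (simp add: submodule_iff quot_module_zero)
qed

lemma coset_kernel: "{x \<in> carrier M. U +>\<^bsub>M\<^esub> x = \<zero>\<^bsub>quot_module M U\<^esub>} = U"
proof -
  have "U \<subseteq> carrier M" using U by (simp add: submodule_iff)
  moreover have "{x \<in> carrier M. U +>\<^bsub>M\<^esub> x = U} = {x \<in> carrier M. x \<in> U}"
    using coset_eq_submodule_iff by (intro Collect_cong conj_cong refl)
  ultimately show ?thesis
    unfolding quot_module_zero by blast
qed

end

end

section \<open>Maximal elements and associated primes\<close>

lemma (in noetherian_ring) maximal_ideal_in_family:
  assumes "\<K> \<noteq> {}" "\<And>K. K \<in> \<K> \<Longrightarrow> ideal K R"
  obtains K where "K \<in> \<K>" "\<And>L. \<lbrakk>L \<in> \<K>; K \<subseteq> L\<rbrakk> \<Longrightarrow> L = K"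
proof -
  have "\<exists>K\<in>\<K>. \<forall>L\<in>\<K>. K \<subseteq> L \<longrightarrow> L = K"
  proof (rule subset_Zorn_nonempty[OF assms(1)])
    fix C assume C: "C \<noteq> {}" "subset.chain \<K> C"
    then have C': "C \<subseteq> \<K>" by (simp add: subset_chain_def)
    have "subset.chain {I. ideal I R} C"
      using C(2) C' assms(2) by (auto simp: subset_chain_def)
    then have "\<Union>C \<in> C" by (rule ideal_chain_is_trivial[OF C(1)])
    with C' show "\<Union>C \<in> \<K>" by (rule subsetD)
  qed
  then show thesis using that by metis
qed

abbreviation ann_of :: "('r, 'x) ring_scheme \<Rightarrow> ('r, 'm) module \<Rightarrow> 'm \<Rightarrow> 'r set" where
  "ann_of R M x \<equiv> {a \<in> carrier R. a \<odot>\<^bsub>M\<^esub> x = \<zero>\<^bsub>M\<^esub>}"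

lemma (in plain_module) ann_of_prime_multiple:
  assumes "primeideal (ann_of R M w) R" "w \<in> carrier M" "t \<in> carrier R" "t \<notin> ann_of R M w"
  shows "ann_of R M (t \<odot>\<^bsub>M\<^esub> w) = ann_of R M w"
proof -
  have "a \<odot>\<^bsub>M\<^esub> (t \<odot>\<^bsub>M\<^esub> w) = \<zero>\<^bsub>M\<^esub> \<longleftrightarrow> a \<odot>\<^bsub>M\<^esub> w = \<zero>\<^bsub>M\<^esub>" if a: "a \<in> carrier R" for a
  proof
    assume "a \<odot>\<^bsub>M\<^esub> (t \<odot>\<^bsub>M\<^esub> w) = \<zero>\<^bsub>M\<^esub>"
    then have "a \<otimes> t \<in> ann_of R M w" using assms(2,3) a by (simp add: smult_assoc1)
    then have "a \<in> ann_of R M w" using primeideal.I_prime[OF assms(1) a assms(3)] assms(4) by blast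
    then show "a \<odot>\<^bsub>M\<^esub> w = \<zero>\<^bsub>M\<^esub>" by simp
  next
    assume "a \<odot>\<^bsub>M\<^esub> w = \<zero>\<^bsub>M\<^esub>"
    then show "a \<odot>\<^bsub>M\<^esub> (t \<odot>\<^bsub>M\<^esub> w) = \<zero>\<^bsub>M\<^esub>" using assms(2,3) a smult_swap[of a t w] by simp
  qed
  then show ?thesis by blast
qed

text \<open>A maximal member among the annihilators of nonzero multiples of \<open>w\<close> is prime.\<close>

lemma (in plain_module) multiple_with_prime_annihilator:
  assumes noeth: "noetherian_ring R" and w: "w \<in> carrier M" "w \<noteq> \<zero>\<^bsub>M\<^esub>"
  obtains r where "r \<in> carrier R" "primeideal (ann_of R M (r \<odot>\<^bsub>M\<^esub> w)) R"
proof -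
  define \<K> where "\<K> = {ann_of R M (r \<odot>\<^bsub>M\<^esub> w) |r. r \<in> carrier R \<and> r \<odot>\<^bsub>M\<^esub> w \<noteq> \<zero>\<^bsub>M\<^esub>}"
  have "ann_of R M (\<one> \<odot>\<^bsub>M\<^esub> w) \<in> \<K>" unfolding \<K>_def using w by force
  then have ne: "\<K> \<noteq> {}" by blast
  have "ideal K R" if "K \<in> \<K>" for K
    using that w unfolding \<K>_def by (auto intro: annihilator_ideal)
  then obtain K where K: "K \<in> \<K>" and max: "\<And>L. \<lbrakk>L \<in> \<K>; K \<subseteq> L\<rbrakk> \<Longrightarrow> L = K"
    using noetherian_ring.maximal_ideal_in_family[OF noeth ne] by metis
  then obtain r where r: "r \<in> carrier R" "r \<odot>\<^bsub>M\<^esub> w \<noteq> \<zero>\<^bsub>M\<^esub>" "K = ann_of R M (r \<odot>\<^bsub>M\<^esub> w)"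
    unfolding \<K>_def by blast
  have "primeideal K R"
  proof (rule primeidealI)
    show "ideal K R" unfolding r(3) using r w by (intro annihilator_ideal) simp
    show "cring R" by (rule R.is_cring)
    have "\<one> \<notin> K" unfolding r(3) using r w by simp
    then show "carrier R \<noteq> K" using R.one_closed by metis
    fix a b assume ab: "a \<in> carrier R" "b \<in> carrier R" "a \<otimes> b \<in> K"
    show "a \<in> K \<or> b \<in> K"
    proof (rule disjCI)
      assume "b \<notin> K"
      then have b: "(b \<otimes> r) \<odot>\<^bsub>M\<^esub> w \<noteq> \<zero>\<^bsub>M\<^esub>" using ab r w by (simp add: smult_assoc1)
      then have "ann_of R M ((b \<otimes> r) \<odot>\<^bsub>M\<^esub> w) \<in> \<K>" unfolding \<K>_def using ab r by blast
      moreover have "K \<subseteq> ann_of R M ((b \<otimes> r) \<odot>\<^bsub>M\<^esub> w)"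
        unfolding r(3) using ab r w by (auto simp: smult_assoc1 smult_swap[of _ b])
      ultimately have eq: "ann_of R M ((b \<otimes> r) \<odot>\<^bsub>M\<^esub> w) = K" by (rule max)
      have "a \<odot>\<^bsub>M\<^esub> ((b \<otimes> r) \<odot>\<^bsub>M\<^esub> w) = \<zero>\<^bsub>M\<^esub>"
        using ab r w by (simp add: smult_assoc1)
      then have "a \<in> ann_of R M ((b \<otimes> r) \<odot>\<^bsub>M\<^esub> w)" using ab by blast
      then show "a \<in> K" unfolding eq .
    qed
  qed
  then show thesis
    unfolding r(3) by (rule that[OF r(1)])
qed

section \<open>Homomorphisms from an ideal\<close>

lemma (in cring) ideal_add_principal:
  assumes K: "ideal K R" and x: "x \<in> carrier R"
  shows "ideal {k \<oplus> r \<otimes> x |k r. k \<in> K \<and> r \<in> carrier R} R" (is "ideal ?L R")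
proof -
  note K = K[unfolded ideal_iff]
  have Kc: "k \<in> carrier R" if "k \<in> K" for k using that K by blast
  show ?thesis unfolding ideal_iff
  proof (intro conjI ballI)
    show "?L \<subseteq> carrier R" using Kc x by auto
    have "\<zero> = \<zero> \<oplus> \<zero> \<otimes> x" using x by simp
    then show "\<zero> \<in> ?L" using K by blast
    fix u assume "u \<in> ?L"
    then obtain k r where u: "u = k \<oplus> r \<otimes> x" "k \<in> K" "r \<in> carrier R" by blast
    { fix v assume "v \<in> ?L"
      then obtain l s where v: "v = l \<oplus> s \<otimes> x" "l \<in> K" "s \<in> carrier R" by blast
      have "u \<oplus> v = (k \<oplus> l) \<oplus> (r \<oplus> s) \<otimes> x"
        using u v Kc x by (simp add: l_distr a_ac)
      then show "u \<oplus> v \<in> ?L" using u v K by blast }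
    fix a assume a: "a \<in> carrier R"
    have "a \<otimes> u = a \<otimes> k \<oplus> (a \<otimes> r) \<otimes> x"
      using u a Kc x by (simp add: r_distr m_assoc)
    then show "a \<otimes> u \<in> ?L" using u a K by blast
  qed
qed

text \<open>Among the ideals \<open>K \<subseteq> I\<close> that contain no multiple \<open>sI\<close> with \<open>s \<notin> \<pp>\<close> let \<open>K\<close> be maximal; the zero
  ideal is one of them as \<open>\<pp>\<close> contains the annihilator of \<open>I\<close>. Locally at \<open>\<pp>\<close> the module \<open>I/K\<close> is
  then simple. Hence, for \<open>x \<in> I\<close> outside \<open>K\<close>, some \<open>t \<notin> \<pp>\<close> satisfies \<open>tI \<subseteq> K + Rx\<close>, and mapping
  \<open>y\<close> to \<open>rw\<close> when \<open>ty \<in> rx + K\<close> is well defined.\<close>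

lemma (in plain_module) hom_from_ideal_onto_multiple:
  assumes noeth: "noetherian_ring R" and I: "ideal I R"
    and w: "w \<in> carrier M" and prime: "primeideal (ann_of R M w) R"
    and sub: "annihilator R (ideal_module R I) \<subseteq> ann_of R M w"
  obtains f x t where "f \<in> module_hom R (ideal_module R I) M" "x \<in> I"
    "t \<in> carrier R" "t \<notin> ann_of R M w" "f x = t \<odot>\<^bsub>M\<^esub> w"
proof -
  define \<pp> where "\<pp> = ann_of R M w"
  interpret P: primeideal \<pp> R using prime unfolding \<pp>_def .
  have mul: "s \<otimes> t \<in> carrier R - \<pp>" if "s \<in> carrier R - \<pp>" "t \<in> carrier R - \<pp>" for s t
    using that P.I_prime[of s t] by blast
  have one: "\<one> \<in> carrier R - \<pp>"
    using P.I_notcarr P.one_imp_carrier by auto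
  have Ic: "y \<in> carrier R" if "y \<in> I" for y using that I[unfolded R.ideal_iff] by blast
  define \<K> where "\<K> = {K. ideal K R \<and> K \<subseteq> I \<and> (\<forall>s\<in>carrier R - \<pp>. \<exists>y\<in>I. s \<otimes> y \<notin> K)}"
  have "{\<zero>} \<in> \<K>"
  proof -
    have "\<exists>y\<in>I. s \<otimes> y \<noteq> \<zero>" if "s \<in> carrier R - \<pp>" for s
      using sub that unfolding annihilator_def \<pp>_def by auto
    then show ?thesis
      unfolding \<K>_def using R.zeroideal I[unfolded R.ideal_iff] by auto
  qed
  then have ne: "\<K> \<noteq> {}" by blast
  have "ideal K R" if "K \<in> \<K>" for K using that unfolding \<K>_def by blast
  then obtain K where K: "K \<in> \<K>" and max: "\<And>L. \<lbrakk>L \<in> \<K>; K \<subseteq> L\<rbrakk> \<Longrightarrow> L = K"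
    using noetherian_ring.maximal_ideal_in_family[OF noeth ne] by metis
  have Ki: "ideal K R" and KI: "K \<subseteq> I" and Ks: "\<And>s. s \<in> carrier R - \<pp> \<Longrightarrow> \<exists>y\<in>I. s \<otimes> y \<notin> K"
    using K unfolding \<K>_def by blast+
  note K' = Ki[unfolded R.ideal_iff]
  have Kc: "k \<in> carrier R" if "k \<in> K" for k using that K' by blast
  have cof: "\<exists>t\<in>carrier R - \<pp>. \<forall>z\<in>I. \<exists>k\<in>K. \<exists>r\<in>carrier R. t \<otimes> z = k \<oplus> r \<otimes> y"
    if y: "y \<in> I" "y \<notin> K" for y
  proof -
    let ?L = "{k \<oplus> r \<otimes> y |k r. k \<in> K \<and> r \<in> carrier R}"
    have Li: "ideal ?L R" using R.ideal_add_principal[OF Ki Ic[OF y(1)]] .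
    have LI: "?L \<subseteq> I" using KI I[unfolded R.ideal_iff] y by auto
    have "k \<in> ?L" if "k \<in> K" for k
    proof -
      have "k = k \<oplus> \<zero> \<otimes> y" using Kc that Ic y by simp
      then show ?thesis using that by blast
    qed
    then have KL: "K \<subseteq> ?L" by blast
    have "y = \<zero> \<oplus> \<one> \<otimes> y" using Ic y by simp
    then have "y \<in> ?L" using K' by blast
    then have "?L \<noteq> K" using y by blast
    then have "?L \<notin> \<K>" using max[OF _ KL] by blast
    then have "\<exists>t\<in>carrier R - \<pp>. \<forall>z\<in>I. t \<otimes> z \<in> ?L"
      unfolding \<K>_def using Li LI by blast
    then show ?thesis by blast
  qed
  have tf: "y \<in> K" if s: "s \<in> carrier R - \<pp>" and y: "y \<in> I" and sy: "s \<otimes> y \<in> K" for s y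
  proof (rule ccontr)
    assume "y \<notin> K"
    then obtain t where t: "t \<in> carrier R - \<pp>"
      and tz: "\<And>z. z \<in> I \<Longrightarrow> \<exists>k\<in>K. \<exists>r\<in>carrier R. t \<otimes> z = k \<oplus> r \<otimes> y"
      using cof[OF y] by blast
    have "(s \<otimes> t) \<otimes> z \<in> K" if z: "z \<in> I" for z
    proof -
      obtain k r where kr: "k \<in> K" "r \<in> carrier R" "t \<otimes> z = k \<oplus> r \<otimes> y" using tz[OF z] by blast
      have "(s \<otimes> t) \<otimes> z = s \<otimes> (k \<oplus> r \<otimes> y)"
        using s t Ic z by (simp add: m_assoc flip: kr(3))
      also have "\<dots> = s \<otimes> k \<oplus> r \<otimes> (s \<otimes> y)"
        using s kr Kc Ic y by (simp add: r_distr m_lcomm)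
      also have "\<dots> \<in> K" using K' s sy kr by blast
      finally show ?thesis .
    qed
    then show False using Ks[OF mul[OF s t]] by blast
  qed
  obtain x where x: "x \<in> I" "x \<notin> K" using Ks[OF one] Ic by fastforce
  obtain t where t: "t \<in> carrier R - \<pp>"
    and tz: "\<And>z. z \<in> I \<Longrightarrow> \<exists>k\<in>K. \<exists>r\<in>carrier R. t \<otimes> z = k \<oplus> r \<otimes> x"
    using cof[OF x] by blast
  note xc = Ic[OF x(1)]
  define G where "G z u = (\<exists>r\<in>carrier R. \<exists>k\<in>K. t \<otimes> z = k \<oplus> r \<otimes> x \<and> u = r \<odot>\<^bsub>M\<^esub> w)" for z u
  have "\<exists>f\<in>module_hom R (ideal_module R I) M. \<forall>z u. G z u \<longrightarrow> f z = u"
  proof (rule module_hom_of_graph[where G = G and A = "ideal_module R I" and B = M and R = R])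
    show "\<exists>u. G z u" if "z \<in> carrier (ideal_module R I)" for z
      using tz that unfolding G_def by fastforce
    show "u \<in> carrier M" if "G z u" for z u
      using that w unfolding G_def by auto
    show "u = u'" if "G z u" "G z u'" for z u u'
    proof -
      obtain r k r' k' where *: "r \<in> carrier R" "k \<in> K" "r' \<in> carrier R" "k' \<in> K"
        "k \<oplus> r \<otimes> x = k' \<oplus> r' \<otimes> x" "u = r \<odot>\<^bsub>M\<^esub> w" "u' = r' \<odot>\<^bsub>M\<^esub> w"
        using \<open>G z u\<close> \<open>G z u'\<close> unfolding G_def by metis
      have kc: "k \<in> carrier R" "k' \<in> carrier R" using * Kc by auto
      have "(r \<ominus> r') \<otimes> x = (k \<oplus> r \<otimes> x) \<ominus> k \<ominus> r' \<otimes> x"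
        using *(1,3) kc xc by algebra
      also have "\<dots> = k' \<ominus> k"
        unfolding *(5) using *(1,3) kc xc by algebra
      also have "\<dots> = k' \<oplus> (\<ominus> \<one>) \<otimes> k"
        using kc by algebra
      also have "\<dots> \<in> K" using K' * by blast
      finally have "r \<ominus> r' \<in> \<pp>" using tf[of "r \<ominus> r'" x] x * by blast
      then have "(r \<ominus> r') \<odot>\<^bsub>M\<^esub> w = \<zero>\<^bsub>M\<^esub>" unfolding \<pp>_def by blast
      then have "r \<odot>\<^bsub>M\<^esub> w \<ominus>\<^bsub>M\<^esub> r' \<odot>\<^bsub>M\<^esub> w = \<zero>\<^bsub>M\<^esub>"
        using * w by (simp add: R.minus_eq M.minus_eq smult_l_distr smult_l_minus)
      then show "u = u'" unfolding *(6,7) by (rule minus_eq_zero_imp_eq[rotated 2]) (use * w in auto)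
    qed
    show "G (y \<oplus>\<^bsub>ideal_module R I\<^esub> z) (u \<oplus>\<^bsub>M\<^esub> v)"
      if yz: "y \<in> carrier (ideal_module R I)" "z \<in> carrier (ideal_module R I)"
        and "G y u" "G z v" for y z u v
    proof -
      obtain r k r' k' where *: "r \<in> carrier R" "k \<in> K" "r' \<in> carrier R" "k' \<in> K"
        "t \<otimes> y = k \<oplus> r \<otimes> x" "t \<otimes> z = k' \<oplus> r' \<otimes> x" "u = r \<odot>\<^bsub>M\<^esub> w" "v = r' \<odot>\<^bsub>M\<^esub> w"
        using \<open>G y u\<close> \<open>G z v\<close> unfolding G_def by metis
      have "t \<otimes> (y \<oplus> z) = t \<otimes> y \<oplus> t \<otimes> z" using t yz Ic by (simp add: r_distr)
      also have "\<dots> = (k \<oplus> k') \<oplus> (r \<oplus> r') \<otimes> x"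
        unfolding *(5,6) using * Kc xc by (simp add: l_distr R.a_ac)
      finally have "t \<otimes> (y \<oplus> z) = (k \<oplus> k') \<oplus> (r \<oplus> r') \<otimes> x" .
      moreover have "u \<oplus>\<^bsub>M\<^esub> v = (r \<oplus> r') \<odot>\<^bsub>M\<^esub> w" using * w by (simp add: smult_l_distr)
      moreover have "k \<oplus> k' \<in> K" "r \<oplus> r' \<in> carrier R" using * K' by auto
      ultimately show ?thesis unfolding G_def ideal_module_simps by blast
    qed
    show "G (a \<odot>\<^bsub>ideal_module R I\<^esub> z) (a \<odot>\<^bsub>M\<^esub> u)"
      if a: "a \<in> carrier R" and z: "z \<in> carrier (ideal_module R I)" and "G z u" for a z u
    proof -
      obtain r k where *: "r \<in> carrier R" "k \<in> K" "t \<otimes> z = k \<oplus> r \<otimes> x" "u = r \<odot>\<^bsub>M\<^esub> w"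
        using \<open>G z u\<close> unfolding G_def by blast
      have "t \<otimes> (a \<otimes> z) = a \<otimes> (t \<otimes> z)" using t a z Ic by (simp add: m_lcomm)
      also have "\<dots> = a \<otimes> k \<oplus> (a \<otimes> r) \<otimes> x"
        unfolding *(3) using a * Kc xc by (simp add: r_distr m_assoc)
      finally have "t \<otimes> (a \<otimes> z) = a \<otimes> k \<oplus> (a \<otimes> r) \<otimes> x" .
      moreover have "a \<odot>\<^bsub>M\<^esub> u = (a \<otimes> r) \<odot>\<^bsub>M\<^esub> w" using * a w by (simp add: smult_assoc1)
      moreover have "a \<otimes> k \<in> K" "a \<otimes> r \<in> carrier R" using * a K' by auto
      ultimately show ?thesis unfolding G_def ideal_module_simps by blast
    qed
  qed
  then obtain f where f: "f \<in> module_hom R (ideal_module R I) M" and fG: "\<And>z u. G z u \<Longrightarrow> f z = u"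
    by blast
  have "t \<otimes> x = \<zero> \<oplus> t \<otimes> x" using t xc by simp
  then have "G x (t \<odot>\<^bsub>M\<^esub> w)" unfolding G_def using t K' by blast
  then have "f x = t \<odot>\<^bsub>M\<^esub> w" by (rule fG)
  with t show thesis unfolding \<pp>_def by (intro that[OF f x(1)]) auto
qed

section \<open>Modules of homomorphisms\<close>

lemma hom_module_simps:
  "carrier (hom_module R A B) = module_hom R A B \<inter> extensional (carrier A)"
  "\<zero>\<^bsub>hom_module R A B\<^esub> = (\<lambda>x\<in>carrier A. \<zero>\<^bsub>B\<^esub>)"
  "f \<oplus>\<^bsub>hom_module R A B\<^esub> g = (\<lambda>x\<in>carrier A. f x \<oplus>\<^bsub>B\<^esub> g x)"
  "a \<odot>\<^bsub>hom_module R A B\<^esub> f = (\<lambda>x\<in>carrier A. a \<odot>\<^bsub>B\<^esub> f x)"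
  by (simp_all add: hom_module_def)

lemma hom_module_is_module:
  assumes A: "module R A" and B: "module R B"
  shows "module R (hom_module R A B)"
proof (rule module_from_smultI)
  interpret A: module R A by fact
  interpret B: module R B by fact
  show "cring R" by (rule A.R.is_cring)
  have ha: "f (x \<oplus>\<^bsub>A\<^esub> y) = f x \<oplus>\<^bsub>B\<^esub> f y"
    if "f \<in> carrier (hom_module R A B)" "x \<in> carrier A" "y \<in> carrier A" for f x y
    using that by (auto simp: hom_module_simps module_hom_def)
  have hs: "f (a \<odot>\<^bsub>A\<^esub> x) = a \<odot>\<^bsub>B\<^esub> f x"
    if "f \<in> carrier (hom_module R A B)" "x \<in> carrier A" "a \<in> carrier R" for f x a
    using that by (auto simp: hom_module_simps module_hom_def)
  have hc: "f x \<in> carrier B" if "f \<in> carrier (hom_module R A B)" "x \<in> carrier A" for f x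
    using that by (auto simp: hom_module_simps module_hom_def)
  have ext: "(\<lambda>x\<in>carrier A. f x) = f" if "f \<in> carrier (hom_module R A B)" for f
    using that by (auto simp: hom_module_simps intro: extensional_restrict)
  show "f \<oplus>\<^bsub>hom_module R A B\<^esub> g \<in> carrier (hom_module R A B)"
    if "f \<in> carrier (hom_module R A B)" "g \<in> carrier (hom_module R A B)" for f g
    unfolding hom_module_simps
    by (intro IntI restrict_extensional module_homI)
       (simp_all add: that ha hs hc B.smult_r_distr B.M.a_ac)
  show "\<zero>\<^bsub>hom_module R A B\<^esub> \<in> carrier (hom_module R A B)"
    unfolding hom_module_simps by (intro IntI restrict_extensional module_homI) simp_all
  show "a \<odot>\<^bsub>hom_module R A B\<^esub> f \<in> carrier (hom_module R A B)"
    if "a \<in> carrier R" "f \<in> carrier (hom_module R A B)" for a f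
    unfolding hom_module_simps
    by (intro IntI restrict_extensional module_homI)
       (simp_all add: that ha hs hc B.smult_r_distr B.smult_swap[of a])
  show "\<zero>\<^bsub>hom_module R A B\<^esub> \<oplus>\<^bsub>hom_module R A B\<^esub> f = f" if "f \<in> carrier (hom_module R A B)" for f
    by (rule trans[OF _ ext[OF that]], unfold hom_module_simps, rule restrict_ext)
       (simp add: hc[OF that])
  show "\<one>\<^bsub>R\<^esub> \<odot>\<^bsub>hom_module R A B\<^esub> f = f" if "f \<in> carrier (hom_module R A B)" for f
    by (rule trans[OF _ ext[OF that]], unfold hom_module_simps, rule restrict_ext)
       (simp add: hc[OF that])
  show "(f \<oplus>\<^bsub>hom_module R A B\<^esub> g) \<oplus>\<^bsub>hom_module R A B\<^esub> k = f \<oplus>\<^bsub>hom_module R A B\<^esub> (g \<oplus>\<^bsub>hom_module R A B\<^esub> k)"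
    if "f \<in> carrier (hom_module R A B)" "g \<in> carrier (hom_module R A B)" "k \<in> carrier (hom_module R A B)"
    for f g k
    unfolding hom_module_simps by (rule restrict_ext) (simp add: that hc B.M.a_assoc)
  show "f \<oplus>\<^bsub>hom_module R A B\<^esub> g = g \<oplus>\<^bsub>hom_module R A B\<^esub> f"
    if "f \<in> carrier (hom_module R A B)" "g \<in> carrier (hom_module R A B)" for f g
    unfolding hom_module_simps by (rule restrict_ext) (simp add: that hc B.M.a_comm)
  show "(a \<oplus>\<^bsub>R\<^esub> b) \<odot>\<^bsub>hom_module R A B\<^esub> f
      = a \<odot>\<^bsub>hom_module R A B\<^esub> f \<oplus>\<^bsub>hom_module R A B\<^esub> b \<odot>\<^bsub>hom_module R A B\<^esub> f"
    if "a \<in> carrier R" "b \<in> carrier R" "f \<in> carrier (hom_module R A B)" for a b f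
    unfolding hom_module_simps by (rule restrict_ext) (simp add: that hc B.smult_l_distr)
  show "a \<odot>\<^bsub>hom_module R A B\<^esub> (f \<oplus>\<^bsub>hom_module R A B\<^esub> g)
      = a \<odot>\<^bsub>hom_module R A B\<^esub> f \<oplus>\<^bsub>hom_module R A B\<^esub> a \<odot>\<^bsub>hom_module R A B\<^esub> g"
    if "a \<in> carrier R" "f \<in> carrier (hom_module R A B)" "g \<in> carrier (hom_module R A B)" for a f g
    unfolding hom_module_simps by (rule restrict_ext) (simp add: that hc B.smult_r_distr)
  show "(a \<otimes>\<^bsub>R\<^esub> b) \<odot>\<^bsub>hom_module R A B\<^esub> f = a \<odot>\<^bsub>hom_module R A B\<^esub> (b \<odot>\<^bsub>hom_module R A B\<^esub> f)"
    if "a \<in> carrier R" "b \<in> carrier R" "f \<in> carrier (hom_module R A B)" for a b f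
    unfolding hom_module_simps by (rule restrict_ext) (simp add: that hc B.smult_assoc1)
  show "\<zero>\<^bsub>R\<^esub> \<odot>\<^bsub>hom_module R A B\<^esub> f = \<zero>\<^bsub>hom_module R A B\<^esub>"
    if "f \<in> carrier (hom_module R A B)" for f
    unfolding hom_module_simps by (rule restrict_ext) (simp add: that hc)
qed

lemma hom_module_carrierI: "f \<in> module_hom R A B \<Longrightarrow> module R A \<Longrightarrow>
    (\<lambda>x\<in>carrier A. f x) \<in> carrier (hom_module R A B)"
proof -
  assume f: "f \<in> module_hom R A B" and "module R A"
  then interpret A: module R A by simp
  show ?thesis
    unfolding hom_module_simps
    by (intro IntI restrict_extensional module_homI) (simp_all add: module_homD[OF f])
qed

section \<open>Extension of homomorphisms into injective modules\<close>

text \<open>A homomorphism from an ideal extends to \<open>R\<close> by injectivity, and the value of the extension at \<open>1\<close> is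
  the multiplier.\<close>

lemma baer_multiplier:
  assumes inj: "injective_module R E" and R: "cring R" and \<aa>: "ideal \<aa> R"
    and g: "g \<in> module_hom R (ideal_module R \<aa>) E"
  obtains e where "e \<in> carrier E" "\<And>r. r \<in> \<aa> \<Longrightarrow> g r = r \<odot>\<^bsub>E\<^esub> e"
proof -
  interpret cring R by fact
  have ac: "r \<in> carrier R" if "r \<in> \<aa>" for r using that \<aa>[unfolded ideal_iff] by blast
  have "(\<lambda>x. x) \<in> module_hom R (ideal_module R \<aa>) (regular_module R)"
    by (rule module_homI) (auto simp: ac)
  then obtain h where h: "h \<in> module_hom R (regular_module R) E" and hg: "\<And>x. x \<in> \<aa> \<Longrightarrow> h x = g x"
    using inj g ideal_module_is_module[OF \<aa>] regular_module_is_module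
    unfolding injective_module_def by (metis ideal_module_simps(1) inj_on_id2)
  have "g r = r \<odot>\<^bsub>E\<^esub> h \<one>\<^bsub>R\<^esub>" if "r \<in> \<aa>" for r
    using module_homD(3)[OF h, of r "\<one>\<^bsub>R\<^esub>"] hg[OF that] ac[OF that] by simp
  moreover have "h \<one>\<^bsub>R\<^esub> \<in> carrier E" using module_homD(1)[OF h, of "\<one>\<^bsub>R\<^esub>"] by simp
  ultimately show thesis using that by blast
qed

text \<open>A partial homomorphism is encoded by its graph; the last clause says that the relation is
  single-valued.\<close>

definition partial_hom :: "('r, 'x) ring_scheme \<Rightarrow> ('r, 'm) module \<Rightarrow> ('r, 'e) module \<Rightarrow> ('m \<times> 'e) set \<Rightarrow> bool"
  where "partial_hom R M E G \<longleftrightarrow>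
    (\<forall>x u. (x, u) \<in> G \<longrightarrow> x \<in> carrier M \<and> u \<in> carrier E) \<and>
    (\<zero>\<^bsub>M\<^esub>, \<zero>\<^bsub>E\<^esub>) \<in> G \<and>
    (\<forall>x u y v. (x, u) \<in> G \<longrightarrow> (y, v) \<in> G \<longrightarrow> (x \<oplus>\<^bsub>M\<^esub> y, u \<oplus>\<^bsub>E\<^esub> v) \<in> G) \<and>
    (\<forall>a x u. a \<in> carrier R \<longrightarrow> (x, u) \<in> G \<longrightarrow> (a \<odot>\<^bsub>M\<^esub> x, a \<odot>\<^bsub>E\<^esub> u) \<in> G) \<and>
    (\<forall>u. (\<zero>\<^bsub>M\<^esub>, u) \<in> G \<longrightarrow> u = \<zero>\<^bsub>E\<^esub>)"

lemma partial_homD: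
  assumes "partial_hom R M E G"
  shows "(x, u) \<in> G \<Longrightarrow> x \<in> carrier M" "(x, u) \<in> G \<Longrightarrow> u \<in> carrier E"
    and "(\<zero>\<^bsub>M\<^esub>, \<zero>\<^bsub>E\<^esub>) \<in> G"
    and "\<lbrakk>(x, u) \<in> G; (y, v) \<in> G\<rbrakk> \<Longrightarrow> (x \<oplus>\<^bsub>M\<^esub> y, u \<oplus>\<^bsub>E\<^esub> v) \<in> G"
    and "\<lbrakk>a \<in> carrier R; (x, u) \<in> G\<rbrakk> \<Longrightarrow> (a \<odot>\<^bsub>M\<^esub> x, a \<odot>\<^bsub>E\<^esub> u) \<in> G"
    and "(\<zero>\<^bsub>M\<^esub>, u) \<in> G \<Longrightarrow> u = \<zero>\<^bsub>E\<^esub>"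
  using assms unfolding partial_hom_def by blast+

lemma partial_hom_neg:
  assumes "module R M" "module R E" "partial_hom R M E G" "(x, u) \<in> G"
  shows "(\<ominus>\<^bsub>M\<^esub> x, \<ominus>\<^bsub>E\<^esub> u) \<in> G"
proof -
  interpret M: module R M by fact
  interpret E: module R E by fact
  show ?thesis
    using partial_homD(5)[OF assms(3) _ assms(4), of "\<ominus>\<^bsub>R\<^esub> \<one>\<^bsub>R\<^esub>"] partial_homD(1,2)[OF assms(3,4)]
    by (simp add: M.a_inv_eq_smult E.a_inv_eq_smult)
qed

lemma partial_hom_unique:
  assumes "module R M" "module R E" "partial_hom R M E G" "(x, u) \<in> G" "(x, v) \<in> G"
  shows "u = v"
proof -
  interpret M: module R M by fact
  interpret E: module R E by fact
  note c = partial_homD(1,2)[OF assms(3,4)] partial_homD(1,2)[OF assms(3,5)]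
  have "(x \<oplus>\<^bsub>M\<^esub> \<ominus>\<^bsub>M\<^esub> x, u \<oplus>\<^bsub>E\<^esub> \<ominus>\<^bsub>E\<^esub> v) \<in> G"
    using partial_homD(4)[OF assms(3,4) partial_hom_neg[OF assms(1-3,5)]] .
  then have "u \<ominus>\<^bsub>E\<^esub> v = \<zero>\<^bsub>E\<^esub>"
    using partial_homD(6)[OF assms(3)] c by (simp add: M.M.r_neg E.M.minus_eq)
  then show ?thesis using E.minus_eq_zero_imp_eq c by blast
qed

text \<open>The homomorphism \<open>r \<mapsto> G(ry)\<close> on the ideal of all \<open>r\<close> with \<open>ry\<close> in the domain of \<open>G\<close> is
  multiplication by some \<open>e\<close>, and \<open>e\<close> can serve as value at \<open>y\<close>.\<close>

lemma partial_hom_extend: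
  assumes M: "module R M" and E: "injective_module R E" and G: "partial_hom R M E G" and y: "y \<in> carrier M"
  obtains G' e where "partial_hom R M E G'" "G \<subseteq> G'" "(y, e) \<in> G'"
proof -
  interpret M: module R M by fact
  have E': "module R E" using E unfolding injective_module_def by blast
  interpret E: module R E by fact
  note G' = partial_homD[OF G]
  define \<aa> where "\<aa> = {r \<in> carrier R. \<exists>u. (r \<odot>\<^bsub>M\<^esub> y, u) \<in> G}"
  have \<aa>: "ideal \<aa> R"
    unfolding M.R.ideal_iff
  proof (intro conjI ballI)
    show "\<aa> \<subseteq> carrier R" unfolding \<aa>_def by blast
    have "(\<zero>\<^bsub>R\<^esub> \<odot>\<^bsub>M\<^esub> y, \<zero>\<^bsub>E\<^esub>) \<in> G" using G'(3) y by simp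
    then show "\<zero>\<^bsub>R\<^esub> \<in> \<aa>" unfolding \<aa>_def by blast
    fix r assume "r \<in> \<aa>"
    then obtain u where r: "r \<in> carrier R" "(r \<odot>\<^bsub>M\<^esub> y, u) \<in> G" unfolding \<aa>_def by blast
    { fix s assume "s \<in> \<aa>"
      then obtain v where s: "s \<in> carrier R" "(s \<odot>\<^bsub>M\<^esub> y, v) \<in> G" unfolding \<aa>_def by blast
      have "((r \<oplus>\<^bsub>R\<^esub> s) \<odot>\<^bsub>M\<^esub> y, u \<oplus>\<^bsub>E\<^esub> v) \<in> G"
        using G'(4)[OF r(2) s(2)] r s y by (simp add: M.smult_l_distr)
      then show "r \<oplus>\<^bsub>R\<^esub> s \<in> \<aa>" unfolding \<aa>_def using r s by blast }
    fix a assume a: "a \<in> carrier R"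
    have "((a \<otimes>\<^bsub>R\<^esub> r) \<odot>\<^bsub>M\<^esub> y, a \<odot>\<^bsub>E\<^esub> u) \<in> G"
      using G'(5)[OF a r(2)] r a y by (simp add: M.smult_assoc1)
    then show "a \<otimes>\<^bsub>R\<^esub> r \<in> \<aa>" unfolding \<aa>_def using r a by blast
  qed
  have ac: "r \<in> carrier R" if "r \<in> \<aa>" for r using that unfolding \<aa>_def by blast
  have "\<exists>g\<in>module_hom R (ideal_module R \<aa>) E. \<forall>r u. (r \<odot>\<^bsub>M\<^esub> y, u) \<in> G \<longrightarrow> g r = u"
  proof (rule module_hom_of_graph)
    show "\<exists>u. (r \<odot>\<^bsub>M\<^esub> y, u) \<in> G" if "r \<in> carrier (ideal_module R \<aa>)" for r
      using that unfolding \<aa>_def by simp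
    show "u = u'" if "(r \<odot>\<^bsub>M\<^esub> y, u) \<in> G" "(r \<odot>\<^bsub>M\<^esub> y, u') \<in> G" for r u u'
      by (rule partial_hom_unique[OF M E' G that])
    show "u \<in> carrier E" if "(r \<odot>\<^bsub>M\<^esub> y, u) \<in> G" for r u by (rule G'(2)[OF that])
    show "((r \<oplus>\<^bsub>ideal_module R \<aa>\<^esub> s) \<odot>\<^bsub>M\<^esub> y, u \<oplus>\<^bsub>E\<^esub> v) \<in> G"
      if "r \<in> carrier (ideal_module R \<aa>)" "s \<in> carrier (ideal_module R \<aa>)"
        "(r \<odot>\<^bsub>M\<^esub> y, u) \<in> G" "(s \<odot>\<^bsub>M\<^esub> y, v) \<in> G" for r s u v
      using G'(4)[OF that(3,4)] ac that(1,2) y by (simp add: M.smult_l_distr)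
    show "((a \<odot>\<^bsub>ideal_module R \<aa>\<^esub> r) \<odot>\<^bsub>M\<^esub> y, a \<odot>\<^bsub>E\<^esub> u) \<in> G"
      if "a \<in> carrier R" "r \<in> carrier (ideal_module R \<aa>)" "(r \<odot>\<^bsub>M\<^esub> y, u) \<in> G" for a r u
      using G'(5)[OF that(1,3)] ac that(1,2) y by (simp add: M.smult_assoc1)
  qed
  then obtain g where g: "g \<in> module_hom R (ideal_module R \<aa>) E"
    and gG: "\<And>r u. (r \<odot>\<^bsub>M\<^esub> y, u) \<in> G \<Longrightarrow> g r = u" by blast
  obtain e where e: "e \<in> carrier E" and ge: "\<And>r. r \<in> \<aa> \<Longrightarrow> g r = r \<odot>\<^bsub>E\<^esub> e"
    using baer_multiplier[OF E M.R.is_cring \<aa> g] by blast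
  define H where "H = {(x \<oplus>\<^bsub>M\<^esub> r \<odot>\<^bsub>M\<^esub> y, u \<oplus>\<^bsub>E\<^esub> r \<odot>\<^bsub>E\<^esub> e) |x u r. (x, u) \<in> G \<and> r \<in> carrier R}"
  have HI: "(x \<oplus>\<^bsub>M\<^esub> r \<odot>\<^bsub>M\<^esub> y, u \<oplus>\<^bsub>E\<^esub> r \<odot>\<^bsub>E\<^esub> e) \<in> H" if "(x, u) \<in> G" "r \<in> carrier R" for x u r
    using that unfolding H_def by blast
  have sub: "(x, u) \<in> H" if xu: "(x, u) \<in> G" for x u
    using HI[OF xu M.R.zero_closed] G'(1,2)[OF xu] y e by simp
  have "(\<zero>\<^bsub>M\<^esub> \<oplus>\<^bsub>M\<^esub> \<one>\<^bsub>R\<^esub> \<odot>\<^bsub>M\<^esub> y, \<zero>\<^bsub>E\<^esub> \<oplus>\<^bsub>E\<^esub> \<one>\<^bsub>R\<^esub> \<odot>\<^bsub>E\<^esub> e) \<in> H"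
    by (rule HI[OF G'(3) M.R.one_closed])
  then have ye: "(y, e) \<in> H" using y e by simp
  have "partial_hom R M E H"
    unfolding partial_hom_def
  proof (intro conjI allI impI)
    show "(\<zero>\<^bsub>M\<^esub>, \<zero>\<^bsub>E\<^esub>) \<in> H" by (rule sub[OF G'(3)])
    fix z w assume "(z, w) \<in> H"
    then obtain x u r where z: "(x, u) \<in> G" "r \<in> carrier R" "z = x \<oplus>\<^bsub>M\<^esub> r \<odot>\<^bsub>M\<^esub> y" "w = u \<oplus>\<^bsub>E\<^esub> r \<odot>\<^bsub>E\<^esub> e"
      unfolding H_def by blast
    note c = G'(1,2)[OF z(1)]
    show "z \<in> carrier M" "w \<in> carrier E" using z(2-) c y e by simp_all
    show "(a \<odot>\<^bsub>M\<^esub> z, a \<odot>\<^bsub>E\<^esub> w) \<in> H" if a: "a \<in> carrier R" for a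
      using HI[OF G'(5)[OF a z(1)] M.R.m_closed[OF a z(2)]] z(2-) c a y e
      by (simp add: M.smult_r_distr E.smult_r_distr M.smult_assoc1 E.smult_assoc1)
    fix z' w' assume "(z', w') \<in> H"
    then obtain x' u' r' where z': "(x', u') \<in> G" "r' \<in> carrier R"
      "z' = x' \<oplus>\<^bsub>M\<^esub> r' \<odot>\<^bsub>M\<^esub> y" "w' = u' \<oplus>\<^bsub>E\<^esub> r' \<odot>\<^bsub>E\<^esub> e"
      unfolding H_def by blast
    note c' = G'(1,2)[OF z'(1)]
    show "(z \<oplus>\<^bsub>M\<^esub> z', w \<oplus>\<^bsub>E\<^esub> w') \<in> H"
      using HI[OF G'(4)[OF z(1) z'(1)] M.R.a_closed[OF z(2) z'(2)]] z(2-) c z'(2-) c' y e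
      by (simp add: M.smult_l_distr E.smult_l_distr M.M.a_ac E.M.a_ac)
  next
    fix w assume "(\<zero>\<^bsub>M\<^esub>, w) \<in> H"
    then obtain x u r where z: "(x, u) \<in> G" "r \<in> carrier R" "\<zero>\<^bsub>M\<^esub> = x \<oplus>\<^bsub>M\<^esub> r \<odot>\<^bsub>M\<^esub> y" "w = u \<oplus>\<^bsub>E\<^esub> r \<odot>\<^bsub>E\<^esub> e"
      unfolding H_def by blast
    note c = G'(1,2)[OF z(1)]
    have "\<ominus>\<^bsub>M\<^esub> x = r \<odot>\<^bsub>M\<^esub> y"
      by (rule M.M.minus_equality) (use z c y in \<open>simp_all add: M.M.a_comm\<close>)
    then have rG: "(r \<odot>\<^bsub>M\<^esub> y, \<ominus>\<^bsub>E\<^esub> u) \<in> G" using partial_hom_neg[OF M E' G z(1)] by simp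
    then have "r \<in> \<aa>" unfolding \<aa>_def using z(2) by blast
    then have "r \<odot>\<^bsub>E\<^esub> e = \<ominus>\<^bsub>E\<^esub> u" using ge gG[OF rG] by simp
    then show "w = \<zero>\<^bsub>E\<^esub>" unfolding z(4) using c by (simp add: E.M.r_neg)
  qed
  moreover have "G \<subseteq> H" using sub by auto
  ultimately show thesis using ye that by blast
qed

text \<open>By Zorn's lemma there is a maximal extension, and the one-step extension makes its domain all of
  \<open>M\<close>. So injectivity, although tested on modules over the type of ring elements only, holds for
  modules over every type.\<close>

lemma partial_hom_total:
  assumes M: "module R M" and E: "injective_module R E" and G: "partial_hom R M E G"
  obtains h where "h \<in> module_hom R M E" "\<And>x u. (x, u) \<in> G \<Longrightarrow> h x = u"
proof -
  have E': "module R E" using E unfolding injective_module_def by blast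
  define \<G> where "\<G> = {H. partial_hom R M E H \<and> G \<subseteq> H}"
  have "\<exists>H\<in>\<G>. \<forall>Z\<in>\<G>. H \<subseteq> Z \<longrightarrow> Z = H"
  proof (rule subset_Zorn_nonempty)
    show "\<G> \<noteq> {}" unfolding \<G>_def using G by blast
    fix C assume C: "C \<noteq> {}" "subset.chain \<G> C"
    then have CG: "C \<subseteq> \<G>" and Ch: "\<And>Z Y. \<lbrakk>Z \<in> C; Y \<in> C\<rbrakk> \<Longrightarrow> Z \<subseteq> Y \<or> Y \<subseteq> Z"
      by (auto simp: subset_chain_def)
    have p: "partial_hom R M E Z" if "Z \<in> C" for Z using CG that unfolding \<G>_def by blast
    have "partial_hom R M E (\<Union>C)"
      unfolding partial_hom_def
    proof (intro conjI allI impI)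
      show "(\<zero>\<^bsub>M\<^esub>, \<zero>\<^bsub>E\<^esub>) \<in> \<Union>C" using C(1) partial_homD(3)[OF p] by blast
      show "u = \<zero>\<^bsub>E\<^esub>" if "(\<zero>\<^bsub>M\<^esub>, u) \<in> \<Union>C" for u using that partial_homD(6)[OF p] by blast
      fix x u assume "(x, u) \<in> \<Union>C"
      then obtain Z where Z: "Z \<in> C" "(x, u) \<in> Z" by blast
      show "x \<in> carrier M" "u \<in> carrier E" using partial_homD(1,2)[OF p[OF Z(1)] Z(2)] by blast+
      show "(a \<odot>\<^bsub>M\<^esub> x, a \<odot>\<^bsub>E\<^esub> u) \<in> \<Union>C" if "a \<in> carrier R" for a
        using partial_homD(5)[OF p[OF Z(1)] that Z(2)] Z(1) by blast
      fix y v assume "(y, v) \<in> \<Union>C"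
      then obtain Y where Y: "Y \<in> C" "(y, v) \<in> Y" by blast
      obtain W where W: "W \<in> C" "(x, u) \<in> W" "(y, v) \<in> W"
        using Ch[OF Z(1) Y(1)] Z Y by blast
      show "(x \<oplus>\<^bsub>M\<^esub> y, u \<oplus>\<^bsub>E\<^esub> v) \<in> \<Union>C"
        using partial_homD(4)[OF p[OF W(1)] W(2,3)] W(1) by blast
    qed
    moreover have "G \<subseteq> \<Union>C" using C(1) CG unfolding \<G>_def by blast
    ultimately show "\<Union>C \<in> \<G>" unfolding \<G>_def by blast
  qed
  then obtain H where HG: "H \<in> \<G>" and m: "\<forall>Z\<in>\<G>. H \<subseteq> Z \<longrightarrow> Z = H" by (rule bexE)
  have H: "partial_hom R M E H" "G \<subseteq> H" using HG by (simp_all add: \<G>_def)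
  have max: "Z = H" if "partial_hom R M E Z" "H \<subseteq> Z" for Z
  proof -
    have "G \<subseteq> Z" using H(2) that(2) by (rule subset_trans)
    then have "Z \<in> \<G>" using that(1) by (simp add: \<G>_def)
    then show ?thesis by (rule m[rule_format, OF _ that(2)])
  qed
  have tot: "\<exists>u. (y, u) \<in> H" if y: "y \<in> carrier M" for y
  proof -
    obtain H' e where H': "partial_hom R M E H'" "H \<subseteq> H'" "(y, e) \<in> H'"
      using partial_hom_extend[OF M E H(1) y] by blast
    show ?thesis using max[OF H'(1,2)] H'(3) by blast
  qed
  have "\<exists>h\<in>module_hom R M E. \<forall>x u. (x, u) \<in> H \<longrightarrow> h x = u"
    by (rule module_hom_of_graph[OF tot partial_hom_unique[OF M E' H(1)]])
       (use partial_homD[OF H(1)] in blast)+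
  with H(2) that show thesis by blast
qed

section \<open>The injective hull of the residue field is a cogenerator\<close>

lemma local_ring_proper_ideal:
  assumes noeth: "noetherian_ring R" and loc: "local_ring_at R \<mm>" and K: "ideal K R" "\<one>\<^bsub>R\<^esub> \<notin> K"
  shows "K \<subseteq> \<mm>"
proof -
  interpret cring R using loc unfolding local_ring_at_def by blast
  define \<K> where "\<K> = {L. ideal L R \<and> K \<subseteq> L \<and> \<one>\<^bsub>R\<^esub> \<notin> L}"
  have ne: "\<K> \<noteq> {}" using K unfolding \<K>_def by blast
  have "ideal L R" if "L \<in> \<K>" for L using that unfolding \<K>_def by blast
  then obtain L where L: "L \<in> \<K>" and max: "\<And>Z. \<lbrakk>Z \<in> \<K>; L \<subseteq> Z\<rbrakk> \<Longrightarrow> Z = L"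
    using noetherian_ring.maximal_ideal_in_family[OF noeth ne] by metis
  then have L': "ideal L R" "K \<subseteq> L" "\<one>\<^bsub>R\<^esub> \<notin> L" unfolding \<K>_def by blast+
  have "maximalideal L R"
  proof (rule maximalidealI[OF L'(1)])
    show "carrier R \<noteq> L" using L'(3) one_closed by metis
    fix Z assume Z: "ideal Z R" "L \<subseteq> Z"
    show "Z = L \<or> Z = carrier R"
    proof (cases "\<one>\<^bsub>R\<^esub> \<in> Z")
      case True
      then show ?thesis using ideal.one_imp_carrier[OF Z(1)] by blast
    next
      case False
      then have "Z \<in> \<K>" unfolding \<K>_def using Z L'(2) by blast
      then show ?thesis using max Z(2) by blast
    qed
  qed
  then show ?thesis using loc L'(2) unfolding local_ring_at_def by blast
qed

text \<open>The image of the residue class of \<open>1\<close> has the required properties.\<close>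

lemma injective_hull_socle_element:
  assumes loc: "local_ring_at R \<mm>" and hull: "injective_hull R (residue_field_module R \<mm>) E"
  obtains e where "e \<in> carrier E" "e \<noteq> \<zero>\<^bsub>E\<^esub>" "\<And>a. a \<in> \<mm> \<Longrightarrow> a \<odot>\<^bsub>E\<^esub> e = \<zero>\<^bsub>E\<^esub>"
proof -
  interpret cring R using loc unfolding local_ring_at_def by blast
  have m: "maximalideal \<mm> R" using loc unfolding local_ring_at_def by blast
  have mi: "ideal \<mm> R" using m by (simp add: maximalideal_def)
  have m1: "\<one>\<^bsub>R\<^esub> \<notin> \<mm>"
    using ideal.one_imp_carrier[OF mi] maximalideal.I_notcarr[OF m] by metis
  interpret reg: plain_module R "regular_module R"
    by (rule plain_module.intro[OF regular_module_is_module])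
  let ?Q = "residue_field_module R \<mm>"
  have sub: "submodule \<mm> R (regular_module R)" using mi by (simp add: submodule_regular_module_iff)
  have Q: "module R ?Q" by (rule reg.quot_module_is_module[OF sub])
  have E: "module R E" using hull unfolding injective_hull_def injective_module_def by blast
  obtain j where j: "j \<in> module_hom R ?Q E" "inj_on j (carrier ?Q)"
    using hull unfolding injective_hull_def by blast
  let ?c = "\<mm> +>\<^bsub>regular_module R\<^esub> \<one>\<^bsub>R\<^esub>"
  have c: "?c \<in> carrier ?Q" using reg.quot_module_carrier[OF sub] by auto
  interpret Q: module R ?Q by (rule Q)
  have j0: "j \<zero>\<^bsub>?Q\<^esub> = \<zero>\<^bsub>E\<^esub>" by (rule module_hom_zero[OF Q E j(1)])
  show thesis
  proof (rule that)
    show "j ?c \<in> carrier E" by (rule module_homD(1)[OF j(1) c])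
    show "j ?c \<noteq> \<zero>\<^bsub>E\<^esub>"
    proof
      assume "j ?c = \<zero>\<^bsub>E\<^esub>"
      then have "?c = \<zero>\<^bsub>?Q\<^esub>" using j0 inj_onD[OF j(2) _ c Q.M.zero_closed] by simp
      then have "?c = \<mm>" using reg.quot_module_zero[OF sub] by simp
      then show False using reg.coset_eq_submodule_iff[OF sub, of "\<one>\<^bsub>R\<^esub>"] m1 by simp
    qed
    fix a assume a: "a \<in> \<mm>"
    then have ac: "a \<in> carrier R" using mi[unfolded ideal_iff] by blast
    have "a \<odot>\<^bsub>?Q\<^esub> ?c = \<mm> +>\<^bsub>regular_module R\<^esub> a"
      using reg.quot_module_smult[OF sub ac, of "\<one>\<^bsub>R\<^esub>"] ac by simp
    also have "\<dots> = \<mm>" using reg.coset_eq_submodule_iff[OF sub, of a] ac a by simp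
    finally have "a \<odot>\<^bsub>?Q\<^esub> ?c = \<zero>\<^bsub>?Q\<^esub>" using reg.quot_module_zero[OF sub] by simp
    then show "a \<odot>\<^bsub>E\<^esub> j ?c = \<zero>\<^bsub>E\<^esub>" using module_homD(3)[OF j(1) ac c] j0 by simp
  qed
qed

text \<open>As \<open>x \<notin> V\<close>, the conductor \<open>{r. rx \<in> V}\<close> is a proper ideal and therefore lies in \<open>\<mm>\<close>. So
  \<open>v + rx \<mapsto> re\<close>, with \<open>e \<noteq> 0\<close> in \<open>E\<close> killed by \<open>\<mm>\<close>, is well defined on \<open>V + Rx\<close>, and injectivity extends it
  to \<open>M\<close>.\<close>

lemma hom_separating:
  assumes noeth: "noetherian_ring R" and loc: "local_ring_at R \<mm>"
    and hull: "injective_hull R (residue_field_module R \<mm>) E"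
    and M: "module R M" and V: "submodule V R M" and x: "x \<in> carrier M" "x \<notin> V"
  obtains h where "h \<in> module_hom R M E" "\<And>v. v \<in> V \<Longrightarrow> h v = \<zero>\<^bsub>E\<^esub>" "h x \<noteq> \<zero>\<^bsub>E\<^esub>"
proof -
  have inj: "injective_module R E" using hull unfolding injective_hull_def by blast
  then have E: "module R E" unfolding injective_module_def by blast
  interpret M: module R M by fact
  interpret E: module R E by fact
  obtain e where e: "e \<in> carrier E" "e \<noteq> \<zero>\<^bsub>E\<^esub>" "\<And>a. a \<in> \<mm> \<Longrightarrow> a \<odot>\<^bsub>E\<^esub> e = \<zero>\<^bsub>E\<^esub>"
    using injective_hull_socle_element[OF loc hull] by blast
  note V' = V[unfolded M.submodule_iff]
  have Vc: "v \<in> carrier M" if "v \<in> V" for v using that V' by blast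
  let ?K = "{a \<in> carrier R. a \<odot>\<^bsub>M\<^esub> x \<in> V}"
  have "?K \<subseteq> \<mm>"
    by (rule local_ring_proper_ideal[OF noeth loc M.conductor_ideal[OF V x(1)]]) (use x in simp)
  define G where "G = {(v \<oplus>\<^bsub>M\<^esub> r \<odot>\<^bsub>M\<^esub> x, r \<odot>\<^bsub>E\<^esub> e) |v r. v \<in> V \<and> r \<in> carrier R}"
  have GI: "(v \<oplus>\<^bsub>M\<^esub> r \<odot>\<^bsub>M\<^esub> x, r \<odot>\<^bsub>E\<^esub> e) \<in> G" if "v \<in> V" "r \<in> carrier R" for v r
    using that unfolding G_def by blast
  have GV: "(v, \<zero>\<^bsub>E\<^esub>) \<in> G" if "v \<in> V" for v
    using GI[OF that M.R.zero_closed] Vc[OF that] x e by simp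
  have "partial_hom R M E G"
    unfolding partial_hom_def
  proof (intro conjI allI impI)
    show "(\<zero>\<^bsub>M\<^esub>, \<zero>\<^bsub>E\<^esub>) \<in> G" using GV V' by blast
    fix y u assume "(y, u) \<in> G"
    then obtain v r where y: "v \<in> V" "r \<in> carrier R" "y = v \<oplus>\<^bsub>M\<^esub> r \<odot>\<^bsub>M\<^esub> x" "u = r \<odot>\<^bsub>E\<^esub> e"
      unfolding G_def by blast
    show "y \<in> carrier M" "u \<in> carrier E" using y Vc x e by simp_all
    show "(a \<odot>\<^bsub>M\<^esub> y, a \<odot>\<^bsub>E\<^esub> u) \<in> G" if a: "a \<in> carrier R" for a
    proof -
      have "a \<odot>\<^bsub>M\<^esub> v \<in> V" using V' a y(1) by blast
      from GI[OF this M.R.m_closed[OF a y(2)]] show ?thesis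
        using y Vc a x e by (simp add: M.smult_r_distr M.smult_assoc1 E.smult_assoc1)
    qed
    fix y' u' assume "(y', u') \<in> G"
    then obtain v' r' where y': "v' \<in> V" "r' \<in> carrier R" "y' = v' \<oplus>\<^bsub>M\<^esub> r' \<odot>\<^bsub>M\<^esub> x" "u' = r' \<odot>\<^bsub>E\<^esub> e"
      unfolding G_def by blast
    have "v \<oplus>\<^bsub>M\<^esub> v' \<in> V" using V' y(1) y'(1) by blast
    from GI[OF this M.R.a_closed[OF y(2) y'(2)]] show "(y \<oplus>\<^bsub>M\<^esub> y', u \<oplus>\<^bsub>E\<^esub> u') \<in> G"
      using y y' Vc x e by (simp add: M.smult_l_distr E.smult_l_distr M.M.a_ac)
  next
    fix u assume "(\<zero>\<^bsub>M\<^esub>, u) \<in> G"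
    then obtain v r where y: "v \<in> V" "r \<in> carrier R" "\<zero>\<^bsub>M\<^esub> = v \<oplus>\<^bsub>M\<^esub> r \<odot>\<^bsub>M\<^esub> x" "u = r \<odot>\<^bsub>E\<^esub> e"
      unfolding G_def by blast
    have "\<ominus>\<^bsub>M\<^esub> v = r \<odot>\<^bsub>M\<^esub> x"
      by (rule M.M.minus_equality) (use y Vc x in \<open>simp_all add: M.M.a_comm\<close>)
    then have "r \<odot>\<^bsub>M\<^esub> x \<in> V" using M.submoduleE(3)[OF V y(1)] by simp
    then have "r \<in> \<mm>" using \<open>?K \<subseteq> \<mm>\<close> y(2) by blast
    then show "u = \<zero>\<^bsub>E\<^esub>" unfolding y(4) by (rule e(3))
  qed
  then obtain h where h: "h \<in> module_hom R M E" "\<And>y u. (y, u) \<in> G \<Longrightarrow> h y = u"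
    using partial_hom_total[OF M inj] by blast
  have "(\<zero>\<^bsub>M\<^esub> \<oplus>\<^bsub>M\<^esub> \<one>\<^bsub>R\<^esub> \<odot>\<^bsub>M\<^esub> x, \<one>\<^bsub>R\<^esub> \<odot>\<^bsub>E\<^esub> e) \<in> G" by (rule GI) (use V' in auto)
  then have "(x, e) \<in> G" using x e by simp
  then have "h x \<noteq> \<zero>\<^bsub>E\<^esub>" using h(2) e(2) by simp
  with h(2)[OF GV] show thesis using that[OF h(1)] by blast
qed

section \<open>Generated and cogenerated modules\<close>

lemma direct_power_simps:
  "carrier (direct_power \<Lambda> A) = \<Lambda> \<rightarrow>\<^sub>E carrier A"
  "x \<oplus>\<^bsub>direct_power \<Lambda> A\<^esub> y = (\<lambda>i\<in>\<Lambda>. x i \<oplus>\<^bsub>A\<^esub> y i)"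
  "a \<odot>\<^bsub>direct_power \<Lambda> A\<^esub> x = (\<lambda>i\<in>\<Lambda>. a \<odot>\<^bsub>A\<^esub> x i)"
  by (simp_all add: direct_power_def)

lemma direct_copower_simps:
  "carrier (direct_copower \<Lambda> A) = {x \<in> \<Lambda> \<rightarrow>\<^sub>E carrier A. finite {i\<in>\<Lambda>. x i \<noteq> \<zero>\<^bsub>A\<^esub>}}"
  "x \<oplus>\<^bsub>direct_copower \<Lambda> A\<^esub> y = (\<lambda>i\<in>\<Lambda>. x i \<oplus>\<^bsub>A\<^esub> y i)"
  "a \<odot>\<^bsub>direct_copower \<Lambda> A\<^esub> x = (\<lambda>i\<in>\<Lambda>. a \<odot>\<^bsub>A\<^esub> x i)"
  by (simp_all add: direct_copower_def direct_power_def make_module_def)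

lemma generated_by_hom_image:
  fixes A :: "('r, 'a) module" and M :: "('r, 'm) module"
  assumes \<phi>: "\<phi> \<in> module_hom R A M"
  shows "generated_by R A (M\<lparr>carrier := \<phi> ` carrier A\<rparr>)"
proof -
  let ?C = "direct_copower {\<phi>} A"
  have v: "x \<phi> \<in> carrier A" if "x \<in> carrier ?C" for x
    using that by (auto simp: direct_copower_simps)
  have "(\<lambda>x. \<phi> (x \<phi>)) \<in> module_hom R ?C (M\<lparr>carrier := \<phi> ` carrier A\<rparr>)"
    by (rule module_homI) (simp_all add: v, simp_all add: direct_copower_simps module_homD[OF \<phi>] v)
  moreover have "(\<lambda>x. \<phi> (x \<phi>)) ` carrier ?C = \<phi> ` carrier A"
  proof
    show "(\<lambda>x. \<phi> (x \<phi>)) ` carrier ?C \<subseteq> \<phi> ` carrier A" using v by blast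
    show "\<phi> ` carrier A \<subseteq> (\<lambda>x. \<phi> (x \<phi>)) ` carrier ?C"
    proof
      fix u assume "u \<in> \<phi> ` carrier A"
      then obtain a where a: "a \<in> carrier A" "u = \<phi> a" by blast
      have "(\<lambda>i\<in>{\<phi>}. a) \<in> carrier ?C" using a(1) by (simp add: direct_copower_simps)
      moreover have "u = \<phi> ((\<lambda>i\<in>{\<phi>}. a) \<phi>)" using a(2) by simp
      ultimately show "u \<in> (\<lambda>x. \<phi> (x \<phi>)) ` carrier ?C"
        by (intro image_eqI[where x = "\<lambda>i\<in>{\<phi>}. a"])
    qed
  qed
  ultimately show ?thesis unfolding generated_by_def by fastforce
qed

text \<open>An element of a direct sum is a finite sum of elements of the summands, so a submodule that
  contains the images of all homomorphisms \<open>A \<rightarrow> M\<close> contains the image of the direct sum.\<close>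

lemma generated_by_subset:
  fixes A :: "('r, 'a) module" and M :: "('r, 'm) module"
  assumes A: "module R A" and M: "module R M" and U: "submodule U R M" and W: "submodule W R M"
    and gen: "generated_by R A (M\<lparr>carrier := U\<rparr>)"
    and sub: "\<And>\<phi> a. \<lbrakk>\<phi> \<in> module_hom R A M; a \<in> carrier A\<rbrakk> \<Longrightarrow> \<phi> a \<in> W"
  shows "U \<subseteq> W"
proof
  interpret A: module R A by fact
  interpret M: module R M by fact
  note U' = U[unfolded M.submodule_iff] and W' = W[unfolded M.submodule_iff]
  obtain \<Lambda> :: "('a \<Rightarrow> 'm) set" and f
    where f: "f \<in> module_hom R (direct_copower \<Lambda> A) (M\<lparr>carrier := U\<rparr>)"
      and fU: "f ` carrier (direct_copower \<Lambda> A) = U"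
    using gen unfolding generated_by_def by auto
  let ?C = "direct_copower \<Lambda> A"
  have fc: "f x \<in> carrier M" if "x \<in> carrier ?C" for x using module_homD(1)[OF f that] U' by auto
  have fa: "f (x \<oplus>\<^bsub>?C\<^esub> y) = f x \<oplus>\<^bsub>M\<^esub> f y" if "x \<in> carrier ?C" "y \<in> carrier ?C" for x y
    using module_homD(2)[OF f that] by simp
  have fs: "f (a \<odot>\<^bsub>?C\<^esub> x) = a \<odot>\<^bsub>M\<^esub> f x" if "a \<in> carrier R" "x \<in> carrier ?C" for a x
    using module_homD(3)[OF f that] by simp
  define \<delta> where "\<delta> i a = (\<lambda>j\<in>\<Lambda>. if j = i then a else \<zero>\<^bsub>A\<^esub>)" for i a
  have \<delta>c: "\<delta> i a \<in> carrier ?C" if "a \<in> carrier A" for i a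
  proof -
    have "{j \<in> \<Lambda>. \<delta> i a j \<noteq> \<zero>\<^bsub>A\<^esub>} \<subseteq> {i}" unfolding \<delta>_def by auto
    then have "finite {j \<in> \<Lambda>. \<delta> i a j \<noteq> \<zero>\<^bsub>A\<^esub>}" by (rule finite_subset) simp
    moreover have "\<delta> i a \<in> \<Lambda> \<rightarrow>\<^sub>E carrier A" unfolding \<delta>_def using that by auto
    ultimately show ?thesis by (simp add: direct_copower_simps)
  qed
  have "(\<lambda>a. f (\<delta> i a)) \<in> module_hom R A M" for i
  proof (rule module_homI)
    show "f (\<delta> i a) \<in> carrier M" if "a \<in> carrier A" for a by (rule fc[OF \<delta>c[OF that]])
    show "f (\<delta> i (a \<oplus>\<^bsub>A\<^esub> b)) = f (\<delta> i a) \<oplus>\<^bsub>M\<^esub> f (\<delta> i b)" if "a \<in> carrier A" "b \<in> carrier A" for a b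
    proof -
      have "\<delta> i (a \<oplus>\<^bsub>A\<^esub> b) = \<delta> i a \<oplus>\<^bsub>?C\<^esub> \<delta> i b"
        unfolding direct_copower_simps \<delta>_def by (rule restrict_ext) simp
      then show ?thesis using fa[OF \<delta>c[OF that(1)] \<delta>c[OF that(2)]] by simp
    qed
    show "f (\<delta> i (r \<odot>\<^bsub>A\<^esub> a)) = r \<odot>\<^bsub>M\<^esub> f (\<delta> i a)" if "r \<in> carrier R" "a \<in> carrier A" for r a
    proof -
      have "\<delta> i (r \<odot>\<^bsub>A\<^esub> a) = r \<odot>\<^bsub>?C\<^esub> \<delta> i a"
        unfolding direct_copower_simps \<delta>_def by (rule restrict_ext) (simp add: that A.smult_r_null)
      then show ?thesis using fs[OF that(1) \<delta>c[OF that(2)]] by simp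
    qed
  qed
  then have \<delta>W: "f (\<delta> i a) \<in> W" if "a \<in> carrier A" for i a using sub[OF _ that] by blast
  have "\<forall>x\<in>carrier ?C. {i \<in> \<Lambda>. x i \<noteq> \<zero>\<^bsub>A\<^esub>} \<subseteq> F \<longrightarrow> f x \<in> W" if "finite F" for F
    using that
  proof induction
    case empty
    show ?case
    proof (intro ballI impI)
      fix x assume x: "x \<in> carrier ?C" "{i \<in> \<Lambda>. x i \<noteq> \<zero>\<^bsub>A\<^esub>} \<subseteq> {}"
      have "(\<lambda>i\<in>\<Lambda>. x i) = x" using x(1) by (auto simp: direct_copower_simps)
      moreover have "\<zero>\<^bsub>R\<^esub> \<odot>\<^bsub>?C\<^esub> x = (\<lambda>i\<in>\<Lambda>. x i)"
        unfolding direct_copower_simps by (rule restrict_ext) (use x(2) in auto)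
      ultimately have "f x = \<zero>\<^bsub>R\<^esub> \<odot>\<^bsub>M\<^esub> f x" using fs[OF A.R.zero_closed x(1)] by simp
      then have "f x = \<zero>\<^bsub>M\<^esub>" using fc[OF x(1)] by simp
      then show "f x \<in> W" using W' by simp
    qed
  next
    case (insert i F)
    show ?case
    proof (intro ballI impI)
      fix x assume x: "x \<in> carrier ?C" "{j \<in> \<Lambda>. x j \<noteq> \<zero>\<^bsub>A\<^esub>} \<subseteq> insert i F"
      have xc: "x j \<in> carrier A" if "j \<in> \<Lambda>" for j using x(1) that by (auto simp: direct_copower_simps)
      define x' where "x' = (\<lambda>j\<in>\<Lambda>. if j = i then \<zero>\<^bsub>A\<^esub> else x j)"
      have x'c: "x' \<in> carrier ?C"
      proof -
        have "{j \<in> \<Lambda>. x' j \<noteq> \<zero>\<^bsub>A\<^esub>} \<subseteq> {j \<in> \<Lambda>. x j \<noteq> \<zero>\<^bsub>A\<^esub>}" unfolding x'_def by auto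
        then have "finite {j \<in> \<Lambda>. x' j \<noteq> \<zero>\<^bsub>A\<^esub>}"
          by (rule finite_subset) (use x(1) in \<open>simp add: direct_copower_simps\<close>)
        moreover have "x' \<in> \<Lambda> \<rightarrow>\<^sub>E carrier A" unfolding x'_def using xc by auto
        ultimately show ?thesis by (simp add: direct_copower_simps)
      qed
      have "{j \<in> \<Lambda>. x' j \<noteq> \<zero>\<^bsub>A\<^esub>} \<subseteq> F" using x(2) unfolding x'_def by auto
      then have x'W: "f x' \<in> W" using insert.IH x'c by blast
      show "f x \<in> W"
      proof (cases "i \<in> \<Lambda>")
        case True
        have "x' \<oplus>\<^bsub>?C\<^esub> \<delta> i (x i) = (\<lambda>j\<in>\<Lambda>. x j)"
          unfolding direct_copower_simps \<delta>_def x'_def by (rule restrict_ext) (use xc in auto)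
        also have "\<dots> = x" using x(1) by (auto simp: direct_copower_simps)
        finally have "f x = f x' \<oplus>\<^bsub>M\<^esub> f (\<delta> i (x i))" using fa[OF x'c \<delta>c[OF xc[OF True], of i]] by simp
        then show ?thesis using W' x'W \<delta>W[OF xc[OF True]] by simp
      next
        case False
        have "x' = (\<lambda>j\<in>\<Lambda>. x j)" unfolding x'_def by (rule restrict_ext) (use False in auto)
        also have "\<dots> = x" using x(1) by (auto simp: direct_copower_simps)
        finally show ?thesis using x'W by simp
      qed
    qed
  qed
  then have fW: "f x \<in> W" if "x \<in> carrier ?C" for x
    using that by (auto simp: direct_copower_simps)
  fix u assume "u \<in> U"
  then show "u \<in> W" using fU fW by blast
qed

context plain_module
begin

lemma quot_cogenerated_by_kernel:
  fixes D :: "('r, 'd) module"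
  assumes D: "module R D" and \<phi>: "\<phi> \<in> module_hom R M D"
  shows "cogenerated_by R D (quot_module M {x \<in> carrier M. \<phi> x = \<zero>\<^bsub>D\<^esub>})"
proof -
  interpret D: module R D by fact
  define V where "V = {x \<in> carrier M. \<phi> x = \<zero>\<^bsub>D\<^esub>}"
  have V: "submodule V R M" unfolding V_def by (rule submodule_kernel[OF module_axioms D \<phi>])
  have eq: "\<phi> x = \<phi> y \<longleftrightarrow> V +>\<^bsub>M\<^esub> x = V +>\<^bsub>M\<^esub> y" if xy: "x \<in> carrier M" "y \<in> carrier M" for x y
  proof -
    have "V +>\<^bsub>M\<^esub> x = V +>\<^bsub>M\<^esub> y \<longleftrightarrow> x \<ominus>\<^bsub>M\<^esub> y \<in> V" by (rule coset_eq_iff[OF V xy])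
    also have "\<dots> \<longleftrightarrow> \<phi> x \<ominus>\<^bsub>D\<^esub> \<phi> y = \<zero>\<^bsub>D\<^esub>"
      unfolding V_def using xy by (simp add: module_hom_minus[OF module_axioms D \<phi>])
    also have "\<dots> \<longleftrightarrow> \<phi> x = \<phi> y"
      using D.minus_eq_zero_imp_eq[of "\<phi> x" "\<phi> y"] module_homD(1)[OF \<phi>] xy
      by (auto simp: D.M.minus_eq D.M.r_neg)
    finally show ?thesis by blast
  qed
  define g where "g C = \<phi> (SOME y. y \<in> carrier M \<and> V +>\<^bsub>M\<^esub> y = C)" for C
  have g: "g (V +>\<^bsub>M\<^esub> x) = \<phi> x" if x: "x \<in> carrier M" for x
  proof -
    let ?y = "SOME y. y \<in> carrier M \<and> V +>\<^bsub>M\<^esub> y = V +>\<^bsub>M\<^esub> x"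
    have "?y \<in> carrier M \<and> V +>\<^bsub>M\<^esub> ?y = V +>\<^bsub>M\<^esub> x" by (rule someI[of _ x]) (simp add: x)
    then show ?thesis unfolding g_def using eq x by blast
  qed
  \<comment> \<open>A single factor \<open>D\<close> is enough, so any one-element index set will do.\<close>
  let ?\<Lambda> = "{undefined :: 'm set \<Rightarrow> 'd}"
  let ?f = "\<lambda>C. \<lambda>i\<in>?\<Lambda>. g C"
  have "?f \<in> module_hom R (quot_module M V) (direct_power ?\<Lambda> D)"
  proof (rule module_homI)
    fix C assume "C \<in> carrier (quot_module M V)"
    then obtain x where x: "x \<in> carrier M" "C = V +>\<^bsub>M\<^esub> x" by (auto simp: quot_module_carrier[OF V])
    show "?f C \<in> carrier (direct_power ?\<Lambda> D)"
      unfolding direct_power_simps x(2) using g[OF x(1)] module_homD(1)[OF \<phi> x(1)] by auto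
    show "?f (a \<odot>\<^bsub>quot_module M V\<^esub> C) = a \<odot>\<^bsub>direct_power ?\<Lambda> D\<^esub> ?f C" if a: "a \<in> carrier R" for a
      unfolding direct_power_simps x(2)
      by (rule restrict_ext) (simp add: quot_module_smult[OF V] a x(1) g module_homD[OF \<phi>])
    fix B assume "B \<in> carrier (quot_module M V)"
    then obtain y where y: "y \<in> carrier M" "B = V +>\<^bsub>M\<^esub> y" by (auto simp: quot_module_carrier[OF V])
    show "?f (C \<oplus>\<^bsub>quot_module M V\<^esub> B) = ?f C \<oplus>\<^bsub>direct_power ?\<Lambda> D\<^esub> ?f B"
      unfolding direct_power_simps x(2) y(2)
      by (rule restrict_ext) (simp add: quot_module_add[OF V] x(1) y(1) g module_homD[OF \<phi>])
  qed
  moreover have "inj_on ?f (carrier (quot_module M V))"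
  proof (rule inj_onI)
    fix C B assume "C \<in> carrier (quot_module M V)" "B \<in> carrier (quot_module M V)" and fCB: "?f C = ?f B"
    then obtain x y where xy: "x \<in> carrier M" "C = V +>\<^bsub>M\<^esub> x" "y \<in> carrier M" "B = V +>\<^bsub>M\<^esub> y"
      by (auto simp: quot_module_carrier[OF V])
    have "g C = g B" using fun_cong[OF fCB, of undefined] by simp
    then show "C = B" using xy g eq by simp
  qed
  ultimately show ?thesis unfolding cogenerated_by_def V_def by blast
qed

text \<open>The coordinates of an embedding of \<open>M/V\<close> into a power of \<open>D\<close> are homomorphisms \<open>M \<rightarrow> D\<close>.\<close>

lemma cogenerated_by_separates:
  fixes D :: "('r, 'd) module"
  assumes D: "module R D" and V: "submodule V R M" and cogen: "cogenerated_by R D (quot_module M V)"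
    and x: "x \<in> carrier M" and zero: "\<And>\<phi>. \<phi> \<in> module_hom R M D \<Longrightarrow> \<phi> x = \<zero>\<^bsub>D\<^esub>"
  shows "x \<in> V"
proof -
  let ?Q = "quot_module M V"
  obtain \<Lambda> :: "('m set \<Rightarrow> 'd) set" and f
    where f: "f \<in> module_hom R ?Q (direct_power \<Lambda> D)" and inj: "inj_on f (carrier ?Q)"
    using cogen unfolding cogenerated_by_def by blast
  have Qc: "V +>\<^bsub>M\<^esub> y \<in> carrier ?Q" if "y \<in> carrier M" for y
    using that by (auto simp: quot_module_carrier[OF V])
  have hom: "(\<lambda>y. f (V +>\<^bsub>M\<^esub> y) i) \<in> module_hom R M D" if i: "i \<in> \<Lambda>" for i
  proof (rule module_homI)
    show "f (V +>\<^bsub>M\<^esub> y) i \<in> carrier D" if "y \<in> carrier M" for y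
      using module_homD(1)[OF f Qc[OF that]] i by (auto simp: direct_power_simps)
    show "f (V +>\<^bsub>M\<^esub> (y \<oplus>\<^bsub>M\<^esub> z)) i = f (V +>\<^bsub>M\<^esub> y) i \<oplus>\<^bsub>D\<^esub> f (V +>\<^bsub>M\<^esub> z) i"
      if "y \<in> carrier M" "z \<in> carrier M" for y z
      using module_homD(2)[OF f Qc[OF that(1)] Qc[OF that(2)]] i that
      by (simp add: direct_power_simps quot_module_add[OF V])
    show "f (V +>\<^bsub>M\<^esub> (a \<odot>\<^bsub>M\<^esub> y)) i = a \<odot>\<^bsub>D\<^esub> f (V +>\<^bsub>M\<^esub> y) i"
      if "a \<in> carrier R" "y \<in> carrier M" for a y
      using module_homD(3)[OF f that(1) Qc[OF that(2)]] i that
      by (simp add: direct_power_simps quot_module_smult[OF V])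
  qed
  have "f (V +>\<^bsub>M\<^esub> x) = f (V +>\<^bsub>M\<^esub> \<zero>\<^bsub>M\<^esub>)"
  proof (rule extensionalityI)
    show "f (V +>\<^bsub>M\<^esub> x) \<in> extensional \<Lambda>" "f (V +>\<^bsub>M\<^esub> \<zero>\<^bsub>M\<^esub>) \<in> extensional \<Lambda>"
      using module_homD(1)[OF f Qc] x by (auto simp: direct_power_simps PiE_def)
    show "f (V +>\<^bsub>M\<^esub> x) i = f (V +>\<^bsub>M\<^esub> \<zero>\<^bsub>M\<^esub>) i" if "i \<in> \<Lambda>" for i
      using zero[OF hom[OF that]] module_hom_zero[OF module_axioms D hom[OF that]] by simp
  qed
  then have "V +>\<^bsub>M\<^esub> x = V +>\<^bsub>M\<^esub> \<zero>\<^bsub>M\<^esub>" by (rule inj_onD[OF inj _ Qc[OF x] Qc[OF M.zero_closed]])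
  also have "\<dots> = V" by (rule M.a_coset_add_zero[OF submoduleE(1)[OF V]])
  finally show ?thesis using coset_eq_submodule_iff[OF V x] by blast
qed

section \<open>The submodules \<open>\<gamma>(M)\<close> and \<open>\<kappa>(M)\<close>\<close>

lemma gamma_is_submodule: "submodule (gamma R I M) R M"
  unfolding gamma_def
  by (rule generated_submodule_is_submodule) (auto simp: submodule_iff)

lemma hom_image_in_gamma:
  assumes I: "ideal I R" and \<phi>: "\<phi> \<in> module_hom R (ideal_module R I) M" and a: "a \<in> I"
  shows "\<phi> a \<in> gamma R I M"
proof -
  note A = R.ideal_module_is_module[OF I]
  have "submodule (\<phi> ` I) R M"
    using submodule_image[OF A module_axioms \<phi> module.carrier_is_submodule[OF A]] by simp
  moreover have "generated_by R (ideal_module R I) (M\<lparr>carrier := \<phi> ` I\<rparr>)"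
    using generated_by_hom_image[OF \<phi>] by simp
  ultimately show ?thesis
    unfolding gamma_def using a by (intro subsetD[OF generated_submodule_subset]) blast
qed

lemma gamma_least:
  assumes I: "ideal I R" and W: "submodule W R M"
    and sub: "\<And>\<phi> a. \<lbrakk>\<phi> \<in> module_hom R (ideal_module R I) M; a \<in> I\<rbrakk> \<Longrightarrow> \<phi> a \<in> W"
  shows "gamma R I M \<subseteq> W"
  unfolding gamma_def
proof (rule generated_submodule_least[OF W], rule Union_least)
  fix U assume "U \<in> {U. submodule U R M \<and> generated_by R (ideal_module R I) (M\<lparr>carrier := U\<rparr>)}"
  then show "U \<subseteq> W"
    using generated_by_subset[OF R.ideal_module_is_module[OF I] module_axioms _ W] sub by auto
qed

lemma kappa_eq_common_kernel:
  assumes I: "ideal I R" and E: "module R E"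
  shows "kappa R E I M = {x \<in> carrier M. \<forall>\<phi>\<in>module_hom R M (matlis_dual R E (ideal_module R I)).
    \<phi> x = \<zero>\<^bsub>matlis_dual R E (ideal_module R I)\<^esub>}" (is "_ = ?K")
proof -
  let ?D = "matlis_dual R E (ideal_module R I)"
  have D: "module R ?D" by (rule hom_module_is_module[OF R.ideal_module_is_module[OF I] E])
  interpret D: module R ?D by (rule D)
  show ?thesis
  proof
    have mem: "\<phi> x = \<zero>\<^bsub>?D\<^esub> \<and> x \<in> carrier M"
      if x: "x \<in> kappa R E I M" and \<phi>: "\<phi> \<in> module_hom R M ?D" for x \<phi>
    proof -
      have "x \<in> {x \<in> carrier M. \<phi> x = \<zero>\<^bsub>?D\<^esub>}"
        using x submodule_kernel[OF module_axioms D \<phi>] quot_cogenerated_by_kernel[OF D \<phi>]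
        unfolding kappa_def by blast
      then show ?thesis by blast
    qed
    have "(\<lambda>x. \<zero>\<^bsub>?D\<^esub>) \<in> module_hom R M ?D"
      by (rule module_homI) simp_all
    then show "kappa R E I M \<subseteq> ?K" using mem by blast
    show "?K \<subseteq> kappa R E I M"
      unfolding kappa_def using cogenerated_by_separates[OF D] by blast
  qed
qed

text \<open>Both kinds of homomorphisms are bilinear maps \<open>M \<times> I \<rightarrow> E\<close>. Thus \<open>\<kappa>(M)\<close> consists of the elements
  at which all members of \<open>\<gamma>(M\<degree>)\<close> vanish.\<close>

lemma kappa_eq_annihilated:
  assumes I: "ideal I R" and E: "module R E"
  shows "kappa R E I M = {x \<in> carrier M. \<forall>\<psi>\<in>module_hom R (ideal_module R I) (matlis_dual R E M).
    \<forall>a\<in>I. \<psi> a x = \<zero>\<^bsub>E\<^esub>}"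
proof -
  interpret E: module R E by fact
  let ?D = "matlis_dual R E (ideal_module R I)"
  have Ii: "I \<subseteq> carrier R" "\<And>a b. \<lbrakk>a \<in> I; b \<in> I\<rbrakk> \<Longrightarrow> a \<oplus> b \<in> I" "\<And>a b. \<lbrakk>a \<in> carrier R; b \<in> I\<rbrakk> \<Longrightarrow> a \<otimes> b \<in> I"
    using I[unfolded R.ideal_iff] by blast+
  have "(\<forall>\<phi>\<in>module_hom R M ?D. \<phi> x = \<zero>\<^bsub>?D\<^esub>) \<longleftrightarrow>
      (\<forall>\<psi>\<in>module_hom R (ideal_module R I) (matlis_dual R E M). \<forall>a\<in>I. \<psi> a x = \<zero>\<^bsub>E\<^esub>)"
    if x: "x \<in> carrier M" for x
  proof (intro iffI ballI)
    fix \<psi> a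
    assume *: "\<forall>\<phi>\<in>module_hom R M ?D. \<phi> x = \<zero>\<^bsub>?D\<^esub>"
      and \<psi>: "\<psi> \<in> module_hom R (ideal_module R I) (matlis_dual R E M)" and a: "a \<in> I"
    have h: "\<psi> b \<in> module_hom R M E" if "b \<in> I" for b
      using module_homD(1)[OF \<psi>, of b] that by (simp add: hom_module_simps)
    have "(\<lambda>y. \<lambda>b\<in>I. \<psi> b y) \<in> module_hom R M ?D"
    proof (rule module_homI)
      show "(\<lambda>b\<in>I. \<psi> b y) \<in> carrier ?D" if y: "y \<in> carrier M" for y
        unfolding hom_module_simps ideal_module_simps
        by (intro IntI restrict_extensional module_homI)
           (use Ii y module_homD[OF h] module_homD(2,3)[OF \<psi>] in \<open>simp_all add: hom_module_simps\<close>)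
      show "(\<lambda>b\<in>I. \<psi> b (y \<oplus>\<^bsub>M\<^esub> z)) = (\<lambda>b\<in>I. \<psi> b y) \<oplus>\<^bsub>?D\<^esub> (\<lambda>b\<in>I. \<psi> b z)"
        if "y \<in> carrier M" "z \<in> carrier M" for y z
        unfolding hom_module_simps ideal_module_simps
        by (rule restrict_ext) (simp add: module_homD(2)[OF h] that)
      show "(\<lambda>b\<in>I. \<psi> b (c \<odot>\<^bsub>M\<^esub> y)) = c \<odot>\<^bsub>?D\<^esub> (\<lambda>b\<in>I. \<psi> b y)"
        if "c \<in> carrier R" "y \<in> carrier M" for c y
        unfolding hom_module_simps ideal_module_simps
        by (rule restrict_ext) (simp add: module_homD(3)[OF h] that)
    qed
    then have "(\<lambda>b\<in>I. \<psi> b x) = \<zero>\<^bsub>?D\<^esub>" by (rule bspec[OF *])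
    then have "(\<lambda>b\<in>I. \<psi> b x) a = \<zero>\<^bsub>?D\<^esub> a" by simp
    then show "\<psi> a x = \<zero>\<^bsub>E\<^esub>" using a by (simp add: hom_module_simps)
  next
    fix \<phi>
    assume *: "\<forall>\<psi>\<in>module_hom R (ideal_module R I) (matlis_dual R E M). \<forall>a\<in>I. \<psi> a x = \<zero>\<^bsub>E\<^esub>"
      and \<phi>: "\<phi> \<in> module_hom R M ?D"
    have h: "\<phi> y \<in> module_hom R (ideal_module R I) E" "\<phi> y \<in> extensional I" if "y \<in> carrier M" for y
      using module_homD(1)[OF \<phi> that] by (simp_all add: hom_module_simps)
    have "(\<lambda>b. \<lambda>y\<in>carrier M. \<phi> y b) \<in> module_hom R (ideal_module R I) (matlis_dual R E M)"
    proof (rule module_homI)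
      show "(\<lambda>y\<in>carrier M. \<phi> y b) \<in> carrier (matlis_dual R E M)" if "b \<in> carrier (ideal_module R I)" for b
        unfolding hom_module_simps
        by (intro IntI restrict_extensional module_homI)
           (use that module_homD(1)[OF h(1)] module_homD(2,3)[OF \<phi>] in \<open>simp_all add: hom_module_simps\<close>)
      show "(\<lambda>y\<in>carrier M. \<phi> y (b \<oplus>\<^bsub>ideal_module R I\<^esub> c))
          = (\<lambda>y\<in>carrier M. \<phi> y b) \<oplus>\<^bsub>matlis_dual R E M\<^esub> (\<lambda>y\<in>carrier M. \<phi> y c)"
        if "b \<in> carrier (ideal_module R I)" "c \<in> carrier (ideal_module R I)" for b c
        unfolding hom_module_simps
        by (rule restrict_ext) (use module_homD(2)[OF h(1) that] in simp)
      show "(\<lambda>y\<in>carrier M. \<phi> y (r \<odot>\<^bsub>ideal_module R I\<^esub> b)) = r \<odot>\<^bsub>matlis_dual R E M\<^esub> (\<lambda>y\<in>carrier M. \<phi> y b)"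
        if "r \<in> carrier R" "b \<in> carrier (ideal_module R I)" for r b
        unfolding hom_module_simps
        by (rule restrict_ext) (use module_homD(3)[OF h(1) that] in simp)
    qed
    then have "\<forall>b\<in>I. \<phi> x b = \<zero>\<^bsub>E\<^esub>" using * x by fastforce
    then have "(\<lambda>b\<in>I. \<phi> x b) = \<zero>\<^bsub>?D\<^esub>"
      unfolding hom_module_simps ideal_module_simps by (intro restrict_ext) blast
    then show "\<phi> x = \<zero>\<^bsub>?D\<^esub>" using extensional_restrict[OF h(2)[OF x]] by simp
  qed
  then show ?thesis unfolding kappa_eq_common_kernel[OF I E] by blast
qed

end

section \<open>The support of an ideal\<close>

text \<open>If the localization vanishes, then every element of \<open>I\<close> is killed by some \<open>u \<notin> \<pp>\<close>. The ideals
  \<open>{x \<in> I. ux = 0}\<close> grow when \<open>u\<close> is replaced by a product \<open>uv\<close>, so a maximal one among them is all of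
  \<open>I\<close>, and its \<open>u\<close> annihilates \<open>I\<close>. Conversely, an annihilator of \<open>I\<close> outside \<open>\<pp>\<close> identifies all fractions.\<close>

lemma Supp_ideal_module:
  assumes noeth: "noetherian_ring R" and R: "cring R" and I: "ideal I R"
  shows "Supp R (ideal_module R I) = {\<pp>. primeideal \<pp> R \<and> annihilator R (ideal_module R I) \<subseteq> \<pp>}"
proof -
  let ?N = "ideal_module R I"
  interpret cring R by fact
  interpret N: module R ?N by (rule ideal_module_is_module[OF I])
  note I' = I[unfolded ideal_iff]
  have Ic: "x \<in> carrier R" if "x \<in> I" for x using that I' by blast
  have "carrier (localization R ?N (carrier R - \<pp>)) = {\<zero>\<^bsub>localization R ?N (carrier R - \<pp>)\<^esub>}
      \<longleftrightarrow> \<not> annihilator R ?N \<subseteq> \<pp>" if p: "primeideal \<pp> R" for \<pp>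
  proof -
    interpret P: primeideal \<pp> R by fact
    define S where "S = carrier R - \<pp>"
    have one: "\<one>\<^bsub>R\<^esub> \<in> S" unfolding S_def using P.I_notcarr P.one_imp_carrier by auto
    have mul: "s \<otimes>\<^bsub>R\<^esub> t \<in> S" if "s \<in> S" "t \<in> S" for s t
      using that P.I_prime[of s t] unfolding S_def by blast
    have Sc: "s \<in> carrier R" if "s \<in> S" for s using that unfolding S_def by blast
    let ?r = "fraction_rel ?N S"
    have car: "carrier (localization R ?N S) = (I \<times> S) // ?r"
      and zer: "\<zero>\<^bsub>localization R ?N S\<^esub> = ?r `` {(\<zero>\<^bsub>R\<^esub>, \<one>\<^bsub>R\<^esub>)}"
      by (simp_all add: localization_def)
    have diff: "t \<odot>\<^bsub>?N\<^esub> x \<ominus>\<^bsub>?N\<^esub> s \<odot>\<^bsub>?N\<^esub> y \<in> carrier ?N"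
      if "x \<in> I" "y \<in> I" "s \<in> S" "t \<in> S" for x y s t
      using that Sc N.smult_closed[of t x] N.smult_closed[of s y] N.M.minus_closed
      unfolding ideal_module_simps(1) by simp
    show ?thesis
      unfolding S_def[symmetric] car zer
    proof
      assume eq: "(I \<times> S) // ?r = {?r `` {(\<zero>\<^bsub>R\<^esub>, \<one>\<^bsub>R\<^esub>)}}"
      have kill: "\<exists>u\<in>S. u \<otimes>\<^bsub>R\<^esub> x = \<zero>\<^bsub>R\<^esub>" if x: "x \<in> I" for x
      proof -
        have xN: "x \<in> carrier ?N" using x by simp
        have "?r `` {(x, \<one>\<^bsub>R\<^esub>)} \<in> (I \<times> S) // ?r" using x one by (intro quotientI) simp
        then have "?r `` {(x, \<one>\<^bsub>R\<^esub>)} = ?r `` {(\<zero>\<^bsub>R\<^esub>, \<one>\<^bsub>R\<^esub>)}" unfolding eq by simp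
        moreover have "((x, \<one>\<^bsub>R\<^esub>), (x, \<one>\<^bsub>R\<^esub>)) \<in> ?r"
        proof -
          have "\<one>\<^bsub>R\<^esub> \<odot>\<^bsub>?N\<^esub> (\<one>\<^bsub>R\<^esub> \<odot>\<^bsub>?N\<^esub> x \<ominus>\<^bsub>?N\<^esub> \<one>\<^bsub>R\<^esub> \<odot>\<^bsub>?N\<^esub> x) = \<zero>\<^bsub>?N\<^esub>"
            using xN N.M.r_neg[OF xN] by (simp only: N.smult_one N.M.minus_eq N.M.zero_closed)
          then show ?thesis unfolding fraction_rel_def using x one by auto
        qed
        ultimately have "((\<zero>\<^bsub>R\<^esub>, \<one>\<^bsub>R\<^esub>), (x, \<one>\<^bsub>R\<^esub>)) \<in> ?r" by blast
        then obtain u where u: "u \<in> S"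
          "u \<odot>\<^bsub>?N\<^esub> (\<one>\<^bsub>R\<^esub> \<odot>\<^bsub>?N\<^esub> \<zero>\<^bsub>R\<^esub> \<ominus>\<^bsub>?N\<^esub> \<one>\<^bsub>R\<^esub> \<odot>\<^bsub>?N\<^esub> x) = \<zero>\<^bsub>?N\<^esub>"
          unfolding fraction_rel_def by blast
        have z: "\<zero>\<^bsub>R\<^esub> = \<zero>\<^bsub>?N\<^esub>" by simp
        have ninv: "\<ominus>\<^bsub>?N\<^esub> x \<in> carrier ?N" using xN by (rule N.M.a_inv_closed)
        have "\<one>\<^bsub>R\<^esub> \<odot>\<^bsub>?N\<^esub> \<zero>\<^bsub>R\<^esub> \<ominus>\<^bsub>?N\<^esub> \<one>\<^bsub>R\<^esub> \<odot>\<^bsub>?N\<^esub> x = \<ominus>\<^bsub>?N\<^esub> x"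
          unfolding z using xN ninv by (simp only: N.smult_one N.M.minus_eq N.M.zero_closed N.M.l_zero)
        then have "u \<odot>\<^bsub>?N\<^esub> (\<ominus>\<^bsub>?N\<^esub> x) = \<zero>\<^bsub>?N\<^esub>" using u(2) by simp
        then have "\<ominus>\<^bsub>?N\<^esub> (u \<odot>\<^bsub>?N\<^esub> x) = \<zero>\<^bsub>?N\<^esub>" using N.smult_r_minus[OF Sc[OF u(1)] xN] by simp
        then have "\<zero>\<^bsub>?N\<^esub> \<ominus>\<^bsub>?N\<^esub> (u \<odot>\<^bsub>?N\<^esub> x) = \<zero>\<^bsub>?N\<^esub>"
          unfolding N.M.minus_eq by (simp only: N.M.l_zero N.M.zero_closed)
        then have "\<zero>\<^bsub>?N\<^esub> = u \<odot>\<^bsub>?N\<^esub> x"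
          by (rule N.minus_eq_zero_imp_eq[OF N.M.zero_closed N.smult_closed[OF Sc[OF u(1)] xN]])
        then show ?thesis using u(1) by (intro bexI[of _ u]) simp_all
      qed
      define \<K> where "\<K> = {{x \<in> I. u \<otimes>\<^bsub>R\<^esub> x = \<zero>\<^bsub>R\<^esub>} |u. u \<in> S}"
      have "{x \<in> I. \<one>\<^bsub>R\<^esub> \<otimes>\<^bsub>R\<^esub> x = \<zero>\<^bsub>R\<^esub>} \<in> \<K>" unfolding \<K>_def using one by blast
      then have ne: "\<K> \<noteq> {}" by blast
      have "ideal {x \<in> I. u \<otimes>\<^bsub>R\<^esub> x = \<zero>\<^bsub>R\<^esub>} R" if "u \<in> S" for u
        unfolding ideal_iff using I' Sc[OF that] Ic by (auto simp: r_distr m_lcomm)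
      then have "ideal K R" if "K \<in> \<K>" for K using that unfolding \<K>_def by blast
      then obtain K where K: "K \<in> \<K>" and max: "\<And>L. \<lbrakk>L \<in> \<K>; K \<subseteq> L\<rbrakk> \<Longrightarrow> L = K"
        using noetherian_ring.maximal_ideal_in_family[OF noeth ne] by metis
      then obtain u where u: "u \<in> S" "K = {x \<in> I. u \<otimes>\<^bsub>R\<^esub> x = \<zero>\<^bsub>R\<^esub>}" unfolding \<K>_def by blast
      have "u \<otimes>\<^bsub>R\<^esub> x = \<zero>\<^bsub>R\<^esub>" if x: "x \<in> I" for x
      proof -
        obtain v where v: "v \<in> S" "v \<otimes>\<^bsub>R\<^esub> x = \<zero>\<^bsub>R\<^esub>" using kill[OF x] by blast
        let ?L = "{y \<in> I. (u \<otimes>\<^bsub>R\<^esub> v) \<otimes>\<^bsub>R\<^esub> y = \<zero>\<^bsub>R\<^esub>}"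
        have "?L \<in> \<K>" unfolding \<K>_def using mul[OF u(1) v(1)] by blast
        moreover have "K \<subseteq> ?L"
          unfolding u(2) using Sc[OF u(1)] Sc[OF v(1)] Ic by (auto simp: m_comm[of u v] m_assoc)
        ultimately have L: "?L = K" by (rule max)
        have "x \<in> ?L" using x v Sc[OF u(1)] Sc[OF v(1)] Ic by (simp add: m_assoc)
        then show ?thesis unfolding L u(2) by blast
      qed
      then have "u \<in> annihilator R ?N" unfolding annihilator_def using Sc[OF u(1)] by simp
      then show "\<not> annihilator R ?N \<subseteq> \<pp>" using u(1) unfolding S_def by blast
    next
      assume "\<not> annihilator R ?N \<subseteq> \<pp>"
      then obtain j where j: "j \<in> annihilator R ?N" "j \<notin> \<pp>" by blast
      then have jS: "j \<in> S" unfolding S_def annihilator_def by blast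
      have jz: "j \<odot>\<^bsub>?N\<^esub> z = \<zero>\<^bsub>?N\<^esub>" if "z \<in> carrier ?N" for z
        using j(1) that unfolding annihilator_def by blast
      have "?r `` {p} = I \<times> S" if p: "p \<in> I \<times> S" for p
      proof -
        have "(p, q) \<in> ?r \<longleftrightarrow> q \<in> I \<times> S" for q
        proof
          assume "q \<in> I \<times> S"
          then show "(p, q) \<in> ?r"
            using p jS jz[OF diff] unfolding fraction_rel_def by fastforce
        qed (auto simp: fraction_rel_def)
        then show ?thesis by blast
      qed
      moreover have "(\<zero>\<^bsub>R\<^esub>, \<one>\<^bsub>R\<^esub>) \<in> I \<times> S" using I' one by blast
      ultimately show "(I \<times> S) // ?r = {?r `` {(\<zero>\<^bsub>R\<^esub>, \<one>\<^bsub>R\<^esub>)}}"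
        unfolding quotient_def by (simp, blast)
    qed
  qed
  then show ?thesis unfolding Supp_def by blast
qed

section \<open>Artinian quotients and coassociated primes\<close>

text \<open>The descending chain condition for \<open>M/U\<close>, expressed inside \<open>M\<close>: in this form \<open>M/U\<close> and an iterated
  quotient \<open>(M/K)/(U/K)\<close> need not be compared by an isomorphism.\<close>

definition artinian_above :: "('r, 'x) ring_scheme \<Rightarrow> ('r, 'm) module \<Rightarrow> 'm set \<Rightarrow> bool" where
  "artinian_above R M U \<longleftrightarrow>
     (\<forall>W :: nat \<Rightarrow> 'm set. (\<forall>n. submodule (W n) R M \<and> U \<subseteq> W n) \<and> (\<forall>n. W (Suc n) \<subseteq> W n) \<longrightarrow>
        (\<exists>n. \<forall>k\<ge>n. W k = W n))"

lemma artinian_above_mono: "artinian_above R M U \<Longrightarrow> U \<subseteq> V \<Longrightarrow> artinian_above R M V"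
  unfolding artinian_above_def by (meson subset_trans)

lemma artinian_module_surj_iff:
  assumes A: "module R A" and B: "module R B" and f: "f \<in> module_hom R A B"
    and surj: "f ` carrier A = carrier B"
  shows "artinian_module R B \<longleftrightarrow> artinian_above R A {x \<in> carrier A. f x = \<zero>\<^bsub>B\<^esub>}"
proof -
  interpret A: module R A by fact
  interpret B: module R B by fact
  define N where "N = {x \<in> carrier A. f x = \<zero>\<^bsub>B\<^esub>}"
  have iv: "{x \<in> carrier A. f x \<in> f ` W} = W" if W: "submodule W R A" "N \<subseteq> W" for W
  proof
    note W' = W(1)[unfolded A.submodule_iff]
    show "W \<subseteq> {x \<in> carrier A. f x \<in> f ` W}" using W' by blast
    show "{x \<in> carrier A. f x \<in> f ` W} \<subseteq> W"
    proof
      fix x assume "x \<in> {x \<in> carrier A. f x \<in> f ` W}"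
      then obtain w where x: "x \<in> carrier A" and w: "w \<in> W" "f x = f w" by blast
      have wA: "w \<in> carrier A" using w W' by blast
      have "f (x \<ominus>\<^bsub>A\<^esub> w) = \<zero>\<^bsub>B\<^esub>"
        using module_hom_minus[OF A B f x wA] w(2) module_homD(1)[OF f wA]
        by (simp add: B.M.minus_eq B.M.r_neg)
      then have "x \<ominus>\<^bsub>A\<^esub> w \<in> W" using W(2) x wA unfolding N_def by auto
      then have "(x \<ominus>\<^bsub>A\<^esub> w) \<oplus>\<^bsub>A\<^esub> w \<in> W" using W' w(1) by blast
      then show "x \<in> W" using x wA by (simp add: A.M.minus_eq A.M.a_assoc A.M.l_neg)
    qed
  qed
  have vi: "f ` {x \<in> carrier A. f x \<in> W} = W" if "submodule W R B" for W
  proof -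
    have "W \<subseteq> f ` carrier A" using that unfolding surj B.submodule_iff by blast
    then show ?thesis by blast
  qed
  show ?thesis
    unfolding N_def[symmetric]
  proof
    assume art: "artinian_module R B"
    show "artinian_above R A N"
      unfolding artinian_above_def
    proof (intro allI impI)
      fix W :: "nat \<Rightarrow> _" assume W: "(\<forall>n. submodule (W n) R A \<and> N \<subseteq> W n) \<and> (\<forall>n. W (Suc n) \<subseteq> W n)"
      have "(\<forall>n. submodule (f ` W n) R B) \<and> (\<forall>n. f ` W (Suc n) \<subseteq> f ` W n)"
        using W submodule_image[OF A B f] by (simp add: image_mono)
      then obtain n where n: "\<forall>k\<ge>n. f ` W k = f ` W n"
        using art[unfolded artinian_module_def, rule_format, of "\<lambda>n. f ` W n"] by blast
      have "W k = W n" if "k \<ge> n" for k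
      proof -
        have "W k = {x \<in> carrier A. f x \<in> f ` W k}" by (rule iv[symmetric]) (use W in blast)+
        also have "\<dots> = {x \<in> carrier A. f x \<in> f ` W n}" by (simp only: n[rule_format, OF that])
        also have "\<dots> = W n" by (rule iv) (use W in blast)+
        finally show ?thesis .
      qed
      then show "\<exists>n. \<forall>k\<ge>n. W k = W n" by blast
    qed
  next
    assume art: "artinian_above R A N"
    show "artinian_module R B"
      unfolding artinian_module_def
    proof (intro allI impI)
      fix W :: "nat \<Rightarrow> _" assume W: "(\<forall>n. submodule (W n) R B) \<and> (\<forall>n. W (Suc n) \<subseteq> W n)"
      let ?V = "\<lambda>n. {x \<in> carrier A. f x \<in> W n}"
      have "submodule (?V n) R A" for n using submodule_vimage[OF A B f] W by blast
      moreover have "N \<subseteq> ?V n" for n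
      proof -
        have "\<zero>\<^bsub>B\<^esub> \<in> W n" using W unfolding B.submodule_iff by blast
        then show ?thesis unfolding N_def by auto
      qed
      moreover have "?V (Suc n) \<subseteq> ?V n" for n using W by blast
      ultimately obtain n where n: "\<forall>k\<ge>n. ?V k = ?V n"
        using art[unfolded artinian_above_def, rule_format, of ?V] by blast
      have "W k = W n" if "k \<ge> n" for k
      proof -
        have "W k = f ` ?V k" by (rule vi[symmetric]) (use W in blast)
        also have "\<dots> = f ` ?V n" by (simp only: n[rule_format, OF that])
        also have "\<dots> = W n" by (rule vi) (use W in blast)
        finally show ?thesis .
      qed
      then show "\<exists>n. \<forall>k\<ge>n. W k = W n" by blast
    qed
  qed
qed

lemma artinian_above_minimal:
  assumes art: "artinian_above R M U" and ne: "\<W> \<noteq> {}"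
    and sub: "\<And>W. W \<in> \<W> \<Longrightarrow> submodule W R M \<and> U \<subseteq> W"
  obtains W where "W \<in> \<W>" "\<And>V. \<lbrakk>V \<in> \<W>; V \<subseteq> W\<rbrakk> \<Longrightarrow> V = W"
proof (rule ccontr)
  assume "\<not> thesis"
  then have "\<forall>W\<in>\<W>. \<exists>V. V \<in> \<W> \<and> V \<subset> W" using that by blast
  then obtain g where g: "\<And>W. W \<in> \<W> \<Longrightarrow> g W \<in> \<W> \<and> g W \<subset> W" by metis
  obtain W0 where W0: "W0 \<in> \<W>" using ne by blast
  define S where "S n = (g ^^ n) W0" for n
  have S: "S n \<in> \<W>" for n by (induction n) (simp_all add: S_def W0 g)
  have Ss: "S (Suc n) \<subset> S n" for n using g[OF S[of n]] by (simp add: S_def)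
  obtain n where "\<forall>k\<ge>n. S k = S n"
    using art[unfolded artinian_above_def, rule_format, of S] S sub Ss by blast
  then show False using Ss[of n] by (metis le_SucI order_refl psubset_eq)
qed

lemma annihilator_surj_image:
  assumes f: "f \<in> module_hom R A B" and A: "module R A" and surj: "f ` carrier A = carrier B"
  shows "annihilator R B = {a \<in> carrier R. \<forall>x\<in>carrier A. a \<odot>\<^bsub>A\<^esub> x \<in> {x \<in> carrier A. f x = \<zero>\<^bsub>B\<^esub>}}"
proof -
  have "a \<odot>\<^bsub>B\<^esub> f x = \<zero>\<^bsub>B\<^esub> \<longleftrightarrow> a \<odot>\<^bsub>A\<^esub> x \<in> {x \<in> carrier A. f x = \<zero>\<^bsub>B\<^esub>}"
    if "a \<in> carrier R" "x \<in> carrier A" for a x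
    using module_homD(3)[OF f that] module.smult_closed[OF A that] by simp
  then show ?thesis
    unfolding annihilator_def surj[symmetric] by blast
qed

text \<open>The annihilator of \<open>M/U\<close>.\<close>

definition colon_ideal :: "('r, 'x) ring_scheme \<Rightarrow> ('r, 'm) module \<Rightarrow> 'm set \<Rightarrow> 'r set" where
  "colon_ideal R M U = {a \<in> carrier R. \<forall>x\<in>carrier M. a \<odot>\<^bsub>M\<^esub> x \<in> U}"

context plain_module
begin

lemma Koass_iff:
  "\<pp> \<in> Koass R M \<longleftrightarrow> primeideal \<pp> R \<and>
     (\<exists>U. submodule U R M \<and> artinian_above R M U \<and> \<pp> = colon_ideal R M U)"
proof -
  have "artinian_module R (quot_module M U) \<longleftrightarrow> artinian_above R M U"
    and "annihilator R (quot_module M U) = colon_ideal R M U" if U: "submodule U R M" for U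
    using artinian_module_surj_iff[OF module_axioms quot_module_is_module[OF U] coset_hom[OF U]]
      annihilator_surj_image[OF coset_hom[OF U] module_axioms]
    by (simp_all only: quot_module_carrier[OF U] coset_kernel[OF U] colon_ideal_def)
  then show ?thesis unfolding Koass_def by blast
qed

text \<open>A quotient of \<open>M/K\<close> is a quotient of \<open>M\<close> by a submodule containing \<open>K\<close>: the composite
  \<open>M \<rightarrow> M/K \<rightarrow> (M/K)/U'\<close> is onto, and its kernel is the preimage of \<open>U'\<close>.\<close>

lemma Koass_quot_iff:
  assumes K: "submodule K R M"
  shows "\<pp> \<in> Koass R (quot_module M K) \<longleftrightarrow> primeideal \<pp> R \<and>
     (\<exists>U. submodule U R M \<and> K \<subseteq> U \<and> artinian_above R M U \<and> \<pp> = colon_ideal R M U)"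
proof -
  let ?Q = "quot_module M K"
  let ?\<pi> = "\<lambda>x. K +>\<^bsub>M\<^esub> x"
  have Q: "module R ?Q" by (rule quot_module_is_module[OF K])
  interpret Q: plain_module R ?Q by (rule plain_module.intro[OF Q])
  define pre where "pre U' = {x \<in> carrier M. ?\<pi> x \<in> U'}" for U'
  have above: "artinian_above R ?Q U' \<longleftrightarrow> artinian_above R M (pre U')"
    and colon: "colon_ideal R ?Q U' = colon_ideal R M (pre U')" if U': "submodule U' R ?Q" for U'
  proof -
    let ?QQ = "quot_module ?Q U'"
    let ?f = "\<lambda>x. U' +>\<^bsub>?Q\<^esub> (K +>\<^bsub>M\<^esub> x)"
    have QQ: "module R ?QQ" by (rule Q.quot_module_is_module[OF U'])
    have c: "?\<pi> x \<in> carrier ?Q" if "x \<in> carrier M" for x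
      using that by (auto simp: quot_module_carrier[OF K])
    have f: "?f \<in> module_hom R M ?QQ"
      by (rule module_homI)
         (simp_all add: module_homD[OF coset_hom[OF K]] module_homD[OF Q.coset_hom[OF U']] c)
    have surj: "?f ` carrier M = carrier ?QQ"
      unfolding Q.quot_module_carrier[OF U'] quot_module_carrier[OF K] by (simp add: image_image)
    have ker: "{x \<in> carrier M. ?f x = \<zero>\<^bsub>?QQ\<^esub>} = pre U'"
      unfolding pre_def Q.quot_module_zero[OF U'] using Q.coset_eq_submodule_iff[OF U' c] by blast
    have kerQ: "artinian_module R ?QQ \<longleftrightarrow> artinian_above R ?Q U'"
      "annihilator R ?QQ = colon_ideal R ?Q U'"
      using artinian_module_surj_iff[OF Q QQ Q.coset_hom[OF U']]
        annihilator_surj_image[OF Q.coset_hom[OF U'] Q]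
      by (simp_all only: Q.quot_module_carrier[OF U'] Q.coset_kernel[OF U'] colon_ideal_def)
    show "artinian_above R ?Q U' \<longleftrightarrow> artinian_above R M (pre U')"
      using kerQ(1) artinian_module_surj_iff[OF module_axioms QQ f surj] ker by simp
    show "colon_ideal R ?Q U' = colon_ideal R M (pre U')"
      using kerQ(2) annihilator_surj_image[OF f module_axioms surj] ker by (simp add: colon_ideal_def)
  qed
  have pre_sub: "submodule (pre U') R M" "K \<subseteq> pre U'" if U': "submodule U' R ?Q" for U'
  proof -
    show "submodule (pre U') R M"
      unfolding pre_def by (rule submodule_vimage[OF module_axioms Q coset_hom[OF K] U'])
    have "K \<in> U'" using U' unfolding Q.submodule_iff quot_module_zero[OF K] by blast
    moreover have "?\<pi> x = K" if "x \<in> K" for x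
      using coset_eq_submodule_iff[OF K, of x] that submoduleE(1)[OF K] by blast
    ultimately show "K \<subseteq> pre U'" unfolding pre_def using submoduleE(1)[OF K] by auto
  qed
  have ex: "\<exists>U'. submodule U' R ?Q \<and> pre U' = U" if U: "submodule U R M" "K \<subseteq> U" for U
  proof (intro exI conjI)
    show "submodule (?\<pi> ` U) R ?Q" by (rule submodule_image[OF module_axioms Q coset_hom[OF K] U(1)])
    show "pre (?\<pi> ` U) = U"
    proof
      show "U \<subseteq> pre (?\<pi> ` U)" unfolding pre_def using submoduleE(1)[OF U(1)] by blast
      show "pre (?\<pi> ` U) \<subseteq> U"
      proof
        fix x assume "x \<in> pre (?\<pi> ` U)"
        then obtain u where x: "x \<in> carrier M" and u: "u \<in> U" "?\<pi> x = ?\<pi> u" unfolding pre_def by blast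
        have uM: "u \<in> carrier M" using u(1) submoduleE(1)[OF U(1)] by blast
        have "x \<ominus>\<^bsub>M\<^esub> u \<in> U" using coset_eq_iff[OF K x uM] u(2) U(2) by blast
        then have "(x \<ominus>\<^bsub>M\<^esub> u) \<oplus>\<^bsub>M\<^esub> u \<in> U" using submoduleE(5)[OF U(1)] u(1) by blast
        then show "x \<in> U" using x uM by (simp add: M.minus_eq M.a_assoc M.l_neg)
      qed
    qed
  qed
  show ?thesis
    unfolding Q.Koass_iff using above colon pre_sub ex by metis
qed

end

lemma (in primeideal) finite_Inter_imp_subset:
  assumes "finite F" "\<And>h. h \<in> F \<Longrightarrow> ideal (J h) R"
    and "\<And>a. \<lbrakk>a \<in> carrier R; \<forall>h\<in>F. a \<in> J h\<rbrakk> \<Longrightarrow> a \<in> I"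
  shows "\<exists>h\<in>F. J h \<subseteq> I"
  using assms
proof (induction F)
  case empty
  then have "carrier R \<subseteq> I" by blast
  then show ?case using a_subset I_notcarr by blast
next
  case (insert h F)
  show ?case
  proof (cases "J h \<subseteq> I")
    case False
    then obtain b where b: "b \<in> J h" "b \<notin> I" by blast
    have Jh: "ideal (J h) R" using insert.prems(1) by blast
    then have bc: "b \<in> carrier R" using b(1) unfolding ideal_iff by blast
    have "a \<in> I" if a: "a \<in> carrier R" "\<forall>h\<in>F. a \<in> J h" for a
    proof -
      have "a \<otimes> b \<in> J h" using Jh b(1) a(1) unfolding ideal_iff by blast
      moreover have "a \<otimes> b \<in> J k" if k: "k \<in> F" for k
        using ideal.I_r_closed[of "J k" R a b] insert.prems(1)[of k] k a bc by blast
      ultimately have "a \<otimes> b \<in> I" using insert.prems(2)[of "a \<otimes> b"] a(1) bc by blast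
      then show "a \<in> I" using I_prime[OF a(1) bc] b(2) by blast
    qed
    then show ?thesis using insert.IH insert.prems(1) by blast
  qed blast
qed

section \<open>The three comparisons\<close>

locale matlis_setting = plain_module R M
  for R :: "('r, 'x) ring_scheme" (structure) and M :: "('r, 'm) module" (structure) +
  fixes \<mm> I :: "'r set" and E :: "('r, 'e) module"
  assumes noeth: "noetherian_ring R"
    and local: "local_ring_at R \<mm>"
    and I: "ideal I R"
    and hull: "injective_hull R (residue_field_module R \<mm>) E"
begin

abbreviation "N \<equiv> ideal_module R I"
abbreviation "J \<equiv> annihilator R N"
abbreviation "Md \<equiv> matlis_dual R E M"

lemma E_module: "module R E"
  using hull unfolding injective_hull_def injective_module_def by blast

sublocale E: plain_module R E
  by (rule plain_module.intro[OF E_module])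

sublocale Md: plain_module R Md
  by (rule plain_module.intro[OF hom_module_is_module[OF module_axioms E_module]])

lemma I_subset: "I \<subseteq> carrier R"
  using I unfolding R.ideal_iff by blast

lemma I_carrier: "a \<in> I \<Longrightarrow> a \<in> carrier R"
  using I_subset by blast

lemma J_subset: "J \<subseteq> carrier R"
  unfolding annihilator_def by blast

lemma J_kills: "\<lbrakk>j \<in> J; a \<in> I\<rbrakk> \<Longrightarrow> j \<otimes> a = \<zero>"
  unfolding annihilator_def by simp

lemma Md_hom: "h \<in> carrier Md \<Longrightarrow> h \<in> module_hom R M E"
  by (simp add: hom_module_simps)

lemma Md_smult_eq_zero_iff:
  "a \<odot>\<^bsub>Md\<^esub> h = \<zero>\<^bsub>Md\<^esub> \<longleftrightarrow> (\<forall>x\<in>carrier M. a \<odot>\<^bsub>E\<^esub> h x = \<zero>\<^bsub>E\<^esub>)"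
  unfolding hom_module_simps by (auto simp: restrict_def fun_eq_iff)

lemma kappa_eq:
  "kappa R E I M = {x \<in> carrier M. \<forall>\<psi>\<in>module_hom R N Md. \<forall>a\<in>I. \<psi> a x = \<zero>\<^bsub>E\<^esub>}"
  by (rule kappa_eq_annihilated[OF I E_module])

lemma Md_value:
  assumes "\<psi> \<in> module_hom R N Md" "a \<in> I"
  shows "\<psi> a \<in> module_hom R M E"
  using module_homD(1)[OF assms(1)] assms(2) Md_hom by simp

lemma kappa_is_submodule: "submodule (kappa R E I M) R M"
  unfolding submodule_iff kappa_eq
proof (intro conjI ballI)
  show "\<zero>\<^bsub>M\<^esub> \<in> {x \<in> carrier M. \<forall>\<psi>\<in>module_hom R N Md. \<forall>a\<in>I. \<psi> a x = \<zero>\<^bsub>E\<^esub>}"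
    using module_hom_zero[OF module_axioms E_module Md_value] by simp
qed (auto simp: module_homD[OF Md_value])

subsection \<open>Inclusions\<close>

lemma ideal_times_subset_gamma: "ideal_times_module R I M \<subseteq> gamma R I M"
  unfolding ideal_times_module_def
proof (rule generated_submodule_least[OF gamma_is_submodule], clarify)
  fix a x assume a: "a \<in> I" and x: "x \<in> carrier M"
  have "(\<lambda>b. b \<odot>\<^bsub>M\<^esub> x) \<in> module_hom R N M"
    by (rule module_homI) (simp_all add: I_carrier x smult_l_distr smult_assoc1)
  then show "a \<odot>\<^bsub>M\<^esub> x \<in> gamma R I M" using hom_image_in_gamma[OF I _ a] by blast
qed

lemma gamma_subset_annihilated: "gamma R I M \<subseteq> annihilated_by M J"
proof (rule gamma_least[OF I annihilated_by_submodule[OF J_subset]])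
  fix \<phi> a assume \<phi>: "\<phi> \<in> module_hom R N M" and a: "a \<in> I"
  have "j \<odot>\<^bsub>M\<^esub> \<phi> a = \<zero>\<^bsub>M\<^esub>" if j: "j \<in> J" for j
  proof -
    have "j \<odot>\<^bsub>M\<^esub> \<phi> a = \<phi> (j \<otimes> a)"
      using module_homD(3)[OF \<phi>, of j a] j a J_subset by auto
    also have "\<dots> = \<phi> \<zero>\<^bsub>N\<^esub>" using J_kills[OF j a] by simp
    also have "\<dots> = \<zero>\<^bsub>M\<^esub>" by (rule module_hom_zero[OF R.ideal_module_is_module[OF I] module_axioms \<phi>])
    finally show ?thesis .
  qed
  then show "\<phi> a \<in> annihilated_by M J"
    unfolding annihilated_by_def using module_homD(1)[OF \<phi>] a by simp
qed

lemma annihilator_times_subset_kappa: "ideal_times_module R J M \<subseteq> kappa R E I M"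
  unfolding ideal_times_module_def
proof (rule generated_submodule_least[OF kappa_is_submodule], clarify)
  fix j x assume j: "j \<in> J" and x: "x \<in> carrier M"
  have jc: "j \<in> carrier R" using j J_subset by blast
  have "\<psi> a (j \<odot>\<^bsub>M\<^esub> x) = \<zero>\<^bsub>E\<^esub>" if \<psi>: "\<psi> \<in> module_hom R N Md" and a: "a \<in> I" for \<psi> a
  proof -
    have "\<psi> a (j \<odot>\<^bsub>M\<^esub> x) = (j \<odot>\<^bsub>Md\<^esub> \<psi> a) x"
      using module_homD(3)[OF Md_value[OF \<psi> a] jc x] x by (simp add: hom_module_simps)
    also have "j \<odot>\<^bsub>Md\<^esub> \<psi> a = \<psi> (j \<otimes> a)" using module_homD(3)[OF \<psi> jc] a by simp
    also have "\<dots> = \<psi> \<zero>\<^bsub>N\<^esub>" using J_kills[OF j a] by simp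
    also have "\<dots> = \<zero>\<^bsub>Md\<^esub>" by (rule module_hom_zero[OF R.ideal_module_is_module[OF I] Md.module_axioms \<psi>])
    finally show ?thesis using x by (simp add: hom_module_simps)
  qed
  then show "j \<odot>\<^bsub>M\<^esub> x \<in> kappa R E I M" unfolding kappa_eq using jc x by simp
qed

lemma kappa_subset_annihilated: "kappa R E I M \<subseteq> annihilated_by M I"
proof
  fix x assume x: "x \<in> kappa R E I M"
  then have xM: "x \<in> carrier M" unfolding kappa_eq by blast
  have "a \<odot>\<^bsub>M\<^esub> x = \<zero>\<^bsub>M\<^esub>" if a: "a \<in> I" for a
  proof (rule ccontr)
    assume "a \<odot>\<^bsub>M\<^esub> x \<noteq> \<zero>\<^bsub>M\<^esub>"
    then obtain h where h: "h \<in> module_hom R M E" "h (a \<odot>\<^bsub>M\<^esub> x) \<noteq> \<zero>\<^bsub>E\<^esub>"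
      using hom_separating[OF noeth local hull module_axioms zero_submodule, of "a \<odot>\<^bsub>M\<^esub> x"]
        I_carrier[OF a] xM by blast
    note hD = module_homD[OF h(1)]
    \<comment> \<open>The bilinear map \<open>(b, y) \<mapsto> h(by)\<close> does not vanish at \<open>(a, x)\<close>.\<close>
    have "(\<lambda>b. \<lambda>y\<in>carrier M. h (b \<odot>\<^bsub>M\<^esub> y)) \<in> module_hom R N Md"
    proof (rule module_homI)
      show "(\<lambda>y\<in>carrier M. h (b \<odot>\<^bsub>M\<^esub> y)) \<in> carrier Md" if "b \<in> carrier N" for b
        unfolding hom_module_simps
        by (intro IntI restrict_extensional module_homI)
           (use that in \<open>simp_all add: I_carrier hD smult_r_distr E.smult_swap[of b]\<close>)
    qed (simp_all add: hom_module_simps I_carrier hD smult_l_distr smult_assoc1 cong: restrict_cong)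
    moreover have "\<forall>\<psi>\<in>module_hom R N Md. \<forall>b\<in>I. \<psi> b x = \<zero>\<^bsub>E\<^esub>" using x unfolding kappa_eq by blast
    ultimately have "\<forall>b\<in>I. (\<lambda>y\<in>carrier M. h (b \<odot>\<^bsub>M\<^esub> y)) x = \<zero>\<^bsub>E\<^esub>" by (rule bspec[rotated])
    then have "(\<lambda>y\<in>carrier M. h (a \<odot>\<^bsub>M\<^esub> y)) x = \<zero>\<^bsub>E\<^esub>" using a by (rule bspec)
    then show False using h(2) xM by simp
  qed
  then show "x \<in> annihilated_by M I" unfolding annihilated_by_def using xM by blast
qed

subsection \<open>Essential and small submodules\<close>

text \<open>A nonzero submodule of \<open>M[Ann(I)]\<close> contains an element \<open>v\<close> whose annihilator is a prime \<open>\<pp> \<supseteq> Ann(I)\<close>, and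
  then also some \<open>tv \<noteq> 0\<close> in the image of a homomorphism \<open>I \<rightarrow> M\<close>.\<close>

lemma gamma_essential: "essential_submodule R (M\<lparr>carrier := annihilated_by M J\<rparr>) (gamma R I M)"
  unfolding essential_submodule_def submodule_restrict_iff[OF annihilated_by_submodule[OF J_subset]]
proof (intro conjI allI impI)
  show "submodule (gamma R I M) R M" by (rule gamma_is_submodule)
  show "gamma R I M \<subseteq> annihilated_by M J" by (rule gamma_subset_annihilated)
  fix W assume "(submodule W R M \<and> W \<subseteq> annihilated_by M J) \<and> W \<noteq> {\<zero>\<^bsub>M\<lparr>carrier := annihilated_by M J\<rparr>\<^esub>}"
  then have W: "submodule W R M" "W \<subseteq> annihilated_by M J" and W0: "W \<noteq> {\<zero>\<^bsub>M\<^esub>}" by auto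
  note W' = W(1)[unfolded submodule_iff]
  obtain w where w: "w \<in> W" "w \<noteq> \<zero>\<^bsub>M\<^esub>" using W' W0 by blast
  have wM: "w \<in> carrier M" using w W' by blast
  obtain r where r: "r \<in> carrier R" "primeideal (ann_of R M (r \<odot>\<^bsub>M\<^esub> w)) R"
    using multiple_with_prime_annihilator[OF noeth wM w(2)] by blast
  have rw: "r \<odot>\<^bsub>M\<^esub> w \<in> W" using W' r(1) w(1) by blast
  then have rwM: "r \<odot>\<^bsub>M\<^esub> w \<in> carrier M" using W' by blast
  have J: "J \<subseteq> ann_of R M (r \<odot>\<^bsub>M\<^esub> w)" using rw W(2) J_subset unfolding annihilated_by_def by blast
  obtain f x t where f: "f \<in> module_hom R N M" "x \<in> I"
    and t: "t \<in> carrier R" "t \<notin> ann_of R M (r \<odot>\<^bsub>M\<^esub> w)" "f x = t \<odot>\<^bsub>M\<^esub> (r \<odot>\<^bsub>M\<^esub> w)"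
    using hom_from_ideal_onto_multiple[OF noeth I rwM r(2) J] by blast
  have "f x \<in> gamma R I M" by (rule hom_image_in_gamma[OF I f])
  moreover have "f x \<in> W" unfolding t(3) using W' t(1) rw by blast
  moreover have "f x \<noteq> \<zero>\<^bsub>M\<^esub>" using t by simp
  ultimately show "gamma R I M \<inter> W \<noteq> {\<zero>\<^bsub>M\<lparr>carrier := annihilated_by M J\<rparr>\<^esub>}" by auto
qed

text \<open>Dual form of essentiality: the homomorphisms vanishing on \<open>V\<close> form a nonzero submodule of
  \<open>M\<degree>[Ann(I)]\<close>, which therefore meets \<open>\<gamma>(M\<degree>)\<close>; a common nonzero element vanishes on \<open>\<kappa>(M) + V\<close>.\<close>

lemma hom_vanishing_on_kappa:
  assumes V: "submodule V R M" "V \<noteq> carrier M" and JV: "ideal_times_module R J M \<subseteq> V"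
  obtains g y where "g \<in> module_hom R M E" "y \<in> carrier M" "g y \<noteq> \<zero>\<^bsub>E\<^esub>"
    "\<And>v. v \<in> V \<Longrightarrow> g v = \<zero>\<^bsub>E\<^esub>" "\<And>x. x \<in> kappa R E I M \<Longrightarrow> g x = \<zero>\<^bsub>E\<^esub>"
proof -
  have Vc: "V \<subseteq> carrier M" using V(1) unfolding submodule_iff by blast
  then obtain z where z: "z \<in> carrier M" "z \<notin> V" using V(2) by blast
  obtain h0 where h0: "h0 \<in> module_hom R M E" "\<And>v. v \<in> V \<Longrightarrow> h0 v = \<zero>\<^bsub>E\<^esub>" "h0 z \<noteq> \<zero>\<^bsub>E\<^esub>"
    using hom_separating[OF noeth local hull module_axioms V(1) z] by blast
  define h where "h = (\<lambda>x\<in>carrier M. h0 x)"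
  have h: "h \<in> carrier Md" unfolding h_def by (rule hom_module_carrierI[OF h0(1) module_axioms])
  have hV: "h v = \<zero>\<^bsub>E\<^esub>" if "v \<in> V" for v using h0(2) that Vc unfolding h_def by auto
  have "h \<noteq> \<zero>\<^bsub>Md\<^esub>"
  proof
    assume "h = \<zero>\<^bsub>Md\<^esub>"
    then have "h z = \<zero>\<^bsub>Md\<^esub> z" by simp
    then show False using h0(3) z(1) by (simp add: h_def hom_module_simps)
  qed
  then obtain r where r: "r \<in> carrier R" "primeideal (ann_of R Md (r \<odot>\<^bsub>Md\<^esub> h)) R"
    using Md.multiple_with_prime_annihilator[OF noeth h] by blast
  have rh: "r \<odot>\<^bsub>Md\<^esub> h \<in> carrier Md" using r(1) h by (rule Md.smult_closed)
  have J: "J \<subseteq> ann_of R Md (r \<odot>\<^bsub>Md\<^esub> h)"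
  proof
    fix j assume j: "j \<in> J"
    then have jc: "j \<in> carrier R" using J_subset by blast
    have "j \<odot>\<^bsub>Md\<^esub> h = \<zero>\<^bsub>Md\<^esub>"
      unfolding hom_module_simps
    proof (rule restrict_ext)
      fix y assume y: "y \<in> carrier M"
      have "j \<odot>\<^bsub>M\<^esub> y \<in> ideal_times_module R J M"
        unfolding ideal_times_module_def using j y by (intro subsetD[OF generated_submodule_subset]) blast
      then have "h (j \<odot>\<^bsub>M\<^esub> y) = \<zero>\<^bsub>E\<^esub>" using hV JV by blast
      then show "j \<odot>\<^bsub>E\<^esub> h y = \<zero>\<^bsub>E\<^esub>" using module_homD(3)[OF Md_hom[OF h] jc y] by simp
    qed
    then have "j \<odot>\<^bsub>Md\<^esub> (r \<odot>\<^bsub>Md\<^esub> h) = \<zero>\<^bsub>Md\<^esub>"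
      using Md.smult_swap[OF jc r(1) h] Md.smult_r_null[OF r(1)] by simp
    then show "j \<in> ann_of R Md (r \<odot>\<^bsub>Md\<^esub> h)" using jc by blast
  qed
  obtain f x t where f: "f \<in> module_hom R N Md" "x \<in> I"
    and t: "t \<in> carrier R" "t \<notin> ann_of R Md (r \<odot>\<^bsub>Md\<^esub> h)" "f x = t \<odot>\<^bsub>Md\<^esub> (r \<odot>\<^bsub>Md\<^esub> h)"
    using Md.hom_from_ideal_onto_multiple[OF noeth I rh r(2) J] by blast
  have fx: "f x \<in> module_hom R M E" by (rule Md_value[OF f])
  have fx': "f x y = t \<odot>\<^bsub>E\<^esub> (r \<odot>\<^bsub>E\<^esub> h y)" if "y \<in> carrier M" for y
    unfolding t(3) using that by (simp add: hom_module_simps)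
  have "\<exists>y\<in>carrier M. f x y \<noteq> \<zero>\<^bsub>E\<^esub>"
  proof (rule ccontr)
    assume "\<not> (\<exists>y\<in>carrier M. f x y \<noteq> \<zero>\<^bsub>E\<^esub>)"
    then have "t \<odot>\<^bsub>Md\<^esub> (r \<odot>\<^bsub>Md\<^esub> h) = \<zero>\<^bsub>Md\<^esub>"
      unfolding hom_module_simps by (intro restrict_ext) (simp add: fx')
    then show False using t(1,2) by simp
  qed
  then obtain y where y: "y \<in> carrier M" "f x y \<noteq> \<zero>\<^bsub>E\<^esub>" by blast
  have fV: "f x v = \<zero>\<^bsub>E\<^esub>" if "v \<in> V" for v
    using fx'[of v] hV[OF that] that Vc t(1) r(1) by (auto simp: E.smult_r_null)
  have "f x u = \<zero>\<^bsub>E\<^esub>" if "u \<in> kappa R E I M" for u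
    using that f unfolding kappa_eq by blast
  with fx y fV show thesis using that by blast
qed

lemma kappa_small:
  "small_submodule R (quot_module M (ideal_times_module R J M))
     (carrier (quot_module (M\<lparr>carrier := kappa R E I M\<rparr>) (ideal_times_module R J M)))"
proof -
  let ?K = "kappa R E I M"
  define T where "T = ideal_times_module R J M"
  have T: "submodule T R M"
    unfolding T_def ideal_times_module_def using J_subset
    by (intro generated_submodule_is_submodule) auto
  have Q: "module R (quot_module M T)" by (rule quot_module_is_module[OF T])
  interpret Q: module R "quot_module M T" by (rule Q)
  have K: "submodule ?K R M" by (rule kappa_is_submodule)
  have Kc: "?K \<subseteq> carrier M" using K unfolding submodule_iff by blast
  have C: "carrier (quot_module (M\<lparr>carrier := ?K\<rparr>) T) = (\<lambda>x. T +>\<^bsub>M\<^esub> x) ` ?K"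
    by (auto simp: quot_module_def A_RCOSETS_def' a_r_coset_def')
  have sub: "submodule ((\<lambda>x. T +>\<^bsub>M\<^esub> x) ` ?K) R (quot_module M T)"
    by (rule submodule_image[OF module_axioms Q coset_hom[OF T] K])
  have False
    if V': "submodule V' R (quot_module M T)" and ne: "V' \<noteq> carrier (quot_module M T)"
      and eq: "(\<lambda>x. T +>\<^bsub>M\<^esub> x) ` ?K <+>\<^bsub>quot_module M T\<^esub> V' = carrier (quot_module M T)" for V'
  proof -
    \<comment> \<open>If \<open>V' \<noteq> M/T\<close> and \<open>\<kappa>(M)/T\<close> span \<open>M/T\<close>, then \<open>M = \<kappa>(M) + V\<close>, so a homomorphism that vanishes on
      both \<open>\<kappa>(M)\<close> and \<open>V\<close> is zero.\<close>
    define V where "V = {x \<in> carrier M. T +>\<^bsub>M\<^esub> x \<in> V'}"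
    have V: "submodule V R M"
      unfolding V_def by (rule submodule_vimage[OF module_axioms Q coset_hom[OF T] V'])
    have V'c: "V' \<subseteq> (\<lambda>x. T +>\<^bsub>M\<^esub> x) ` carrier M"
      using V' unfolding Q.submodule_iff quot_module_carrier[OF T] by blast
    have "V \<noteq> carrier M"
    proof
      assume "V = carrier M"
      then have "(\<lambda>x. T +>\<^bsub>M\<^esub> x) ` carrier M \<subseteq> V'" unfolding V_def by blast
      then show False using ne V'c unfolding quot_module_carrier[OF T] by blast
    qed
    moreover have "T \<subseteq> V"
    proof
      fix u assume u: "u \<in> T"
      then have uM: "u \<in> carrier M" using T unfolding submodule_iff by blast
      have "T +>\<^bsub>M\<^esub> u = \<zero>\<^bsub>quot_module M T\<^esub>"
        using coset_eq_submodule_iff[OF T uM] u quot_module_zero[OF T] by simp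
      moreover have "\<zero>\<^bsub>quot_module M T\<^esub> \<in> V'" using V' unfolding Q.submodule_iff by blast
      ultimately show "u \<in> V" unfolding V_def using uM by simp
    qed
    ultimately obtain g y where g: "g \<in> module_hom R M E" "y \<in> carrier M" "g y \<noteq> \<zero>\<^bsub>E\<^esub>"
      and gV: "\<And>v. v \<in> V \<Longrightarrow> g v = \<zero>\<^bsub>E\<^esub>" and gK: "\<And>x. x \<in> ?K \<Longrightarrow> g x = \<zero>\<^bsub>E\<^esub>"
      using hom_vanishing_on_kappa[OF V] unfolding T_def by blast
    have "T +>\<^bsub>M\<^esub> y \<in> carrier (quot_module M T)" using g(2) by (auto simp: quot_module_carrier[OF T])
    then obtain c d where c: "c \<in> ?K" and d: "d \<in> V'"
      and cd: "T +>\<^bsub>M\<^esub> y = (T +>\<^bsub>M\<^esub> c) \<oplus>\<^bsub>quot_module M T\<^esub> d"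
      unfolding eq[symmetric] set_add_def' by blast
    obtain v where v: "v \<in> carrier M" "d = T +>\<^bsub>M\<^esub> v" using d V'c by blast
    have vV: "v \<in> V" unfolding V_def using v d by blast
    have cM: "c \<in> carrier M" using c Kc by blast
    have "T +>\<^bsub>M\<^esub> y = T +>\<^bsub>M\<^esub> (c \<oplus>\<^bsub>M\<^esub> v)" using cd v quot_module_add[OF T cM v(1)] by simp
    then have "y \<ominus>\<^bsub>M\<^esub> (c \<oplus>\<^bsub>M\<^esub> v) \<in> T" using coset_eq_iff[OF T g(2)] cM v(1) by blast
    then have "g (y \<ominus>\<^bsub>M\<^esub> (c \<oplus>\<^bsub>M\<^esub> v)) = \<zero>\<^bsub>E\<^esub>" using gV \<open>T \<subseteq> V\<close> by blast
    moreover have "g (c \<oplus>\<^bsub>M\<^esub> v) = \<zero>\<^bsub>E\<^esub>"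
      using module_homD(2)[OF g(1) cM v(1)] gK[OF c] gV[OF vV] by simp
    ultimately have "g y \<ominus>\<^bsub>E\<^esub> \<zero>\<^bsub>E\<^esub> = \<zero>\<^bsub>E\<^esub>"
      using module_hom_minus[OF module_axioms E_module g(1,2), of "c \<oplus>\<^bsub>M\<^esub> v"] cM v(1) by simp
    then have "g y = \<zero>\<^bsub>E\<^esub>"
      by (rule E.minus_eq_zero_imp_eq[OF module_homD(1)[OF g(1,2)] E.M.zero_closed])
    with g(3) show False by blast
  qed
  then show ?thesis
    unfolding T_def[symmetric] C small_submodule_def using sub by blast
qed

subsection \<open>Associated and coassociated primes\<close>

text \<open>The element \<open>tw\<close> of \<open>\<gamma>(M)\<close> obtained from an element \<open>w\<close> with prime annihilator \<open>\<pp>\<close> has the same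
  annihilator, because \<open>t \<notin> \<pp>\<close>.\<close>

lemma Ass_gamma: "Ass R (M\<lparr>carrier := gamma R I M\<rparr>) = Ass R M \<inter> Supp R N"
proof
  have gM: "gamma R I M \<subseteq> carrier M" using gamma_is_submodule unfolding submodule_iff by blast
  show "Ass R (M\<lparr>carrier := gamma R I M\<rparr>) \<subseteq> Ass R M \<inter> Supp R N"
  proof
    fix \<pp> assume "\<pp> \<in> Ass R (M\<lparr>carrier := gamma R I M\<rparr>)"
    then obtain x where p: "primeideal \<pp> R" and x: "x \<in> gamma R I M" "\<pp> = ann_of R M x"
      unfolding Ass_def by auto
    have "J \<subseteq> \<pp>"
      unfolding x(2) using x(1) gamma_subset_annihilated J_subset unfolding annihilated_by_def by blast
    then show "\<pp> \<in> Ass R M \<inter> Supp R N"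
      unfolding Supp_ideal_module[OF noeth R.is_cring I] Ass_def using p x gM by blast
  qed
  show "Ass R M \<inter> Supp R N \<subseteq> Ass R (M\<lparr>carrier := gamma R I M\<rparr>)"
  proof
    fix \<pp> assume "\<pp> \<in> Ass R M \<inter> Supp R N"
    then obtain w where p: "primeideal \<pp> R" and J: "J \<subseteq> \<pp>" and w: "w \<in> carrier M" "\<pp> = ann_of R M w"
      unfolding Supp_ideal_module[OF noeth R.is_cring I] Ass_def by blast
    note p' = p[unfolded w(2)]
    obtain f x t where f: "f \<in> module_hom R N M" "x \<in> I"
      and t: "t \<in> carrier R" "t \<notin> ann_of R M w" "f x = t \<odot>\<^bsub>M\<^esub> w"
      using hom_from_ideal_onto_multiple[OF noeth I w(1) p' J[unfolded w(2)]] by blast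
    have "ann_of R M (f x) = \<pp>"
      unfolding t(3) w(2) by (rule ann_of_prime_multiple[OF p' w(1) t(1,2)])
    moreover have "f x \<in> gamma R I M" by (rule hom_image_in_gamma[OF I f])
    ultimately show "\<pp> \<in> Ass R (M\<lparr>carrier := gamma R I M\<rparr>)"
      unfolding Ass_def using p by auto
  qed
qed

text \<open>An artinian module embeds into a finite power of \<open>E\<close>, since a minimal finite intersection of
  kernels must vanish; its annihilator is then a finite intersection of annihilators of
  homomorphisms, and a prime ideal of this form is one of them.\<close>

lemma Koass_imp_annihilator_of_hom:
  assumes U: "submodule U R M" and art: "artinian_above R M U"
    and p: "primeideal (colon_ideal R M U) R"
  obtains h where "h \<in> carrier Md" "\<And>u. u \<in> U \<Longrightarrow> h u = \<zero>\<^bsub>E\<^esub>" "ann_of R Md h = colon_ideal R M U"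
proof -
  interpret P: primeideal "colon_ideal R M U" R by (rule p)
  have Uc: "U \<subseteq> carrier M" using U unfolding submodule_iff by blast
  define H where "H = {h \<in> carrier Md. \<forall>u\<in>U. h u = \<zero>\<^bsub>E\<^esub>}"
  define ker where "ker F = {x \<in> carrier M. \<forall>h\<in>F. h x = \<zero>\<^bsub>E\<^esub>}" for F :: "('m \<Rightarrow> 'e) set"
  define \<W> where "\<W> = {ker F |F. finite F \<and> F \<subseteq> H}"
  have Hh: "h \<in> module_hom R M E" if "h \<in> H" for h using that Md_hom unfolding H_def by blast
  have ne: "\<W> \<noteq> {}" unfolding \<W>_def by blast
  have sub: "submodule W R M \<and> U \<subseteq> W" if "W \<in> \<W>" for W
  proof -
    obtain F where F: "F \<subseteq> H" "W = ker F" using \<open>W \<in> \<W>\<close> unfolding \<W>_def by blast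
    have Fh: "h \<in> module_hom R M E" if "h \<in> F" for h using that F(1) Hh by blast
    have "submodule W R M"
      unfolding submodule_iff F(2) ker_def
    proof (intro conjI ballI)
      show "\<zero>\<^bsub>M\<^esub> \<in> {x \<in> carrier M. \<forall>h\<in>F. h x = \<zero>\<^bsub>E\<^esub>}"
        using module_hom_zero[OF module_axioms E_module Fh] by simp
    qed (auto simp: module_homD[OF Fh])
    moreover have "U \<subseteq> W" unfolding F(2) ker_def using F(1) Uc unfolding H_def by blast
    ultimately show ?thesis ..
  qed
  obtain W where W: "W \<in> \<W>" and min: "\<And>V. \<lbrakk>V \<in> \<W>; V \<subseteq> W\<rbrakk> \<Longrightarrow> V = W"
    using artinian_above_minimal[OF art ne sub] by blast
  then obtain F where F: "finite F" "F \<subseteq> H" "W = ker F" unfolding \<W>_def by blast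
  have kerU: "x \<in> U" if x: "x \<in> ker F" for x
  proof (rule ccontr)
    assume xU: "x \<notin> U"
    have xM: "x \<in> carrier M" using x unfolding ker_def by blast
    obtain h0 where h0: "h0 \<in> module_hom R M E" "\<And>u. u \<in> U \<Longrightarrow> h0 u = \<zero>\<^bsub>E\<^esub>" "h0 x \<noteq> \<zero>\<^bsub>E\<^esub>"
      using hom_separating[OF noeth local hull module_axioms U xM xU] by blast
    define h where "h = (\<lambda>x\<in>carrier M. h0 x)"
    have "h \<in> carrier Md" unfolding h_def by (rule hom_module_carrierI[OF h0(1) module_axioms])
    then have h: "h \<in> H" unfolding H_def h_def using h0(2) Uc by auto
    have "ker (insert h F) \<in> \<W>" unfolding \<W>_def using F h by blast
    moreover have "ker (insert h F) \<subseteq> W" unfolding F(3) ker_def by blast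
    ultimately have "ker (insert h F) = W" by (rule min)
    then have "x \<in> ker (insert h F)" using x F(3) by simp
    then have "h x = \<zero>\<^bsub>E\<^esub>" unfolding ker_def by blast
    then show False using h0(3) xM unfolding h_def by simp
  qed
  have ann: "a \<odot>\<^bsub>Md\<^esub> h = \<zero>\<^bsub>Md\<^esub> \<longleftrightarrow> (\<forall>x\<in>carrier M. h (a \<odot>\<^bsub>M\<^esub> x) = \<zero>\<^bsub>E\<^esub>)"
    if a: "a \<in> carrier R" and h: "h \<in> carrier Md" for a h
    unfolding Md_smult_eq_zero_iff using module_homD(3)[OF Md_hom[OF h] a] by simp
  have "\<exists>h\<in>F. ann_of R Md h \<subseteq> colon_ideal R M U"
  proof (rule P.finite_Inter_imp_subset[OF F(1)])
    show "ideal (ann_of R Md h) R" if "h \<in> F" for h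
      using that F(2) unfolding H_def by (intro Md.annihilator_ideal) blast
    fix a assume a: "a \<in> carrier R" "\<forall>h\<in>F. a \<in> ann_of R Md h"
    have "a \<odot>\<^bsub>M\<^esub> x \<in> ker F" if x: "x \<in> carrier M" for x
    proof -
      have "h (a \<odot>\<^bsub>M\<^esub> x) = \<zero>\<^bsub>E\<^esub>" if h: "h \<in> F" for h
      proof -
        have "h \<in> carrier Md" using h F(2) unfolding H_def by blast
        moreover have "a \<odot>\<^bsub>Md\<^esub> h = \<zero>\<^bsub>Md\<^esub>" using a(2) h by blast
        ultimately show ?thesis using ann[OF a(1)] x by blast
      qed
      then show ?thesis unfolding ker_def using a(1) x by simp
    qed
    then show "a \<in> colon_ideal R M U" unfolding colon_ideal_def using a(1) kerU by blast
  qed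
  then obtain h where h: "h \<in> F" "ann_of R Md h \<subseteq> colon_ideal R M U" by blast
  have hH: "h \<in> carrier Md" "\<And>u. u \<in> U \<Longrightarrow> h u = \<zero>\<^bsub>E\<^esub>" using h(1) F(2) unfolding H_def by blast+
  have "colon_ideal R M U \<subseteq> ann_of R Md h"
    unfolding colon_ideal_def using ann[OF _ hH(1)] hH(2) by blast
  with h(2) have "ann_of R Md h = colon_ideal R M U" by blast
  then show thesis using that hH by blast
qed

text \<open>If \<open>M/U\<close> is artinian with prime annihilator \<open>\<pp> \<supseteq> Ann(I)\<close>, take \<open>h: M/U \<rightarrow> E\<close> with annihilator \<open>\<pp>\<close>. Some
  multiple \<open>th\<close> with \<open>t \<notin> \<pp>\<close> lies in \<open>\<gamma>(M\<degree>)\<close>, hence vanishes on \<open>\<kappa>(M)\<close>. Its kernel \<open>V\<close> contains \<open>U\<close>, so that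
  \<open>M/V\<close> is artinian, and the annihilator of \<open>M/V\<close> is that of \<open>th\<close>, which is \<open>\<pp>\<close>.\<close>

lemma Koass_quot_kappa: "Koass R (quot_module M (kappa R E I M)) = Koass R M \<inter> Supp R N"
proof
  note K = kappa_is_submodule
  show "Koass R (quot_module M (kappa R E I M)) \<subseteq> Koass R M \<inter> Supp R N"
  proof
    fix \<pp> assume "\<pp> \<in> Koass R (quot_module M (kappa R E I M))"
    then obtain U where p: "primeideal \<pp> R" and U: "submodule U R M" "kappa R E I M \<subseteq> U"
      "artinian_above R M U" "\<pp> = colon_ideal R M U"
      unfolding Koass_quot_iff[OF K] by blast
    have "j \<odot>\<^bsub>M\<^esub> x \<in> U" if "j \<in> J" "x \<in> carrier M" for j x
    proof -
      have "j \<odot>\<^bsub>M\<^esub> x \<in> ideal_times_module R J M"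
        unfolding ideal_times_module_def
        using that by (intro subsetD[OF generated_submodule_subset]) blast
      then show ?thesis using annihilator_times_subset_kappa U(2) by blast
    qed
    then have "J \<subseteq> \<pp>" unfolding U(4) colon_ideal_def using J_subset by blast
    then show "\<pp> \<in> Koass R M \<inter> Supp R N"
      unfolding Supp_ideal_module[OF noeth R.is_cring I] using p U Koass_iff by blast
  qed
  show "Koass R M \<inter> Supp R N \<subseteq> Koass R (quot_module M (kappa R E I M))"
  proof
    fix \<pp> assume "\<pp> \<in> Koass R M \<inter> Supp R N"
    then obtain U where p: "primeideal \<pp> R" and J: "J \<subseteq> \<pp>" and U: "submodule U R M"
      "artinian_above R M U" "\<pp> = colon_ideal R M U"
      unfolding Supp_ideal_module[OF noeth R.is_cring I] using Koass_iff by blast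
    obtain h where h: "h \<in> carrier Md" "\<And>u. u \<in> U \<Longrightarrow> h u = \<zero>\<^bsub>E\<^esub>" "ann_of R Md h = \<pp>"
      using Koass_imp_annihilator_of_hom[OF U(1,2) p[unfolded U(3)]] unfolding U(3) by blast
    note p' = p[folded h(3)]
    obtain f x t where f: "f \<in> module_hom R N Md" "x \<in> I"
      and t: "t \<in> carrier R" "t \<notin> ann_of R Md h" "f x = t \<odot>\<^bsub>Md\<^esub> h"
      using Md.hom_from_ideal_onto_multiple[OF noeth I h(1) p' J[folded h(3)]] by blast
    have annf: "ann_of R Md (f x) = \<pp>"
      unfolding t(3) using Md.ann_of_prime_multiple[OF p' h(1) t(1,2)] h(3) by simp
    have fx: "f x \<in> module_hom R M E" by (rule Md_value[OF f])
    define V where "V = {y \<in> carrier M. f x y = \<zero>\<^bsub>E\<^esub>}"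
    have "submodule V R M" unfolding V_def by (rule submodule_kernel[OF module_axioms E_module fx])
    moreover have "kappa R E I M \<subseteq> V" unfolding V_def kappa_eq using f by blast
    moreover have "U \<subseteq> V"
    proof
      fix u assume u: "u \<in> U"
      then have uM: "u \<in> carrier M" using U(1) unfolding submodule_iff by blast
      have "f x u = t \<odot>\<^bsub>E\<^esub> h u" unfolding t(3) using uM by (simp add: hom_module_simps)
      then show "u \<in> V" unfolding V_def using uM h(2)[OF u] t(1) by (simp add: E.smult_r_null)
    qed
    then have "artinian_above R M V" using artinian_above_mono U(2) by blast
    moreover have "\<pp> = colon_ideal R M V"
    proof -
      have "a \<odot>\<^bsub>Md\<^esub> f x = \<zero>\<^bsub>Md\<^esub> \<longleftrightarrow> (\<forall>y\<in>carrier M. a \<odot>\<^bsub>M\<^esub> y \<in> V)" if a: "a \<in> carrier R" for a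
        unfolding Md_smult_eq_zero_iff V_def using module_homD(3)[OF fx a] a by simp
      then show ?thesis unfolding annf[symmetric] colon_ideal_def by blast
    qed
    ultimately show "\<pp> \<in> Koass R (quot_module M (kappa R E I M))"
      unfolding Koass_quot_iff[OF K] using p by blast
  qed
qed

end

theorem mainTheorem10:
  fixes R :: "('r, 'x) ring_scheme"
    and \<mm> I :: "'r set"
    and E :: "('r, 'e) module"
    and M :: "('r, 'm) module"
  assumes "noetherian_ring R"
    and "local_ring_at R \<mm>"
    and "ideal I R"
    and "injective_hull R (residue_field_module R \<mm>) E"
    and "module R M"
  shows "(ideal_times_module R I M \<subseteq> gamma R I M
        \<and> gamma R I M \<subseteq> annihilated_by M (annihilator R (ideal_module R I))
        \<and> ideal_times_module R (annihilator R (ideal_module R I)) M \<subseteq> kappa R E I M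
        \<and> kappa R E I M \<subseteq> annihilated_by M I)
    \<and> (essential_submodule R
          (M\<lparr>carrier := annihilated_by M (annihilator R (ideal_module R I))\<rparr>)
          (gamma R I M)
        \<and> small_submodule R
          (quot_module M (ideal_times_module R (annihilator R (ideal_module R I)) M))
          (carrier (quot_module (M\<lparr>carrier := kappa R E I M\<rparr>)
             (ideal_times_module R (annihilator R (ideal_module R I)) M))))
    \<and> (Ass R (M\<lparr>carrier := gamma R I M\<rparr>) = Ass R M \<inter> Supp R (ideal_module R I)
        \<and> Koass R (quot_module M (kappa R E I M))
            = Koass R M \<inter> Supp R (ideal_module R I))"
proof -
  interpret matlis_setting R M \<mm> I E
    using assms by (intro matlis_setting.intro plain_module.intro matlis_setting_axioms.intro)
  show ?thesis
    by (intro conjI ideal_times_subset_gamma gamma_subset_annihilated annihilator_times_subset_kappa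
        kappa_subset_annihilated gamma_essential kappa_small Ass_gamma Koass_quot_kappa)
qed

end
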